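(* Let $(G,\cdot)$ be an infinite group whose theory is dp-minimal and $\omega$-categorical. Then $G$ contains an infinite $\emptyset$-definable abelian subgroup.
   Context: A complete theory $T$ (with monster model $\mathfrak{C}$) is dp-minimal if there do not exist formulas $\varphi(x,y)$, $\psi(x,z)$ with $x$ a single variable, and sequences $\langle a_i : i<\omega\rangle$, $\langle b_j : j<\omega\rangle$ (with $|a_i|=|y|$, $|b_j|=|z|$) such that for all $i,j<\omega$ there is $c_{i,j}\in\mathfrak{C}$ with: for all $i'$, $\varphi(c_{i,j},a_{i'})$ holds iff $i'=i$, and for all $j'$, $\psi(c_{i,j},b_{j'})$ holds iff $j'=j$. A structure is dp-minimal (resp. $\omega$-categorical) if its complete theory is. $\emptyset$-definable means definable without parameters. *)

theory Defs
  imports "HOL-Algebra.Group"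
begin

section \<open>First-order logic in the language with one binary function symbol\<close>

text \<open>Bound variables are de Bruijn indices: in \<open>Exists \<phi>\<close> the variable \<open>0\<close> of \<open>\<phi>\<close> is
  bound and the variable \<open>Suc n\<close> of \<open>\<phi>\<close> is the variable \<open>n\<close> outside.\<close>

datatype gterm = Var nat | Times gterm gterm

datatype gform = Eq gterm gterm | Neg gform | And gform gform | Exists gform

record 'a gstruct =
  univ :: "'a set"
  mul :: "'a \<Rightarrow> 'a \<Rightarrow> 'a"

definition is_struct :: "'a gstruct \<Rightarrow> bool" where
  "is_struct M \<longleftrightarrow> univ M \<noteq> {} \<and> (\<forall>x\<in>univ M. \<forall>y\<in>univ M. mul M x y \<in> univ M)"

primrec gval :: "'a gstruct \<Rightarrow> (nat \<Rightarrow> 'a) \<Rightarrow> gterm \<Rightarrow> 'a" where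
  "gval M e (Var n) = e n"
| "gval M e (Times s t) = mul M (gval M e s) (gval M e t)"

primrec gsat :: "'a gstruct \<Rightarrow> (nat \<Rightarrow> 'a) \<Rightarrow> gform \<Rightarrow> bool" where
  "gsat M e (Eq s t) \<longleftrightarrow> gval M e s = gval M e t"
| "gsat M e (Neg \<phi>) \<longleftrightarrow> \<not> gsat M e \<phi>"
| "gsat M e (And \<phi> \<psi>) \<longleftrightarrow> gsat M e \<phi> \<and> gsat M e \<psi>"
| "gsat M e (Exists \<phi>) \<longleftrightarrow> (\<exists>c\<in>univ M. gsat M (case_nat c e) \<phi>)"

primrec tvars :: "gterm \<Rightarrow> nat set" where
  "tvars (Var n) = {n}"
| "tvars (Times s t) = tvars s \<union> tvars t"

primrec fvars :: "gform \<Rightarrow> nat set" where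
  "fvars (Eq s t) = tvars s \<union> tvars t"
| "fvars (Neg \<phi>) = fvars \<phi>"
| "fvars (And \<phi> \<psi>) = fvars \<phi> \<union> fvars \<psi>"
| "fvars (Exists \<phi>) = {n. Suc n \<in> fvars \<phi>}"

definition Th :: "'a gstruct \<Rightarrow> gform set" where
  "Th M = {\<phi>. fvars \<phi> = {} \<and> (\<forall>e. range e \<subseteq> univ M \<longrightarrow> gsat M e \<phi>)}"

definition is_model :: "gform set \<Rightarrow> 'a gstruct \<Rightarrow> bool" where
  "is_model T M \<longleftrightarrow> is_struct M \<and> (\<forall>\<phi>\<in>T. \<forall>e. range e \<subseteq> univ M \<longrightarrow> gsat M e \<phi>)"

definition isomorphic :: "'a gstruct \<Rightarrow> 'b gstruct \<Rightarrow> bool" where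
  "isomorphic M N \<longleftrightarrow> (\<exists>f. bij_betw f (univ M) (univ N) \<and>
     (\<forall>x\<in>univ M. \<forall>y\<in>univ M. f (mul M x y) = mul N (f x) (f y)))"

definition zero_definable :: "'a gstruct \<Rightarrow> 'a set \<Rightarrow> bool" where
  "zero_definable M H \<longleftrightarrow>
     (\<exists>\<phi>. fvars \<phi> \<subseteq> {0} \<and> H = {c \<in> univ M. gsat M (\<lambda>_. c) \<phi>})"


section \<open>Model-theoretic notions\<close>

text \<open>Every countably infinite structure is isomorphic to one whose universe is an infinite
  subset of \<^typ>\<open>nat\<close>, so this says that \<open>T\<close> has exactly one countably infinite model up to
  isomorphism.\<close>

definition omega_categorical :: "gform set \<Rightarrow> bool" where
  "omega_categorical T \<longleftrightarrow>
     (\<exists>M :: nat gstruct. is_model T M \<and> infinite (univ M) \<and>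
        (\<forall>N :: nat gstruct. is_model T N \<and> infinite (univ N) \<longrightarrow> isomorphic M N))"

text \<open>Every finitely satisfiable set \<open>p\<close> of formulas in one variable over a countable parameter
  set is realised.  The sequence \<open>e\<close> enumerates the parameters; in the formulas of \<open>p\<close> the
  variable \<open>0\<close> is the object variable and \<open>Suc n\<close> stands for the parameter \<open>e n\<close>.\<close>

definition aleph1_saturated :: "'a gstruct \<Rightarrow> bool" where
  "aleph1_saturated M \<longleftrightarrow>
     (\<forall>e p. range e \<subseteq> univ M \<longrightarrow>
        (\<forall>q. finite q \<and> q \<subseteq> p \<longrightarrow> (\<exists>c\<in>univ M. \<forall>\<phi>\<in>q. gsat M (case_nat c e) \<phi>)) \<longrightarrow>
        (\<exists>c\<in>univ M. \<forall>\<phi>\<in>p. gsat M (case_nat c e) \<phi>))"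

text \<open>A monster model is a \<open>\<kappa>\<close>-saturated, strongly \<open>\<kappa>\<close>-homogeneous model for some large
  cardinal number \<open>\<kappa>\<close>.  We only ask for the part that does not depend on the choice of
  \<open>\<kappa>\<close>, namely saturation over countable sets; thus every monster model in the usual sense
  is covered.\<close>

definition monster_model :: "gform set \<Rightarrow> 'a gstruct \<Rightarrow> bool" where
  "monster_model T C \<longleftrightarrow> is_model T C \<and> aleph1_saturated C"

text \<open>The value of \<open>\<phi>(x,y)\<close> at \<open>x = c\<close> and \<open>y = a\<close>: the variable \<open>x\<close> has index \<open>0\<close>, and the
  tuple \<open>y\<close> occupies the indices \<open>1, \<dots>, length a\<close>.\<close>

definition holds_at :: "'a gstruct \<Rightarrow> gform \<Rightarrow> 'a \<Rightarrow> 'a list \<Rightarrow> bool" where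
  "holds_at M \<phi> c a \<longleftrightarrow> gsat M (case_nat c (\<lambda>k. a ! k)) \<phi>"

text \<open>Dp-minimality of a complete theory \<open>T\<close> with monster model \<open>C\<close>; here \<open>m\<close> and \<open>n\<close> are the
  lengths of the tuples \<open>y\<close> and \<open>z\<close> of \<open>\<phi>(x,y)\<close> and \<open>\<psi>(x,z)\<close>.\<close>

definition dp_minimal :: "gform set \<Rightarrow> 'a gstruct \<Rightarrow> bool" where
  "dp_minimal T C \<longleftrightarrow> monster_model T C \<and>
     \<not> (\<exists>\<phi> \<psi> m n (a :: nat \<Rightarrow> 'a list) (b :: nat \<Rightarrow> 'a list).
          fvars \<phi> \<subseteq> {..m} \<and> fvars \<psi> \<subseteq> {..n} \<and>
          (\<forall>i. length (a i) = m \<and> set (a i) \<subseteq> univ C) \<and>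
          (\<forall>j. length (b j) = n \<and> set (b j) \<subseteq> univ C) \<and>
          (\<forall>i j. \<exists>c\<in>univ C.
             (\<forall>i'. holds_at C \<phi> c (a i') \<longleftrightarrow> i' = i) \<and>
             (\<forall>j'. holds_at C \<psi> c (b j') \<longleftrightarrow> j' = j)))"

definition group_struct :: "('a, 'b) monoid_scheme \<Rightarrow> 'a gstruct" where
  "group_struct G = \<lparr>univ = carrier G, mul = mult G\<rparr>"

end

theory Submission
  imports Defs "HOL-Library.Countable_Set"
begin

text \<open>By omega-categoricity the theory has a countable atomic model, whose automorphism group has
  finitely many orbits on tuples and for which invariant relations are definable. There the problem
  becomes one about a group \<open>M\<close>. Write \<open>H \<lesssim> K\<close> if \<open>H \<inter> K\<close> has finite index in \<open>H\<close>.
  Dp-minimality makes \<open>\<lesssim>\<close> total on definable subgroups, and a Baldwin--Saxl argument turns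
  \<open>H \<lesssim> C(t)\<close> for all \<open>t \<in> T\<close> into \<open>H \<lesssim> C(T)\<close>. If the FC-center \<open>F\<close> is infinite, its center
  is the required subgroup. Otherwise consider the normal subgroups
  \<open>D(a) = {b. C(a) \<lesssim> C(b)}\<close>, which form a chain. If there is a least one with \<open>a \<notin> F\<close>, its
  center works. If there is none, then for small \<open>D(x)\<close> the center \<open>A\<close> of \<open>D(x)\<close> has finite
  index in \<open>D(x)\<close>, and \<open>u \<mapsto> [u, g]\<close> is an endomorphism of \<open>A\<close>. For \<open>g\<close> with infinite centralizer
  it is nilpotent up to finite groups, with a uniform bound on the nilpotency index because there
  are finitely many orbits; but total comparability produces such \<open>g\<close> of arbitrarily large
  index.\<close>

section \<open>Groups and commensurability\<close>

text \<open>Inside the group theory, definability appears only as invariance under the automorphisms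
  fixing a finite set, and \<open>dp_group\<close> lists everything taken from model theory.
  Saturation is still needed, because dp-minimality forbids infinite patterns while the algebra only
  produces finite ones. So the countable model, coded on the whole type \<open>nat\<close>, stays an
  elementary submodel of the given saturated \<open>C\<close>. The subgroup found in it returns to
  \<open>C\<close> and then to \<open>G\<close> through sentences.

  Comparability has two further uses: infinite definable subgroups intersect in an infinite group,
  and finitely many definable subgroups of infinite index cannot cover a subgroup of finite index.
  Since the group \<open>U\<close> of elements with infinite centralizer has finite index, the
  second fact supplies the element \<open>g\<close> that ends the proof. For it the kernels of the
  iterates of [u, g] on \<open>A\<close> become stationary at some stage \<open>n\<close>, where the
  image of the \<open>n\<close>-th iterate meets \<open>cen {g}\<close> trivially. Both groups are
  infinite, which the first fact forbids.\<close>

locale tgroup =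
  fixes mlt :: "'a \<Rightarrow> 'a \<Rightarrow> 'a" (infixl "\<cdot>" 70) and e :: 'a and iv :: "'a \<Rightarrow> 'a"
  assumes assoc [simp]: "(x \<cdot> y) \<cdot> z = x \<cdot> (y \<cdot> z)"
    and left_one [simp]: "e \<cdot> x = x"
    and left_inv [simp]: "iv x \<cdot> x = e"
begin

lemma iv_cancel_left [simp]: "iv x \<cdot> (x \<cdot> y) = y"
  by (metis assoc left_inv left_one)

lemma left_cancel [simp]: "x \<cdot> y = x \<cdot> z \<longleftrightarrow> y = z"
  by (metis iv_cancel_left)

lemma right_one [simp]: "x \<cdot> e = x"
  by (metis iv_cancel_left left_inv left_cancel)

lemma right_inv [simp]: "x \<cdot> iv x = e"
  by (metis iv_cancel_left left_inv right_one left_cancel)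

lemma iv_cancel_right [simp]: "x \<cdot> (iv x \<cdot> y) = y"
  by (metis assoc right_inv left_one)

lemma right_cancel [simp]: "y \<cdot> x = z \<cdot> x \<longleftrightarrow> y = z"
  by (metis assoc right_inv right_one)

lemma iv_iv [simp]: "iv (iv x) = x"
  by (metis right_inv left_inv left_cancel)

lemma iv_e [simp]: "iv e = e"
  by (metis right_inv left_one)

lemma iv_mlt [simp]: "iv (x \<cdot> y) = iv y \<cdot> iv x"
proof -
  have "(x \<cdot> y) \<cdot> iv (x \<cdot> y) = (x \<cdot> y) \<cdot> (iv y \<cdot> iv x)" unfolding right_inv by simp
  then show ?thesis using left_cancel by blast
qed

definition sg :: "'a set \<Rightarrow> bool" where
  "sg H \<longleftrightarrow> e \<in> H \<and> (\<forall>x\<in>H. \<forall>y\<in>H. x \<cdot> y \<in> H) \<and> (\<forall>x\<in>H. iv x \<in> H)"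

text \<open>For subgroups this says that \<open>H \<inter> K\<close> has finite index in \<open>H\<close>.\<close>

definition ale :: "'a set \<Rightarrow> 'a set \<Rightarrow> bool" (infix "\<lesssim>" 50) where
  "H \<lesssim> K \<longleftrightarrow> (\<exists>S. finite S \<and> H \<subseteq> (\<Union>s\<in>S. (\<cdot>) s ` K))"

text \<open>For subgroups the number of elements is the index of \<open>H \<inter> K\<close> in
  \<open>H\<close>; \<open>K\<close> may stick out of \<open>H\<close>.\<close>

definition cosets :: "'a set \<Rightarrow> 'a set \<Rightarrow> 'a set set" where
  "cosets H K = (\<lambda>x. (\<cdot>) x ` K) ` H"

definition cen :: "'a set \<Rightarrow> 'a set" where
  "cen X = {g. \<forall>x\<in>X. g \<cdot> x = x \<cdot> g}"

definition aut :: "'a set \<Rightarrow> ('a \<Rightarrow> 'a) set" where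
  "aut P = {\<sigma>. bij \<sigma> \<and> (\<forall>x y. \<sigma> (x \<cdot> y) = \<sigma> x \<cdot> \<sigma> y) \<and> (\<forall>p\<in>P. \<sigma> p = p)}"

definition orb :: "'a set \<Rightarrow> 'a \<Rightarrow> 'a set" where
  "orb P x = (\<lambda>\<sigma>. \<sigma> x) ` aut P"

text \<open>Stands for definability over \<open>P\<close>: in the countable model the relations
  invariant over a finite \<open>P\<close> are those definable with parameters in
  \<open>P\<close>.\<close>

definition invt :: "'a set \<Rightarrow> 'a set \<Rightarrow> bool" where
  "invt P X \<longleftrightarrow> (\<forall>\<sigma>\<in>aut P. \<sigma> ` X = X)"

lemma sgI: "e \<in> H \<Longrightarrow> (\<And>x y. x \<in> H \<Longrightarrow> y \<in> H \<Longrightarrow> x \<cdot> y \<in> H) \<Longrightarrow> (\<And>x. x \<in> H \<Longrightarrow> iv x \<in> H) \<Longrightarrow> sg H"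
  by (auto simp: sg_def)

lemma sg_e: "sg H \<Longrightarrow> e \<in> H" and sg_mlt: "sg H \<Longrightarrow> x \<in> H \<Longrightarrow> y \<in> H \<Longrightarrow> x \<cdot> y \<in> H"
  and sg_iv: "sg H \<Longrightarrow> x \<in> H \<Longrightarrow> iv x \<in> H"
  by (auto simp: sg_def)

lemma sg_Int: "sg H \<Longrightarrow> sg K \<Longrightarrow> sg (H \<inter> K)"
  by (auto simp: sg_def)

lemma sg_UNIV [simp]: "sg UNIV"
  by (auto simp: sg_def)

lemma sg_mlt_iff: "sg H \<Longrightarrow> x \<in> H \<Longrightarrow> x \<cdot> y \<in> H \<longleftrightarrow> y \<in> H"
  by (metis sg_mlt sg_iv iv_cancel_left)

lemma sg_mlt_iff': "sg H \<Longrightarrow> y \<in> H \<Longrightarrow> x \<cdot> y \<in> H \<longleftrightarrow> x \<in> H"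
  by (metis sg_mlt sg_iv assoc right_inv right_one)

lemma comm_iv: "g \<cdot> x = x \<cdot> g \<Longrightarrow> iv g \<cdot> x = x \<cdot> iv g"
  by (metis assoc iv_cancel_left right_inv right_one)

lemma sg_cen: "sg (cen X)"
proof (rule sgI)
  show "x \<cdot> y \<in> cen X" if "x \<in> cen X" "y \<in> cen X" for x y
    using that unfolding cen_def by simp (metis assoc)
qed (auto simp: cen_def comm_iv)

lemma cen_antimono: "X \<subseteq> Y \<Longrightarrow> cen Y \<subseteq> cen X"
  by (auto simp: cen_def)

lemma cen_empty [simp]: "cen {} = UNIV"
  by (auto simp: cen_def)

section \<open>Inclusion up to finite index\<close>

lemma in_coset_iff: "x \<in> (\<cdot>) s ` K \<longleftrightarrow> iv s \<cdot> x \<in> K"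
  by (metis imageE imageI iv_cancel_left iv_cancel_right)

lemma ale_iff: "H \<lesssim> K \<longleftrightarrow> (\<exists>S. finite S \<and> (\<forall>h\<in>H. \<exists>s\<in>S. iv s \<cdot> h \<in> K))"
  unfolding ale_def subset_iff UN_iff in_coset_iff by auto

lemma ale_subset: "H \<subseteq> K \<Longrightarrow> H \<lesssim> K"
  unfolding ale_iff by (intro exI[of _ "{e}"]) auto

lemma ale_refl [simp]: "H \<lesssim> H"
  by (rule ale_subset) simp

lemma ale_trans [trans]: assumes "H \<lesssim> K" "K \<lesssim> L" shows "H \<lesssim> L"
proof -
  obtain S where S: "finite S" "\<forall>h\<in>H. \<exists>s\<in>S. iv s \<cdot> h \<in> K"
    using assms(1) unfolding ale_iff by blast
  obtain T where T: "finite T" "\<forall>h\<in>K. \<exists>s\<in>T. iv s \<cdot> h \<in> L"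
    using assms(2) unfolding ale_iff by blast
  define U where "U = (\<Union>s\<in>S. (\<cdot>) s ` T)"
  have "\<exists>u\<in>U. iv u \<cdot> h \<in> L" if h: "h \<in> H" for h
  proof -
    obtain s where s: "s \<in> S" "iv s \<cdot> h \<in> K" using S(2) h by blast
    obtain t where t: "t \<in> T" "iv t \<cdot> (iv s \<cdot> h) \<in> L" using T(2) s(2) by blast
    have "s \<cdot> t \<in> U" unfolding U_def using s t by blast
    moreover have "iv (s \<cdot> t) \<cdot> h \<in> L" using t by simp
    ultimately show ?thesis by blast
  qed
  moreover have "finite U" unfolding U_def using S T by simp
  ultimately show ?thesis unfolding ale_iff by blast
qed

lemma ale_mono: "H \<lesssim> K \<Longrightarrow> H' \<subseteq> H \<Longrightarrow> K \<subseteq> K' \<Longrightarrow> H' \<lesssim> K'"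
  by (meson ale_subset ale_trans)

lemma ale_finite_right: "H \<lesssim> K \<Longrightarrow> finite K \<Longrightarrow> finite H"
  unfolding ale_def by (metis finite_UN finite_imageI finite_subset)

text \<open>A representative \<open>s\<close> may be replaced by any element of \<open>H\<close> in
  its coset of \<open>K\<close>; cosets that miss \<open>H\<close> are dropped.\<close>

lemma ale_rep: assumes "H \<lesssim> K" "sg K"
  shows "\<exists>S. finite S \<and> S \<subseteq> H \<and> (\<forall>h\<in>H. \<exists>s\<in>S. iv s \<cdot> h \<in> K)"
proof -
  obtain S where S: "finite S" "\<forall>h\<in>H. \<exists>s\<in>S. iv s \<cdot> h \<in> K"
    using assms(1) unfolding ale_iff by blast
  define r where "r s = (SOME h. h \<in> H \<and> iv s \<cdot> h \<in> K)" for s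
  define S' where "S' = r ` {s \<in> S. \<exists>h\<in>H. iv s \<cdot> h \<in> K}"
  have r: "r s \<in> H \<and> iv s \<cdot> r s \<in> K" if "h \<in> H" "iv s \<cdot> h \<in> K" for s h
    unfolding r_def by (rule someI) (use that in blast)
  have "\<exists>s\<in>S'. iv s \<cdot> h \<in> K" if h: "h \<in> H" for h
  proof -
    obtain s where s: "s \<in> S" "iv s \<cdot> h \<in> K" using S h by blast
    note r = r[OF h s(2)]
    have "iv (iv s \<cdot> r s) \<cdot> (iv s \<cdot> h) \<in> K" using r s assms(2) by (meson sg_mlt sg_iv)
    then have "iv (r s) \<cdot> h \<in> K" by simp
    then show ?thesis unfolding S'_def using s h by blast
  qed
  moreover have "S' \<subseteq> H" unfolding S'_def using r by blast
  moreover have "finite S'" unfolding S'_def using S(1) by simp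
  ultimately show ?thesis by blast
qed

lemma ale_Int: assumes "H \<lesssim> K" "sg H" "sg K" shows "H \<lesssim> H \<inter> K"
proof -
  obtain S where "finite S" "S \<subseteq> H" "\<forall>h\<in>H. \<exists>s\<in>S. iv s \<cdot> h \<in> K" using ale_rep[of H K] assms by blast
  moreover have "iv s \<cdot> h \<in> H" if "s \<in> S" "h \<in> H" for s h
    using calculation that assms(2) sg_iv sg_mlt by blast
  ultimately show ?thesis unfolding ale_iff by (metis IntI subsetD)
qed

lemma ale_Int2: assumes "H \<lesssim> K" "H \<lesssim> L" "sg H" "sg K" "sg L" shows "H \<lesssim> K \<inter> L"
proof -
  have "H \<lesssim> H \<inter> K" using assms ale_Int by blast
  also have "H \<inter> K \<lesssim> (H \<inter> K) \<inter> L"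
    by (rule ale_Int) (use assms in \<open>auto intro: ale_mono sg_Int\<close>)
  finally show ?thesis by (rule ale_mono) auto
qed

lemma ale_infinite_Int: "H \<lesssim> K \<Longrightarrow> sg H \<Longrightarrow> sg K \<Longrightarrow> infinite H \<Longrightarrow> infinite (H \<inter> K)"
  using ale_Int ale_finite_right by blast

lemma ale_Union: "finite \<H> \<Longrightarrow> (\<And>H. H \<in> \<H> \<Longrightarrow> H \<lesssim> K) \<Longrightarrow> \<Union>\<H> \<lesssim> K"
proof (induction rule: finite_induct)
  case empty
  show ?case unfolding ale_iff by (intro exI[of _ "{}"]) auto
next
  case (insert H \<H>)
  then obtain S T where "finite S" "\<forall>h\<in>H. \<exists>s\<in>S. iv s \<cdot> h \<in> K" "finite T" "\<forall>h\<in>\<Union>\<H>. \<exists>s\<in>T. iv s \<cdot> h \<in> K"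
    using insert.IH[OF insert.prems] insert.prems[of H] unfolding ale_iff by (metis insertCI)
  then show ?case unfolding ale_iff by (intro exI[of _ "S \<union> T"]) (simp, blast)
qed

section \<open>Counting cosets\<close>

lemma coset_eq_iff: assumes "sg K" shows "(\<cdot>) x ` K = (\<cdot>) y ` K \<longleftrightarrow> iv x \<cdot> y \<in> K"
proof
  assume "(\<cdot>) x ` K = (\<cdot>) y ` K"
  then have "y \<in> (\<cdot>) x ` K" using assms sg_e by (metis image_eqI right_one)
  then show "iv x \<cdot> y \<in> K" by (simp add: in_coset_iff)
next
  assume a: "iv x \<cdot> y \<in> K"
  have "iv x \<cdot> z \<in> K \<longleftrightarrow> iv y \<cdot> z \<in> K" for z
  proof -
    have "iv x \<cdot> z = (iv x \<cdot> y) \<cdot> (iv y \<cdot> z)" by simp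
    then show ?thesis using a assms sg_mlt_iff by metis
  qed
  then show "(\<cdot>) x ` K = (\<cdot>) y ` K" by (intro Set.set_eqI) (simp only: in_coset_iff)
qed

lemma ale_cosets: assumes "sg K" shows "H \<lesssim> K \<longleftrightarrow> finite (cosets H K)"
proof
  assume "H \<lesssim> K"
  then obtain S where S: "finite S" "S \<subseteq> H" "\<forall>h\<in>H. \<exists>s\<in>S. iv s \<cdot> h \<in> K" using ale_rep[of H K] assms by blast
  have "cosets H K \<subseteq> (\<lambda>x. (\<cdot>) x ` K) ` S"
  proof
    fix A assume "A \<in> cosets H K"
    then obtain h where h: "h \<in> H" "A = (\<cdot>) h ` K" unfolding cosets_def by blast
    then obtain s where "s \<in> S" "iv s \<cdot> h \<in> K" using S(3) by blast
    then show "A \<in> (\<lambda>x. (\<cdot>) x ` K) ` S" using coset_eq_iff[OF assms, of s h] h by blast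
  qed
  then show "finite (cosets H K)" using S(1) finite_surj by blast
next
  assume "finite (cosets H K)"
  then obtain S where S: "finite S" "S \<subseteq> H" "cosets H K = (\<lambda>x. (\<cdot>) x ` K) ` S"
    unfolding cosets_def by (meson finite_subset_image subset_refl)
  show "H \<lesssim> K" unfolding ale_iff
  proof (intro exI[of _ S] conjI ballI)
    fix h assume "h \<in> H"
    then have "(\<cdot>) h ` K \<in> cosets H K" by (auto simp: cosets_def)
    then obtain s where "s \<in> S" "(\<cdot>) h ` K = (\<cdot>) s ` K" unfolding S(3) by blast
    then show "\<exists>s\<in>S. iv s \<cdot> h \<in> K" using coset_eq_iff[OF assms, of s h] by blast
  qed (fact S)
qed

text \<open>Passing from \<open>K\<close> to the larger \<open>L\<close> coarsens cosets. The map is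
  defined by unions, so no choice of representatives enters.\<close>

lemma cosets_mono_surj: assumes "sg K" "K \<subseteq> L" "sg L"
  shows "\<exists>f. f ` cosets H K = cosets H L \<and> (\<forall>x. f ((\<cdot>) x ` K) = (\<cdot>) x ` L)"
proof -
  define f where "f A = (\<Union>a\<in>A. (\<cdot>) a ` L)" for A
  have "f ((\<cdot>) x ` K) = (\<cdot>) x ` L" for x
  proof (rule Set.set_eqI)
    fix z
    have "z \<in> f ((\<cdot>) x ` K) \<longleftrightarrow> (\<exists>a. iv x \<cdot> a \<in> K \<and> iv a \<cdot> z \<in> L)"
      unfolding f_def UN_iff Bex_def in_coset_iff ..
    also have "\<dots> \<longleftrightarrow> iv x \<cdot> z \<in> L"
    proof
      assume "\<exists>a. iv x \<cdot> a \<in> K \<and> iv a \<cdot> z \<in> L"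
      then obtain a where "iv x \<cdot> a \<in> K" "iv a \<cdot> z \<in> L" by blast
      then have "(iv x \<cdot> a) \<cdot> (iv a \<cdot> z) \<in> L" using assms sg_mlt by blast
      then show "iv x \<cdot> z \<in> L" by simp
    next
      assume "iv x \<cdot> z \<in> L"
      then show "\<exists>a. iv x \<cdot> a \<in> K \<and> iv a \<cdot> z \<in> L" using sg_e[OF assms(1)] by (intro exI[of _ x]) simp
    qed
    finally show "z \<in> f ((\<cdot>) x ` K) \<longleftrightarrow> z \<in> (\<cdot>) x ` L" unfolding in_coset_iff .
  qed
  then show ?thesis unfolding cosets_def image_image by (intro exI[of _ f]) simp
qed

text \<open>If coarsening from \<open>K\<close> to \<open>L\<close> does not lower the finite number
  of cosets, it is injective, so \<open>e\<close> and any \<open>x\<close> in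
  \<open>H \<inter> L\<close> already lie in one coset of \<open>K\<close>. This is how a maximal
  index is exploited in \<open>ale_cen_all\<close> and \<open>ale_chain\<close>.\<close>

lemma cosets_card_eq: assumes "sg K" "K \<subseteq> L" "sg L" "sg H" "finite (cosets H K)"
  "card (cosets H K) \<le> card (cosets H L)" shows "H \<inter> L \<subseteq> K"
proof
  fix x assume x: "x \<in> H \<inter> L"
  obtain f where f: "f ` cosets H K = cosets H L" "\<And>x. f ((\<cdot>) x ` K) = (\<cdot>) x ` L"
    using cosets_mono_surj assms by metis
  have "inj_on f (cosets H K)"
    using f assms by (metis card_image_le eq_card_imp_inj_on order_antisym)
  moreover have "f ((\<cdot>) x ` K) = f ((\<cdot>) e ` K)"
    unfolding f using coset_eq_iff[OF assms(3), of x e] x sg_iv[OF assms(3)] by simp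
  moreover have "(\<cdot>) x ` K \<in> cosets H K" "(\<cdot>) e ` K \<in> cosets H K"
    using x sg_e[OF assms(4)] unfolding cosets_def by (blast intro: imageI)+
  ultimately have "(\<cdot>) x ` K = (\<cdot>) e ` K" by (meson inj_onD)
  then have "iv x \<in> K" using coset_eq_iff[OF assms(1), of x e] by (simp only: right_one)
  then show "x \<in> K" using assms sg_iv iv_iv by metis
qed

end

section \<open>Automorphisms and the Baldwin--Saxl lemma\<close>

text \<open>Dependent choice in which each step sees the whole history. It drives the tree argument
  for \<open>irred\<close>, the construction of elementary submodels and the back-and-forth.\<close>

lemma list_sequence:
  assumes start: "Good l0"
    and step: "\<And>l. Good l \<Longrightarrow> \<exists>x. Good (l @ [x]) \<and> R l x"
  shows "\<exists>t. (\<forall>i<length l0. t i = l0 ! i) \<and>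
    (\<forall>k\<ge>length l0. Good (map t [0..<k]) \<and> R (map t [0..<k]) (t k))"
proof -
  define nx where "nx l = (SOME x. Good (l @ [x]) \<and> R l x)" for l
  have nxt: "Good (l @ [nx l]) \<and> R l (nx l)" if "Good l" for l
    unfolding nx_def by (rule someI_ex) (rule step[OF that])
  define L where "L k = ((\<lambda>l. l @ [nx l]) ^^ k) l0" for k
  have L0: "L 0 = l0" and LS: "L (Suc k) = L k @ [nx (L k)]" for k by (auto simp: L_def)
  have len: "length (L k) = length l0 + k" for k by (induction k) (auto simp: L0 LS)
  have good: "Good (L k)" for k by (induction k) (use start nxt in \<open>auto simp: L0 LS\<close>)
  have pre: "\<exists>u. L (k + d) = L k @ u" for k d by (induction d) (auto simp: LS)
  \<comment> \<open>\<open>L (Suc i)\<close> has more than \<open>i\<close> entries and later stages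
    only append, so this entry is final.\<close>
  define t where "t i = L (Suc i) ! i" for i
  have t: "t i = L k ! i" if "i < length (L k)" for i k
  proof (cases "k \<le> Suc i")
    case True
    then obtain u where "L (Suc i) = L k @ u" using pre[of k "Suc i - k"] by auto
    then show ?thesis using that by (simp add: t_def nth_append)
  next
    case False
    then obtain u where "L k = L (Suc i) @ u" using pre[of "Suc i" "k - Suc i"] by auto
    moreover have "i < length (L (Suc i))" using len by simp
    ultimately show ?thesis by (simp add: t_def nth_append)
  qed
  have mp: "map t [0..<length l0 + k] = L k" for k
    by (rule nth_equalityI) (simp_all add: len t[of _ k])
  have "t i = l0 ! i" if "i < length l0" for i using t[of i 0] that by (simp add: L0)
  moreover have "Good (map t [0..<k]) \<and> R (map t [0..<k]) (t k)" if k: "k \<ge> length l0" for k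
  proof -
    obtain d where d: "k = length l0 + d" using k le_Suc_ex by blast
    have "t k = L (Suc d) ! k" using t[of k "Suc d"] by (simp add: len d)
    also have "\<dots> = nx (L d)" by (simp add: LS nth_append len d)
    finally show ?thesis using mp[of d] nxt[OF good[of d]] good[of d] by (simp del: map_append upt_Suc add: d)
  qed
  ultimately show ?thesis by blast
qed

context tgroup begin

section \<open>Automorphisms fixing a set of parameters\<close>

lemma autI: "bij \<sigma> \<Longrightarrow> (\<And>x y. \<sigma> (x \<cdot> y) = \<sigma> x \<cdot> \<sigma> y) \<Longrightarrow> (\<And>p. p \<in> P \<Longrightarrow> \<sigma> p = p) \<Longrightarrow> \<sigma> \<in> aut P"
  by (simp add: aut_def)

lemma aut_bij: "\<sigma> \<in> aut P \<Longrightarrow> bij \<sigma>" and aut_mlt: "\<sigma> \<in> aut P \<Longrightarrow> \<sigma> (x \<cdot> y) = \<sigma> x \<cdot> \<sigma> y"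
  and aut_fix: "\<sigma> \<in> aut P \<Longrightarrow> p \<in> P \<Longrightarrow> \<sigma> p = p"
  by (auto simp: aut_def)

lemma aut_inj: "\<sigma> \<in> aut P \<Longrightarrow> \<sigma> x = \<sigma> y \<longleftrightarrow> x = y"
  using aut_bij bij_is_inj inj_eq by metis

lemma aut_e: "\<sigma> \<in> aut P \<Longrightarrow> \<sigma> e = e"
  by (metis aut_mlt left_one right_cancel)

lemma aut_iv: "\<sigma> \<in> aut P \<Longrightarrow> \<sigma> (iv x) = iv (\<sigma> x)"
  by (metis aut_mlt aut_e right_inv left_cancel)

lemma aut_mono: "P \<subseteq> Q \<Longrightarrow> aut Q \<subseteq> aut P"
  by (auto simp: aut_def)

lemma aut_id: "(\<lambda>x. x) \<in> aut P"
  by (rule autI) (auto simp: bij_def)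

lemma aut_comp: "\<sigma> \<in> aut P \<Longrightarrow> \<tau> \<in> aut P \<Longrightarrow> \<sigma> \<circ> \<tau> \<in> aut P"
  by (rule autI) (auto simp: aut_mlt aut_fix aut_bij bij_comp)

lemma aut_surj: assumes "\<sigma> \<in> aut P" obtains x where "y = \<sigma> x"
  using aut_bij[OF assms] bij_pointE by metis

lemma aut_inverse: assumes "\<sigma> \<in> aut P"
  shows "\<exists>\<tau>\<in>aut P. (\<forall>x. \<tau> (\<sigma> x) = x) \<and> (\<forall>x. \<sigma> (\<tau> x) = x)"
proof -
  define \<tau> where "\<tau> = inv_into UNIV \<sigma>"
  have b: "bij \<sigma>" using assms aut_bij by blast
  have 1: "\<tau> (\<sigma> x) = x" for x unfolding \<tau>_def by (rule inv_into_f_f) (use b bij_def in auto)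
  have 2: "\<sigma> (\<tau> x) = x" for x unfolding \<tau>_def by (rule f_inv_into_f) (use bij_is_surj[OF b] in auto)
  have "\<tau> \<in> aut P"
  proof (rule autI)
    show "bij \<tau>" using 1 2 by (intro o_bij[of \<sigma>]) auto
    show "\<tau> (x \<cdot> y) = \<tau> x \<cdot> \<tau> y" for x y
      using aut_mlt[OF assms, of "\<tau> x" "\<tau> y"] 1[of "\<tau> x \<cdot> \<tau> y"] by (simp add: 2)
    show "\<tau> p = p" if "p \<in> P" for p using 1[of p] aut_fix[OF assms that] by simp
  qed
  then show ?thesis using 1 2 by blast
qed

lemma invt_mono: "invt P X \<Longrightarrow> P \<subseteq> Q \<Longrightarrow> invt Q X"
  using aut_mono unfolding invt_def by blast

lemma invt_image: "invt P X \<Longrightarrow> \<sigma> \<in> aut P \<Longrightarrow> \<sigma> ` X = X"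
  by (simp add: invt_def)

text \<open>The reverse inclusion comes from the inverse automorphism, which also lies in
  \<open>aut P\<close>.\<close>

lemma invtI: assumes "\<And>\<sigma> x. \<sigma> \<in> aut P \<Longrightarrow> x \<in> X \<Longrightarrow> \<sigma> x \<in> X" shows "invt P X"
  unfolding invt_def
proof (intro ballI equalityI subsetI)
  fix \<sigma> x assume s: "\<sigma> \<in> aut P" and x: "x \<in> X"
  obtain \<tau> where "\<tau> \<in> aut P" "\<sigma> (\<tau> x) = x" using aut_inverse[OF s] by blast
  then show "x \<in> \<sigma> ` X" using assms[of \<tau> x] x by (metis imageI)
qed (use assms in blast)

lemma invt_Int: "invt P X \<Longrightarrow> invt P Y \<Longrightarrow> invt P (X \<inter> Y)"
  by (rule invtI) (use invt_image in blast)

lemma aut_image_Int: "\<sigma> \<in> aut P \<Longrightarrow> \<sigma> ` (X \<inter> Y) = \<sigma> ` X \<inter> \<sigma> ` Y"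
  by (rule image_Int) (use aut_bij bij_is_inj in blast)

lemma aut_image_iff: "\<sigma> \<in> aut P \<Longrightarrow> \<sigma> x \<in> \<sigma> ` X \<longleftrightarrow> x \<in> X"
  by (simp add: inj_image_mem_iff aut_bij bij_is_inj)

lemma aut_image_eqI: assumes "\<sigma> \<in> aut P" "\<And>x. \<sigma> x \<in> Y \<longleftrightarrow> x \<in> X" shows "Y = \<sigma> ` X"
proof
  show "Y \<subseteq> \<sigma> ` X"
  proof
    fix y assume y: "y \<in> Y"
    obtain x where "y = \<sigma> x" using aut_surj[OF assms(1)] .
    then show "y \<in> \<sigma> ` X" using assms(2) y by blast
  qed
qed (use assms(2) in blast)

lemma ale_aut: assumes s: "\<sigma> \<in> aut P" and "H \<lesssim> K" shows "\<sigma> ` H \<lesssim> \<sigma> ` K"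
proof -
  obtain S where S: "finite S" "\<forall>h\<in>H. \<exists>s\<in>S. iv s \<cdot> h \<in> K" using assms(2) unfolding ale_iff by blast
  have "\<exists>s\<in>\<sigma> ` S. iv s \<cdot> h \<in> \<sigma> ` K" if h: "h \<in> \<sigma> ` H" for h
  proof -
    obtain h' where h': "h' \<in> H" "h = \<sigma> h'" using h by blast
    obtain s' where s': "s' \<in> S" "iv s' \<cdot> h' \<in> K" using S(2) h'(1) by blast
    have "iv (\<sigma> s') \<cdot> h = \<sigma> (iv s' \<cdot> h')" using h' s by (simp add: aut_mlt aut_iv)
    then show ?thesis using s' by blast
  qed
  then show ?thesis unfolding ale_iff using S(1) by blast
qed

lemma ale_aut_iff: assumes s: "\<sigma> \<in> aut P" shows "\<sigma> ` H \<lesssim> \<sigma> ` K \<longleftrightarrow> H \<lesssim> K"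
proof
  obtain \<tau> where t: "\<tau> \<in> aut P" "\<forall>x. \<tau> (\<sigma> x) = x" using aut_inverse[OF s] by blast
  assume "\<sigma> ` H \<lesssim> \<sigma> ` K"
  then have "\<tau> ` \<sigma> ` H \<lesssim> \<tau> ` \<sigma> ` K" by (rule ale_aut[OF t(1)])
  then show "H \<lesssim> K" by (simp add: image_image t(2))
qed (rule ale_aut[OF s])

lemma cen_aut: assumes "\<sigma> \<in> aut P" shows "cen (\<sigma> ` X) = \<sigma> ` cen X"
  by (rule aut_image_eqI[OF assms]) (auto simp: cen_def aut_inj[OF assms] aut_mlt[OF assms, symmetric])

lemma cen_aut1: "\<sigma> \<in> aut P \<Longrightarrow> cen {\<sigma> x} = \<sigma> ` cen {x}"
  using cen_aut[of \<sigma> P "{x}"] by simp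

lemma invt_cen: "invt P X \<Longrightarrow> invt P (cen X)"
  unfolding invt_def by (metis cen_aut)

lemma invt_cen1: "x \<in> P \<Longrightarrow> invt P (cen {x})"
  by (rule invt_cen) (auto simp: invt_def aut_fix)

lemma cosets_aut: assumes s: "\<sigma> \<in> aut P" shows "card (cosets (\<sigma> ` H) (\<sigma> ` K)) = card (cosets H K)"
proof -
  have "cosets (\<sigma> ` H) (\<sigma> ` K) = image \<sigma> ` cosets H K"
    unfolding cosets_def image_image by (simp add: aut_mlt[OF s])
  moreover have "inj_on (image \<sigma>) (cosets H K)"
    using aut_bij[OF s] by (meson bij_is_inj inj_on_image inj_on_subset subset_UNIV)
  ultimately show ?thesis using card_image by metis
qed

end

text \<open>The interface to model theory: \<open>finite_orbits\<close> is the Ryll-Nardzewski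
  property, the last two assumptions come from dp-minimality. In the last one the witnesses
  \<open>c\<close> may change with \<open>k\<close>, so it excludes sequences that are irredundant
  merely on every initial segment.\<close>

locale dp_group = tgroup +
  assumes infinite_UNIV: "infinite (UNIV :: 'a set)"
    and finite_orbits: "finite P \<Longrightarrow> finite (range (orb P))"
    and total: "finite P \<Longrightarrow> invt P H \<Longrightarrow> invt P K \<Longrightarrow> sg H \<Longrightarrow> sg K \<Longrightarrow> H \<lesssim> K \<or> K \<lesssim> H"
    and no_irredundant_sequence:
      "\<nexists>t :: nat \<Rightarrow> 'a. \<forall>k. \<exists>c. \<forall>i<k. \<forall>j<k. c i \<cdot> t j = t j \<cdot> c i \<longleftrightarrow> i \<noteq> j"
begin

section \<open>Uniform bounds from finitely many orbits\<close>

lemma orb_self: "x \<in> orb P x"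
  unfolding orb_def by (rule image_eqI[OF _ aut_id]) simp

lemma orb_eqD: assumes "orb P x = orb P y" obtains \<sigma> where "\<sigma> \<in> aut P" "y = \<sigma> x"
  using assms orb_self[of y P] unfolding orb_def by blast

lemma finite_range_invariant:
  assumes "finite P" "\<And>\<sigma> x. \<sigma> \<in> aut P \<Longrightarrow> f (\<sigma> x) = f x" shows "finite (range f)"
proof -
  have "f x = f (SOME y. orb P y = orb P x)" for x
  proof -
    have "orb P (SOME y. orb P y = orb P x) = orb P x" by (rule someI[of _ x]) simp
    then obtain \<sigma> where "\<sigma> \<in> aut P" "x = \<sigma> (SOME y. orb P y = orb P x)" by (rule orb_eqD)
    then show ?thesis using assms(2) by metis
  qed
  then have "range f \<subseteq> (\<lambda>B. f (SOME y. orb P y = B)) ` range (orb P)" by blast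
  then show ?thesis using finite_orbits[OF assms(1)] finite_surj by blast
qed

lemma invariant_bounded:
  fixes f :: "'a \<Rightarrow> nat"
  assumes "finite P" "\<And>\<sigma> x. \<sigma> \<in> aut P \<Longrightarrow> f (\<sigma> x) = f x"
  obtains n where "\<And>x. f x \<le> n"
  using finite_range_invariant[of P f] assms finite_nat_set_iff_bounded_le[of "range f"] by blast

text \<open>Infinite sets of cosets have \<open>card\<close> 0, so the bound carries information
  exactly where the index is finite.\<close>

lemma cosets_bounded:
  assumes "finite P" "invt P H" "\<And>\<sigma> x. \<sigma> \<in> aut P \<Longrightarrow> K (\<sigma> x) = \<sigma> ` K x"
  obtains n where "\<And>x. card (cosets H (K x)) \<le> n"
proof (rule invariant_bounded[OF assms(1), of "\<lambda>x. card (cosets H (K x))"])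
  fix \<sigma> x assume s: "\<sigma> \<in> aut P"
  show "card (cosets H (K (\<sigma> x))) = card (cosets H (K x))"
    using cosets_aut[OF s, of H "K x"] assms(3)[OF s] invt_image[OF assms(2) s] by simp
qed blast

text \<open>A fixed point is a whole orbit. Consequently finitely generated subgroups are finite:
  they consist of points fixed over the generators.\<close>

lemma finite_fixed: assumes "finite P" shows "finite {x. \<forall>\<sigma>\<in>aut P. \<sigma> x = x}"
proof -
  let ?X = "{x. \<forall>\<sigma>\<in>aut P. \<sigma> x = x}"
  have orb: "orb P x = {x}" if "x \<in> ?X" for x using that aut_id unfolding orb_def by force
  have "inj_on (orb P) ?X"
  proof (rule inj_onI)
    fix x y assume "x \<in> ?X" "y \<in> ?X" "orb P x = orb P y"
    then show "x = y" using orb[of x] orb[of y] by simp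
  qed
  moreover have "finite (orb P ` ?X)" using finite_orbits[OF assms] by (rule finite_subset[rotated]) blast
  ultimately show ?thesis using finite_image_iff by blast
qed

text \<open>The element \<open>c i\<close> shows that dropping \<open>ts ! i\<close> enlarges the
  centralizer of the list.\<close>

definition irred :: "'a list \<Rightarrow> bool" where
  "irred ts \<longleftrightarrow> (\<exists>c. \<forall>i<length ts. \<forall>j<length ts. c i \<cdot> ts ! j = ts ! j \<cdot> c i \<longleftrightarrow> i \<noteq> j)"

lemma irred_append: "irred (ts @ us) \<Longrightarrow> irred ts"
  unfolding irred_def
proof (elim exE)
  fix c assume c: "\<forall>i<length (ts @ us). \<forall>j<length (ts @ us). c i \<cdot> (ts @ us) ! j = (ts @ us) ! j \<cdot> c i \<longleftrightarrow> i \<noteq> j"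
  have "c i \<cdot> ts ! j = ts ! j \<cdot> c i \<longleftrightarrow> i \<noteq> j" if "i < length ts" "j < length ts" for i j
    using c[rule_format, of i j] that by (simp add: nth_append)
  then show "\<exists>c. \<forall>i<length ts. \<forall>j<length ts. c i \<cdot> ts ! j = ts ! j \<cdot> c i \<longleftrightarrow> i \<noteq> j" by blast
qed

lemma irred_aut: assumes "irred ts" "\<sigma> \<in> aut P" shows "irred (map \<sigma> ts)"
proof -
  obtain c where c: "\<forall>i<length ts. \<forall>j<length ts. c i \<cdot> ts ! j = ts ! j \<cdot> c i \<longleftrightarrow> i \<noteq> j"
    using assms(1) unfolding irred_def by blast
  have "\<sigma> (c i) \<cdot> map \<sigma> ts ! j = map \<sigma> ts ! j \<cdot> \<sigma> (c i) \<longleftrightarrow> i \<noteq> j"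
    if "i < length ts" "j < length ts" for i j
    using c[rule_format, of i j] that aut_mlt[OF assms(2), symmetric] aut_inj[OF assms(2)] by simp
  then show ?thesis unfolding irred_def by (intro exI[of _ "\<lambda>i. \<sigma> (c i)"]) simp
qed

text \<open>Koenig's lemma: since there are finitely many orbits over a finite set, arbitrarily long
  irredundant lists would yield an infinite one.\<close>

lemma irred_bounded: obtains N where "\<And>ts. irred ts \<Longrightarrow> length ts \<le> N"
proof (rule ccontr)
  assume "\<not> thesis"
  then have unb: "\<exists>ts. irred ts \<and> length ts > n" for n using that not_le by metis
  define Good where "Good ts \<longleftrightarrow> (\<forall>n. \<exists>us. irred (ts @ us) \<and> length us \<ge> n)" for ts
  have "Good []" unfolding Good_def using unb by (auto dest: less_imp_le)
  moreover have "\<exists>x. Good (ts @ [x]) \<and> True" if good: "Good ts" for ts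
  proof -
    have "\<exists>x us. irred (ts @ x # us) \<and> length us \<ge> n" for n
    proof -
      obtain vs where vs: "irred (ts @ vs)" "length vs \<ge> Suc n" using good unfolding Good_def by blast
      then obtain x us where "vs = x # us" by (cases vs) auto
      then show ?thesis using vs by auto
    qed
    then obtain x us where xu: "\<And>n. irred (ts @ x n # us n)" "\<And>n. length (us n) \<ge> n" by metis
    \<comment> \<open>The extension of length \<open>n\<close> may start with a different
      \<open>x n\<close>, but infinitely many of these lie in one orbit over \<open>ts\<close>.
      Automorphisms fixing \<open>ts\<close> then move the tails behind the single element
      \<open>x n0\<close>.\<close>
    have "finite (range (\<lambda>n. orb (set ts) (x n)))"
      by (rule finite_subset[OF _ finite_orbits[of "set ts"]]) auto
    then obtain n0 where n0: "infinite {n. orb (set ts) (x n) = orb (set ts) (x n0)}"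
      using pigeonhole_infinite[of "UNIV :: nat set" "\<lambda>n. orb (set ts) (x n)"] infinite_UNIV_nat by auto
    have "\<exists>vs. irred ((ts @ [x n0]) @ vs) \<and> length vs \<ge> n" for n
    proof -
      obtain m where m: "m \<ge> n" "orb (set ts) (x m) = orb (set ts) (x n0)"
        using n0 unfolding infinite_nat_iff_unbounded_le by blast
      obtain \<sigma> where s: "\<sigma> \<in> aut (set ts)" "x n0 = \<sigma> (x m)" using orb_eqD[OF m(2)] .
      have "map \<sigma> ts = ts" using aut_fix[OF s(1)] by (simp add: map_idI)
      then have "map \<sigma> (ts @ x m # us m) = (ts @ [x n0]) @ map \<sigma> (us m)" using s by simp
      then have "irred ((ts @ [x n0]) @ map \<sigma> (us m))" using irred_aut[OF xu(1)[of m] s(1)] by simp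
      moreover have "length (map \<sigma> (us m)) \<ge> n" using xu(2)[of m] m(1) by simp
      ultimately show ?thesis by blast
    qed
    then show ?thesis unfolding Good_def by blast
  qed
  ultimately obtain t where t: "\<And>k. Good (map t [0..<k])"
    using list_sequence[of Good "[]" "\<lambda>_ _. True"] by auto
  have "\<exists>c. \<forall>i<k. \<forall>j<k. c i \<cdot> t j = t j \<cdot> c i \<longleftrightarrow> i \<noteq> j" for k
  proof -
    have "irred (map t [0..<k])" using t[of k] irred_append unfolding Good_def by blast
    then show ?thesis unfolding irred_def by simp
  qed
  then show False using no_irredundant_sequence by blast
qed

text \<open>The indices of \<open>H \<inter> cen S\<close> in \<open>H\<close> for finite
  \<open>S \<subseteq> T\<close> are bounded: a smallest subset with the same centralizer in
  \<open>H\<close> is irredundant, so it has at most \<open>N\<close> elements, and each element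
  contributes a bounded factor. For \<open>S0\<close> of largest index, adding an element of
  \<open>T\<close> changes nothing.\<close>

lemma ale_cen_all:
  assumes P: "finite P" "invt P H" and H: "sg H" and T: "\<And>t. t \<in> T \<Longrightarrow> H \<lesssim> cen {t}"
  shows "H \<lesssim> cen T"
proof -
  define I where "I S = cosets H (H \<inter> cen S)" for S
  have sgI: "sg (H \<inter> cen S)" for S using H sg_cen sg_Int by blast
  have fin: "finite (I S)" if "finite S" "S \<subseteq> T" for S
  proof -
    have "H \<lesssim> H \<inter> cen S" using that
    proof (induction S rule: finite_induct)
      case (insert t S)
      then have "H \<lesssim> (H \<inter> cen S) \<inter> cen {t}" by (intro ale_Int2[of H "H \<inter> cen S" "cen {t}"] T sgI sg_cen H) auto
      moreover have "(H \<inter> cen S) \<inter> cen {t} = H \<inter> cen (insert t S)" by (auto simp: cen_def)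
      ultimately show ?case by simp
    qed simp
    then show ?thesis unfolding I_def ale_cosets[OF sgI] .
  qed
  obtain n where n: "\<And>t. card (I {t}) \<le> n"
    unfolding I_def
  proof (rule cosets_bounded[OF P, of "\<lambda>t. H \<inter> cen {t}"])
    fix \<sigma> x assume s: "\<sigma> \<in> aut P"
    show "H \<inter> cen {\<sigma> x} = \<sigma> ` (H \<inter> cen {x})"
      using invt_image[OF P(2) s] by (simp add: cen_aut1[OF s] aut_image_Int[OF s])
  qed blast
  have pow: "card (I S) \<le> Suc n ^ card S" if "finite S" "S \<subseteq> T" for S using that
  proof (induction S rule: finite_induct)
    case empty
    have "(\<cdot>) x ` H = H" if "x \<in> H" for x using coset_eq_iff[OF H, of x e] that sg_iv[OF H] by simp
    then have "I {} \<subseteq> {H}" unfolding I_def cosets_def by auto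
    then have "card (I {}) \<le> card {H}" by (intro card_mono) auto
    then show ?case by simp
  next
    case (insert t S)
    have "I (insert t S) \<subseteq> (\<lambda>(A,B). A \<inter> B) ` (I {t} \<times> I S)"
    proof
      fix A assume "A \<in> I (insert t S)"
      then obtain x where x: "x \<in> H" "A = (\<cdot>) x ` (H \<inter> cen (insert t S))" unfolding I_def cosets_def by blast
      have eq: "H \<inter> cen (insert t S) = (H \<inter> cen {t}) \<inter> (H \<inter> cen S)" by (auto simp: cen_def)
      have "A = (\<cdot>) x ` (H \<inter> cen {t}) \<inter> (\<cdot>) x ` (H \<inter> cen S)"
        unfolding x(2) eq by (rule image_Int) (simp add: inj_def)
      then show "A \<in> (\<lambda>(A,B). A \<inter> B) ` (I {t} \<times> I S)" using x(1) unfolding I_def cosets_def by blast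
    qed
    then have "card (I (insert t S)) \<le> card (I {t} \<times> I S)"
      using fin[of S] fin[of "{t}"] insert by (intro surj_card_le) auto
    also have "\<dots> = card (I {t}) * card (I S)" by (rule card_cartesian_product)
    also have "\<dots> \<le> Suc n * Suc n ^ card S"
      using n[of t] insert by (intro mult_mono) auto
    finally show ?case using insert by simp
  qed
  obtain N where N: "\<And>ts. irred ts \<Longrightarrow> length ts \<le> N" by (rule irred_bounded) blast
  have bound: "card (I S) \<le> Suc n ^ N" if S: "finite S" "S \<subseteq> T" for S
  proof -
    define Q where "Q S' \<longleftrightarrow> S' \<subseteq> S \<and> H \<inter> cen S' \<subseteq> cen S" for S'
    have "Q S" unfolding Q_def by auto
    then obtain S' where S': "Q S'" "\<And>R. Q R \<Longrightarrow> card S' \<le> card R"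
      using ex_has_least_nat[of Q S card] by blast
    have finS': "finite S'" using S' S finite_subset unfolding Q_def by blast
    have c: "\<exists>c. \<forall>r\<in>S'. c \<cdot> r = r \<cdot> c \<longleftrightarrow> s \<noteq> r" if s: "s \<in> S'" for s
    proof -
      \<comment> \<open>By minimality some \<open>c\<close> in \<open>H\<close> commutes with the
        rest of \<open>S'\<close> but not with all of \<open>S\<close>, hence not with
        \<open>s\<close>.\<close>
      have "\<not> Q (S' - {s})" using S'(2)[of "S' - {s}"] card_Diff1_less[OF finS' s] by linarith
      then obtain c where c: "c \<in> H" "c \<in> cen (S' - {s})" "c \<notin> cen S" using S'(1) unfolding Q_def by blast
      then have "c \<notin> cen S'" using S'(1) unfolding Q_def by blast
      then show ?thesis using c(2) unfolding cen_def by (intro exI[of _ c]) auto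
    qed
    obtain ts where ts: "set ts = S'" "distinct ts" using finite_distinct_list[OF finS'] by blast
    have "\<exists>c. \<forall>i<length ts. \<forall>r\<in>S'. c i \<cdot> r = r \<cdot> c i \<longleftrightarrow> ts ! i \<noteq> r"
      by (rule choice_iff'[THEN iffD1]) (use c ts in auto)
    then obtain c where c: "\<And>i r. i < length ts \<Longrightarrow> r \<in> S' \<Longrightarrow> c i \<cdot> r = r \<cdot> c i \<longleftrightarrow> ts ! i \<noteq> r" by blast
    have "irred ts" unfolding irred_def
      using c ts by (intro exI[of _ c]) (auto simp: nth_eq_iff_index_eq)
    then have "card S' \<le> N" using N[of ts] ts distinct_card by metis
    have "H \<inter> cen S = H \<inter> cen S'" using S'(1) cen_antimono[of S' S] unfolding Q_def by blast
    then have "card (I S) = card (I S')" unfolding I_def by simp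
    also have "\<dots> \<le> Suc n ^ card S'" using pow[OF finS'] S'(1) S unfolding Q_def by blast
    also have "\<dots> \<le> Suc n ^ N" by (rule power_increasing) (use \<open>card S' \<le> N\<close> in auto)
    finally show ?thesis .
  qed
  obtain S0 where S0: "finite S0 \<and> S0 \<subseteq> T" "\<And>S. finite S \<and> S \<subseteq> T \<Longrightarrow> card (I S) \<le> card (I S0)"
    using ex_has_greatest_nat[of "\<lambda>S. finite S \<and> S \<subseteq> T" "{}" "\<lambda>S. card (I S)" "Suc (Suc n ^ N)"] bound
    by (auto simp: less_Suc_eq_le)
  have "H \<inter> cen S0 \<subseteq> cen {t}" if t: "t \<in> T" for t
  proof -
    have i: "finite (insert t S0) \<and> insert t S0 \<subseteq> T" using S0(1) t by blast
    have "H \<inter> (H \<inter> cen S0) \<subseteq> H \<inter> cen (insert t S0)"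
    proof (rule cosets_card_eq[OF sgI _ sgI H])
      show "H \<inter> cen (insert t S0) \<subseteq> H \<inter> cen S0" by (auto simp: cen_def)
    qed (use fin i S0(2)[OF i] in \<open>auto simp: I_def\<close>)
    then show ?thesis by (auto simp: cen_def)
  qed
  then have "H \<inter> cen S0 \<subseteq> cen T" by (auto simp: cen_def)
  moreover have "H \<lesssim> H \<inter> cen S0" using fin[of S0] S0(1) unfolding I_def ale_cosets[OF sgI] by blast
  ultimately show ?thesis by (meson ale_subset ale_trans)
qed

end

section \<open>Almost centralizers\<close>

lemma card_image_eq:
  assumes "\<And>x y. x \<in> A \<Longrightarrow> y \<in> A \<Longrightarrow> f x = f y \<longleftrightarrow> g x = g y"
  shows "card (f ` A) = card (g ` A)"
proof -
  define h where "h v = g (inv_into A f v)" for v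
  have h: "h (f x) = g x" if x: "x \<in> A" for x
  proof -
    have "f (inv_into A f (f x)) = f x" "inv_into A f (f x) \<in> A" using x by (auto intro: f_inv_into_f inv_into_into)
    then show ?thesis unfolding h_def using assms x by blast
  qed
  have "g ` A = h ` f ` A" unfolding image_image by (rule image_cong) (simp_all add: h)
  moreover have "inj_on h (f ` A)" using assms h by (intro inj_onI) auto
  ultimately show ?thesis by (simp add: card_image)
qed

context tgroup begin

text \<open>The almost centralizer of \<open>H\<close>. For \<open>UNIV\<close> it is the FC-center,
  the set of elements with finitely many conjugates.\<close>

definition acen :: "'a set \<Rightarrow> 'a set" where
  "acen H = {b. H \<lesssim> cen {b}}"

lemma cen_mlt: "cen {a} \<inter> cen {b} \<subseteq> cen {a \<cdot> b}"
proof
  fix x assume "x \<in> cen {a} \<inter> cen {b}"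
  then have x: "x \<cdot> a = a \<cdot> x" "x \<cdot> b = b \<cdot> x" by (auto simp: cen_def)
  have "x \<cdot> (a \<cdot> b) = (x \<cdot> a) \<cdot> b" by simp
  also have "\<dots> = a \<cdot> (x \<cdot> b)" unfolding x(1) by simp
  also have "\<dots> = (a \<cdot> b) \<cdot> x" unfolding x(2) by simp
  finally show "x \<in> cen {a \<cdot> b}" by (simp add: cen_def)
qed

lemma cen_iv: "cen {a} \<subseteq> cen {iv a}"
proof
  fix g assume "g \<in> cen {a}"
  then have "a \<cdot> g = g \<cdot> a" by (simp add: cen_def)
  then have "iv a \<cdot> g = g \<cdot> iv a" by (rule comm_iv)
  then show "g \<in> cen {iv a}" by (simp add: cen_def)
qed

lemma cen_e: "cen {e} = UNIV"
  by (simp add: cen_def)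

lemma sg_acen: assumes "sg H" shows "sg (acen H)"
proof (rule sgI)
  show "e \<in> acen H" by (simp add: acen_def cen_e ale_subset)
  show "x \<cdot> y \<in> acen H" if "x \<in> acen H" "y \<in> acen H" for x y
    using ale_Int2[of H "cen {x}" "cen {y}"] that assms sg_cen cen_mlt[of x y]
    unfolding acen_def by (blast intro: ale_mono)
  show "iv x \<in> acen H" if "x \<in> acen H" for x
    using that cen_iv[of x] unfolding acen_def by (blast intro: ale_mono)
qed

lemma acen_aut: assumes "\<sigma> \<in> aut P" shows "acen (\<sigma> ` H) = \<sigma> ` acen H"
  by (rule aut_image_eqI[OF assms]) (simp add: acen_def cen_aut1[OF assms] ale_aut_iff[OF assms])

lemma invt_acen: "invt P H \<Longrightarrow> invt P (acen H)"
  unfolding invt_def by (metis acen_aut)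

lemma acen_antimono: "H \<lesssim> K \<Longrightarrow> acen K \<subseteq> acen H"
  unfolding acen_def using ale_trans by blast

abbreviation FC :: "'a set" where "FC \<equiv> acen UNIV"

definition U :: "'a set" where "U = {a. infinite (cen {a})}"

definition D :: "'a \<Rightarrow> 'a set" where "D a = acen (cen {a})"

lemma D_iff: "b \<in> D a \<longleftrightarrow> cen {a} \<lesssim> cen {b}"
  by (simp add: D_def acen_def)

lemma sg_D: "sg (D a)"
  unfolding D_def by (rule sg_acen[OF sg_cen])

lemma D_aut: "\<sigma> \<in> aut P \<Longrightarrow> D (\<sigma> a) = \<sigma> ` D a"
  unfolding D_def by (simp add: cen_aut1 acen_aut)

lemma invt_D: "a \<in> P \<Longrightarrow> invt P (D a)"
  unfolding D_def by (intro invt_acen invt_cen1)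

lemma D_self: "a \<in> D a"
  by (simp add: D_iff)

lemma D_mono: "b \<in> D a \<Longrightarrow> D b \<subseteq> D a"
  unfolding D_def by (rule acen_antimono) (simp add: acen_def)

lemma invt_UNIV: "invt P UNIV"
  by (rule invtI) simp

text \<open>Inner automorphisms fix the empty set of parameters, so every set invariant over
  \<open>{}\<close> is closed under conjugation.\<close>

lemma conj_aut: "(\<lambda>x. g \<cdot> (x \<cdot> iv g)) \<in> aut {}"
proof (rule autI)
  show "bij (\<lambda>x. g \<cdot> (x \<cdot> iv g))"
    by (rule o_bij[of "\<lambda>x. iv g \<cdot> (x \<cdot> g)"]) (auto simp: fun_eq_iff)
qed auto

lemma conj_invt: "invt {} X \<Longrightarrow> x \<in> X \<Longrightarrow> g \<cdot> (x \<cdot> iv g) \<in> X"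
  using invt_image[OF _ conj_aut, of X g] by blast

text \<open>Orbit-stabilizer: if there were finitely many conjugates, one conjugator for each would
  represent all cosets of \<open>cen {a}\<close>.\<close>

lemma infinite_class: assumes "a \<notin> FC" shows "infinite (range (\<lambda>g. g \<cdot> (a \<cdot> iv g)))"
proof
  let ?f = "\<lambda>g. g \<cdot> (a \<cdot> iv g)"
  assume fin: "finite (range ?f)"
  define r where "r w = (SOME g. ?f g = w)" for w
  have r: "?f (r (?f h)) = ?f h" for h unfolding r_def by (rule someI[of _ h]) simp
  have "iv (r (?f h)) \<cdot> h \<in> cen {a}" for h
  proof -
    let ?s = "r (?f h)"
    have "iv ?s \<cdot> (?f ?s \<cdot> h) = iv ?s \<cdot> (?f h \<cdot> h)" using r[of h] by metis
    then show ?thesis by (simp add: cen_def)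
  qed
  then have "UNIV \<lesssim> cen {a}" unfolding ale_iff
    by (intro exI[of _ "r ` range ?f"]) (use fin in blast)
  then show False using assms by (simp add: acen_def)
qed

section \<open>Index bounds in finite groups\<close>

lemma lagrange: assumes "sg H" "sg K" "K \<subseteq> H" "finite H" shows "card K * card (cosets H K) = card H"
proof -
  have U: "\<Union>(cosets H K) = H"
  proof
    show "\<Union>(cosets H K) \<subseteq> H" unfolding cosets_def using assms sg_mlt by blast
    have "x \<in> (\<cdot>) x ` K" for x using sg_e[OF assms(2)] by (simp add: in_coset_iff del: image_iff)
    then show "H \<subseteq> \<Union>(cosets H K)" unfolding cosets_def by blast
  qed
  have "card K * card (cosets H K) = card (\<Union>(cosets H K))"
  proof (rule card_partition)
    show "finite (cosets H K)" unfolding cosets_def using assms by simp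
    show "finite (\<Union>(cosets H K))" unfolding U using assms by simp
    show "card c = card K" if "c \<in> cosets H K" for c
      using that unfolding cosets_def by (auto intro!: card_image inj_onI)
    show "c1 \<inter> c2 = {}" if c: "c1 \<in> cosets H K" "c2 \<in> cosets H K" "c1 \<noteq> c2" for c1 c2
    proof (rule ccontr)
      obtain x y where xy: "c1 = (\<cdot>) x ` K" "c2 = (\<cdot>) y ` K" using c unfolding cosets_def by blast
      assume "c1 \<inter> c2 \<noteq> {}"
      then obtain z where "z \<in> (\<cdot>) x ` K" "z \<in> (\<cdot>) y ` K" using xy by blast
      then have "(\<cdot>) x ` K = (\<cdot>) z ` K" "(\<cdot>) y ` K = (\<cdot>) z ` K"
        using coset_eq_iff[OF assms(2)] in_coset_iff by blast+
      then show False using xy c(3) by simp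
    qed
  qed
  then show ?thesis unfolding U .
qed

lemma card_cosets_Int: assumes "sg H" "sg K" shows "card (cosets H (H \<inter> K)) = card (cosets H K)"
  unfolding cosets_def
proof (rule card_image_eq)
  fix x y assume "x \<in> H" "y \<in> H"
  then have "iv x \<cdot> y \<in> H" using assms sg_iv sg_mlt by blast
  then show "(\<cdot>) x ` (H \<inter> K) = (\<cdot>) y ` (H \<inter> K) \<longleftrightarrow> (\<cdot>) x ` K = (\<cdot>) y ` K"
    by (simp add: coset_eq_iff[OF assms(2)] coset_eq_iff[OF sg_Int[OF assms]])
qed

text \<open>Every conjugacy class of \<open>H\<close> outside \<open>V\<close> has \<open>card H div k\<close> elements for some \<open>k \<le> n\<close>, so
  the class equation, multiplied by \<open>n!\<close>, shows that \<open>card H\<close> divides \<open>n! * card (H \<inter> V)\<close>.\<close>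

lemma index_bounded_by_centralizers:
  assumes H: "sg H" "finite H" and V: "sg V" and conj: "\<And>g x. x \<in> V \<Longrightarrow> g \<cdot> (x \<cdot> iv g) \<in> V"
    and n: "\<And>z. z \<in> H - V \<Longrightarrow> card (H \<inter> cen {z}) \<le> n"
  shows "card (cosets H V) \<le> fact n"
proof -
  define cl where "cl z = (\<lambda>x. x \<cdot> (z \<cdot> iv x)) ` H" for z
  have cl: "card H dvd fact n * card (cl z)" if z: "z \<in> H - V" for z
  proof -
    let ?K = "H \<inter> cen {z}"
    have K: "sg ?K" using H sg_cen sg_Int by blast
    have "card (cl z) = card (cosets H ?K)"
      unfolding cl_def cosets_def
    proof (rule card_image_eq)
      fix x y assume xy: "x \<in> H" "y \<in> H"
      have "x \<cdot> (z \<cdot> iv x) = y \<cdot> (z \<cdot> iv y) \<longleftrightarrow> iv x \<cdot> ((x \<cdot> (z \<cdot> iv x)) \<cdot> y) = iv x \<cdot> ((y \<cdot> (z \<cdot> iv y)) \<cdot> y)"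
        by (simp only: left_cancel right_cancel)
      also have "\<dots> \<longleftrightarrow> iv x \<cdot> y \<in> cen {z}" by (auto simp: cen_def)
      also have "\<dots> \<longleftrightarrow> iv x \<cdot> y \<in> ?K" using xy H sg_iv sg_mlt by blast
      also have "\<dots> \<longleftrightarrow> (\<cdot>) x ` ?K = (\<cdot>) y ` ?K" by (rule coset_eq_iff[OF K, symmetric])
      finally show "x \<cdot> (z \<cdot> iv x) = y \<cdot> (z \<cdot> iv y) \<longleftrightarrow> (\<cdot>) x ` ?K = (\<cdot>) y ` ?K" .
    qed
    then have L: "card ?K * card (cl z) = card H" using lagrange[OF H(1) K _ H(2)] by simp
    have "card ?K > 0" using sg_e[OF K] H(2) by (auto simp: card_gt_0_iff)
    then have "card ?K dvd fact n" using n[OF z] by (intro dvd_fact) auto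
    then have "card ?K * card (cl z) dvd fact n * card (cl z)" by (rule mult_dvd_mono) simp
    then show ?thesis using L by simp
  qed
  have clH: "cl z \<subseteq> H - V" if z: "z \<in> H - V" for z
  proof
    fix w assume "w \<in> cl z"
    then obtain x where x: "x \<in> H" "w = x \<cdot> (z \<cdot> iv x)" unfolding cl_def by blast
    have "w \<in> H" using x z H sg_mlt sg_iv by blast
    moreover have "z = iv x \<cdot> (w \<cdot> iv (iv x))" using x by simp
    then have "w \<notin> V" using conj[of w "iv x"] z by auto
    ultimately show "w \<in> H - V" by blast
  qed
  have cl_self: "z \<in> cl z" for z unfolding cl_def using sg_e[OF H(1)] by (intro image_eqI[of _ _ e]) auto
  have cl_eq: "cl w = cl z" if w: "w \<in> cl z" for w z
  proof -
    obtain x where x: "x \<in> H" "w = x \<cdot> (z \<cdot> iv x)" using w unfolding cl_def by blast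
    have a: "y \<cdot> (w \<cdot> iv y) = (y \<cdot> x) \<cdot> (z \<cdot> iv (y \<cdot> x))" for y using x by simp
    have b: "y \<cdot> (z \<cdot> iv y) = (y \<cdot> iv x) \<cdot> (w \<cdot> iv (y \<cdot> iv x))" for y using x by simp
    show ?thesis
    proof
      show "cl w \<subseteq> cl z" unfolding cl_def
      proof
        fix v assume "v \<in> (\<lambda>y. y \<cdot> (w \<cdot> iv y)) ` H"
        then obtain y where "y \<in> H" "v = y \<cdot> (w \<cdot> iv y)" by blast
        then show "v \<in> (\<lambda>y. y \<cdot> (z \<cdot> iv y)) ` H" using a[of y] x sg_mlt[OF H(1)] by blast
      qed
      show "cl z \<subseteq> cl w" unfolding cl_def
      proof
        fix v assume "v \<in> (\<lambda>y. y \<cdot> (z \<cdot> iv y)) ` H"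
        then obtain y where "y \<in> H" "v = y \<cdot> (z \<cdot> iv y)" by blast
        then show "v \<in> (\<lambda>y. y \<cdot> (w \<cdot> iv y)) ` H" using b[of y] x sg_mlt[OF H(1)] sg_iv[OF H(1)] by blast
      qed
    qed
  qed
  have "H - V = \<Union>(cl ` (H - V))" using clH cl_self by blast
  then have "card (H - V) = (\<Sum>c\<in>cl ` (H - V). card c)"
  proof -
    have "card (\<Union>(cl ` (H - V))) = (\<Sum>c\<in>cl ` (H - V). card c)"
    proof (rule card_Union_disjoint)
      show "pairwise disjnt (cl ` (H - V))"
      proof (rule pairwiseI)
        fix c c' assume c: "c \<in> cl ` (H - V)" "c' \<in> cl ` (H - V)" "c \<noteq> c'"
        then obtain z z' where z: "c = cl z" "c' = cl z'" by blast
        show "disjnt c c'"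
        proof (rule ccontr)
          assume "\<not> disjnt c c'"
          then obtain w where "w \<in> cl z" "w \<in> cl z'" using z unfolding disjnt_def by blast
          then show False using cl_eq[of w z] cl_eq[of w z'] z c(3) by simp
        qed
      qed
      show "finite c" if "c \<in> cl ` (H - V)" for c using that H(2) unfolding cl_def by auto
    qed
    then show ?thesis using \<open>H - V = \<Union>(cl ` (H - V))\<close> by simp
  qed
  then have "fact n * card (H - V) = (\<Sum>c\<in>cl ` (H - V). fact n * card c)" by (simp add: sum_distrib_left)
  also have "card H dvd \<dots>" by (rule dvd_sum) (use cl in auto)
  finally have 1: "card H dvd fact n * card (H - V)" .
  have 2: "fact n * card H = fact n * card (H - V) + fact n * card (H \<inter> V)"
    using card_Int_Diff[OF H(2), of V] by (simp add: distrib_left)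
  have "card H dvd fact n * card (H \<inter> V)"
  proof -
    have "card H dvd fact n * card (H - V) + fact n * card (H \<inter> V)" unfolding 2[symmetric] by simp
    then show ?thesis using 1 by (simp add: dvd_add_right_iff)
  qed
  \<comment> \<open>Dividing by \<open>card (H \<inter> V)\<close> turns the divisibility into one
    for the index.\<close>
  moreover have "card (H \<inter> V) * card (cosets H (H \<inter> V)) = card H"
    by (rule lagrange) (use H V sg_Int in auto)
  moreover have "card (H \<inter> V) > 0" using sg_e[OF H(1)] sg_e[OF V] H(2) by (auto simp: card_gt_0_iff)
  ultimately have "card (cosets H (H \<inter> V)) dvd fact n"
    by (metis mult.commute nat_mult_dvd_cancel1)
  then have "card (cosets H (H \<inter> V)) \<le> fact n" by (rule dvd_imp_le) simp
  then show ?thesis using card_cosets_Int[OF H(1) V] by simp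
qed

end

section \<open>Consequences of comparability\<close>

context dp_group begin

text \<open>One group contains the other up to finite index, so the intersection has finite index in
  an infinite group.\<close>

lemma infinite_Int: assumes "finite P" "invt P H" "invt P K" "sg H" "sg K" "infinite H" "infinite K"
  shows "infinite (H \<inter> K)"
  using total[OF assms(1-5)] ale_infinite_Int[of H K] ale_infinite_Int[of K H] assms by (auto simp: Int_commute)

lemma total_cen: "cen {a} \<lesssim> cen {b} \<or> cen {b} \<lesssim> cen {a}"
  by (rule total[of "{a,b}"]) (auto intro: invt_cen1 sg_cen)

lemma D_total: "b \<in> D a \<or> a \<in> D b"
  unfolding D_iff using total_cen by blast

lemma sg_U: "sg U"
proof (rule sgI)
  show "e \<in> U" unfolding U_def by (simp add: cen_e infinite_UNIV)
  show "x \<cdot> y \<in> U" if "x \<in> U" "y \<in> U" for x y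
  proof -
    have "infinite (cen {x} \<inter> cen {y})"
      by (rule infinite_Int[of "{x,y}"]) (use that in \<open>auto intro: invt_cen1 sg_cen simp: U_def\<close>)
    then show ?thesis unfolding U_def using cen_mlt[of x y] infinite_super by blast
  qed
  show "iv x \<in> U" if "x \<in> U" for x
    using that cen_iv[of x] infinite_super unfolding U_def by blast
qed

lemma card_cen_aut: "\<sigma> \<in> aut P \<Longrightarrow> card (cen {\<sigma> x}) = card (cen {x})"
  by (simp add: cen_aut1 card_image aut_bij bij_is_inj inj_on_def aut_inj)

lemma finite_cen_aut: "\<sigma> \<in> aut P \<Longrightarrow> finite (cen {\<sigma> x}) \<longleftrightarrow> finite (cen {x})"
  by (simp add: cen_aut1 finite_image_iff inj_on_def aut_inj)

lemma invt_U: "invt P U"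
  by (rule invtI) (simp add: U_def finite_cen_aut)

text \<open>Centralizers of elements outside \<open>U\<close> have at most \<open>n\<close>
  elements. If \<open>U\<close> had infinite index, representatives of more than \<open>n!\<close>
  cosets would lie in a finite subgroup \<open>H\<close>, contrary to the index bound from the class
  equation.\<close>

lemma UNIV_ale_U: "UNIV \<lesssim> U"
proof (rule ccontr)
  assume "\<not> UNIV \<lesssim> U"
  then have inf: "infinite (cosets UNIV U)" using ale_cosets[OF sg_U] by blast
  obtain n where n: "\<And>z. card (cen {z}) \<le> n"
    using invariant_bounded[of "{}" "\<lambda>z. card (cen {z})"] card_cen_aut by blast
  obtain \<C> where C: "\<C> \<subseteq> cosets UNIV U" "finite \<C>" "card \<C> = Suc (fact n)"
    using infinite_arbitrarily_large[OF inf] by blast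
  obtain S where S: "finite S" "\<C> = (\<lambda>x. (\<cdot>) x ` U) ` S"
    using finite_subset_image[OF C(2) C(1)[unfolded cosets_def]] by blast
  \<comment> \<open>The points fixed over \<open>S\<close> form a subgroup containing
    \<open>S\<close>, finite by \<open>finite_fixed\<close>.\<close>
  define H where "H = {x. \<forall>\<sigma>\<in>aut S. \<sigma> x = x}"
  have H: "finite H" "S \<subseteq> H" "sg H"
    unfolding H_def using finite_fixed[OF S(1)] by (auto simp: aut_fix aut_e aut_mlt aut_iv intro!: sgI)
  have "card (cosets H U) \<le> fact n"
  proof (rule index_bounded_by_centralizers[OF H(3,1) sg_U])
    show "g \<cdot> (x \<cdot> iv g) \<in> U" if "x \<in> U" for g x using conj_invt[OF invt_U that] .
    show "card (H \<inter> cen {z}) \<le> n" if "z \<in> H - U" for z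
      using that n[of z] card_mono[of "cen {z}" "H \<inter> cen {z}"] unfolding U_def by auto
  qed
  moreover have "\<C> \<subseteq> cosets H U" unfolding S(2) cosets_def using H(2) by blast
  then have "card \<C> \<le> card (cosets H U)" by (rule card_mono[rotated]) (simp add: cosets_def H)
  ultimately show False using C(3) by simp
qed

lemma infinite_U: "infinite U"
  using UNIV_ale_U ale_finite_right infinite_UNIV by blast

text \<open>Otherwise the centralizers of the iterates \<open>(\<sigma> ^^ k) a\<close> would
  descend. But these iterates lie in the finite set of points fixed over \<open>{a, g}\<close>, so
  some positive power of \<open>\<sigma>\<close> returns to \<open>a\<close> and closes the
  chain.\<close>

lemma conj_ale: "cen {a} \<lesssim> cen {g \<cdot> (a \<cdot> iv g)}"
proof (rule ccontr)
  define \<sigma> where "\<sigma> x = g \<cdot> (x \<cdot> iv g)" for x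
  have \<sigma>: "\<sigma> \<in> aut {}" using conj_aut unfolding \<sigma>_def .
  assume "\<not> cen {a} \<lesssim> cen {g \<cdot> (a \<cdot> iv g)}"
  then have *: "\<not> cen {a} \<lesssim> cen {\<sigma> a}" by (simp add: \<sigma>_def)
  then have 0: "cen {\<sigma> a} \<lesssim> cen {a}" using total_cen by blast
  have step: "cen {(\<sigma> ^^ Suc k) a} \<lesssim> cen {(\<sigma> ^^ k) a}" for k
    by (induction k) (use 0 in \<open>simp_all add: cen_aut1[OF \<sigma>] ale_aut_iff[OF \<sigma>]\<close>)
  have down: "cen {(\<sigma> ^^ Suc k) a} \<lesssim> cen {\<sigma> a}" for k
  proof (induction k)
    case (Suc k)
    then show ?case using step[of "Suc k"] ale_trans by blast
  qed simp
  have "\<tau> ((\<sigma> ^^ k) a) = (\<sigma> ^^ k) a" if t: "\<tau> \<in> aut {a, g}" for \<tau> k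
    by (induction k) (use aut_fix[OF t] in \<open>auto simp: \<sigma>_def aut_mlt[OF t] aut_iv[OF t]\<close>)
  then have "range (\<lambda>k. (\<sigma> ^^ k) a) \<subseteq> {x. \<forall>\<tau>\<in>aut {a,g}. \<tau> x = x}" by blast
  then have "finite (range (\<lambda>k. (\<sigma> ^^ k) a))" using finite_fixed[of "{a,g}"] finite_subset by blast
  then have "\<not> inj (\<lambda>k. (\<sigma> ^^ k) a)" using finite_imageD infinite_UNIV_nat by blast
  then obtain k l where kl: "k < l" "(\<sigma> ^^ k) a = (\<sigma> ^^ l) a"
    unfolding inj_def by (metis linorder_neqE_nat)
  have "(\<sigma> ^^ l) a = (\<sigma> ^^ k) ((\<sigma> ^^ (l - k)) a)" using kl(1)
    by (metis comp_apply funpow_add le_add_diff_inverse less_imp_le)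
  moreover have "inj (\<sigma> ^^ k)" by (rule inj_fn) (use aut_bij[OF \<sigma>] bij_is_inj in blast)
  ultimately have "(\<sigma> ^^ (l - k)) a = a" using kl(2) by (simp add: inj_eq)
  moreover have "Suc (l - k - 1) = l - k" using kl(1) by simp
  ultimately have "cen {a} \<lesssim> cen {\<sigma> a}" using down[of "l - k - 1"] by metis
  then show False using * by blast
qed

lemma D_normal: assumes "b \<in> D a" shows "g \<cdot> (b \<cdot> iv g) \<in> D a"
  using assms conj_ale[of b g] ale_trans unfolding D_iff by blast

text \<open>\<open>D a\<close> contains the conjugacy class of \<open>a\<close>.\<close>

lemma D_infinite: assumes "a \<notin> FC" shows "infinite (D a)"
proof -
  have "range (\<lambda>g. g \<cdot> (a \<cdot> iv g)) \<subseteq> D a" using D_normal[OF D_self] by blast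
  then show ?thesis using infinite_class[OF assms] infinite_super by blast
qed

lemma U_minus_FC: assumes "finite FC" obtains u where "u \<in> U" "u \<notin> FC"
proof -
  have "\<not> U \<subseteq> FC" using infinite_U assms finite_subset[of U FC] by blast
  then show ?thesis using that by blast
qed

definition abelian :: "'a set \<Rightarrow> bool" where
  "abelian A \<longleftrightarrow> (\<forall>x\<in>A. \<forall>y\<in>A. x \<cdot> y = y \<cdot> x)"

lemma center_of_invariant: assumes "sg H" "invt {} H" "infinite (H \<inter> cen H)"
  shows "\<exists>A. sg A \<and> infinite A \<and> abelian A \<and> invt {} A"
proof (intro exI conjI)
  show "sg (H \<inter> cen H)" using assms sg_Int sg_cen by blast
  show "infinite (H \<inter> cen H)" by fact
  show "abelian (H \<inter> cen H)" unfolding abelian_def cen_def by blast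
  show "invt {} (H \<inter> cen H)" by (intro invt_Int invt_cen assms)
qed

text \<open>Every element of \<open>FC\<close> almost centralizes \<open>FC\<close>;
  \<open>ale_cen_all\<close> collects these conditions, so the center of \<open>FC\<close> has
  finite index in it.\<close>

lemma abelian_if_infinite_FC: assumes "infinite FC"
  shows "\<exists>A. sg A \<and> infinite A \<and> abelian A \<and> invt {} A"
proof (rule center_of_invariant)
  show sg: "sg FC" by (simp add: sg_acen)
  show inv: "invt {} FC" by (intro invt_acen invt_UNIV)
  have "FC \<lesssim> cen {t}" if t: "t \<in> FC" for t using t by (auto simp: acen_def intro: ale_mono)
  then have "FC \<lesssim> cen FC" using ale_cen_all[of "{}" FC FC] sg inv by blast
  then show "infinite (FC \<inter> cen FC)" using ale_infinite_Int sg sg_cen assms by blast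
qed

text \<open>The hypothesis makes \<open>D a\<close> the smallest among all \<open>D c\<close> with
  \<open>c\<close> outside \<open>FC\<close>. Its center is infinite as the intersection of two
  infinite groups: \<open>cen (D a)\<close> almost contains \<open>cen {a}\<close>.\<close>

lemma abelian_if_least: assumes FC: "finite FC" and a: "a \<notin> FC" "\<And>c. c \<notin> FC \<Longrightarrow> cen {c} \<lesssim> cen {a}"
  shows "\<exists>A. sg A \<and> infinite A \<and> abelian A \<and> invt {} A"
proof (rule center_of_invariant[of "D a"])
  show "sg (D a)" by (rule sg_D)
  \<comment> \<open>This description does not mention \<open>a\<close>, whence the invariance over
    \<open>{}\<close>.\<close>
  have D: "D a = {b. \<forall>c. c \<notin> FC \<longrightarrow> cen {c} \<lesssim> cen {b}}"
    using a by (auto simp: D_iff intro: ale_trans[of _ "cen {a}"])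
  show "invt {} (D a)" unfolding D
  proof (rule invtI)
    fix \<sigma> b assume s: "\<sigma> \<in> aut {}" and b: "b \<in> {b. \<forall>c. c \<notin> FC \<longrightarrow> cen {c} \<lesssim> cen {b}}"
    have "cen {c} \<lesssim> cen {\<sigma> b}" if c: "c \<notin> FC" for c
    proof -
      obtain d where d: "c = \<sigma> d" using aut_surj[OF s] .
      have "d \<notin> FC" using c d invt_image[OF invt_acen[OF invt_UNIV] s] by blast
      then have "cen {d} \<lesssim> cen {b}" using b by blast
      then show ?thesis unfolding d by (simp add: cen_aut1[OF s] ale_aut_iff[OF s])
    qed
    then show "\<sigma> b \<in> {b. \<forall>c. c \<notin> FC \<longrightarrow> cen {c} \<lesssim> cen {b}}" by blast
  qed
  obtain u where u: "u \<in> U" "u \<notin> FC" using U_minus_FC[OF FC] .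
  \<comment> \<open>Some \<open>u\<close> outside \<open>FC\<close> has an infinite centralizer, and
    this is almost contained in \<open>cen {a}\<close>.\<close>
  have "infinite (cen {a})" using u a(2)[OF u(2)] ale_finite_right unfolding U_def by blast
  moreover have "cen {a} \<lesssim> cen (D a)"
    by (rule ale_cen_all[of "{a}"]) (auto intro: invt_cen1 sg_cen simp: D_iff)
  ultimately have "infinite (cen (D a))" using ale_finite_right by blast
  then show "infinite (D a \<inter> cen (D a))"
    using D_infinite[OF a(1)] by (intro infinite_Int[of "{a}"]) (auto intro: invt_D invt_cen sg_cen sg_D)
qed

text \<open>Here the chain condition takes the place of Baldwin-Saxl: the indices of the
  \<open>H \<inter> K b\<close> are bounded by equivariance, and within \<open>H\<close> a member of
  largest index lies in every other one.\<close>

lemma ale_chain: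
  assumes P: "finite P" "invt P H" and H: "sg H" and B: "B \<noteq> {}"
    and K: "\<And>b. b \<in> B \<Longrightarrow> sg (K b)" "\<And>b. b \<in> B \<Longrightarrow> H \<lesssim> K b"
    and chain: "\<And>b c. b \<in> B \<Longrightarrow> c \<in> B \<Longrightarrow> K b \<subseteq> K c \<or> K c \<subseteq> K b"
    and eqv: "\<And>\<sigma> x. \<sigma> \<in> aut P \<Longrightarrow> K (\<sigma> x) = \<sigma> ` K x"
  shows "H \<lesssim> (\<Inter>b\<in>B. K b)"
proof -
  define I where "I b = cosets H (H \<inter> K b)" for b
  obtain n where n: "\<And>b. card (I b) \<le> n"
    unfolding I_def
  proof (rule cosets_bounded[OF P, of "\<lambda>t. H \<inter> K t"])
    fix \<sigma> x assume s: "\<sigma> \<in> aut P"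
    show "H \<inter> K (\<sigma> x) = \<sigma> ` (H \<inter> K x)"
      using invt_image[OF P(2) s] by (simp add: eqv[OF s] aut_image_Int[OF s])
  qed blast
  obtain c where "c \<in> B" using B by blast
  then obtain b0 where b0: "b0 \<in> B" "\<And>b. b \<in> B \<Longrightarrow> card (I b) \<le> card (I b0)"
    using ex_has_greatest_nat[of "\<lambda>b. b \<in> B" c "\<lambda>b. card (I b)" "Suc n"] n
    by (auto simp: less_Suc_eq_le)
  have sgI: "sg (H \<inter> K b)" if "b \<in> B" for b using H K that sg_Int by blast
  have "H \<inter> K b0 \<subseteq> K b" if b: "b \<in> B" for b
  proof (cases "K b0 \<subseteq> K b")
    case False
    then have sub: "H \<inter> K b \<subseteq> H \<inter> K b0" using chain b b0 by blast
    have "finite (cosets H (H \<inter> K b))"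
      using ale_Int[OF K(2)[OF b] H K(1)[OF b]] ale_cosets[OF sgI[OF b]] by blast
    then have "H \<inter> (H \<inter> K b0) \<subseteq> H \<inter> K b"
      using b0(2)[OF b] unfolding I_def by (intro cosets_card_eq[OF sgI[OF b] sub sgI[OF b0(1)] H])
    then show ?thesis by blast
  qed auto
  then have "H \<inter> K b0 \<subseteq> (\<Inter>b\<in>B. K b)" by blast
  moreover have "H \<lesssim> H \<inter> K b0" using b0 H K ale_Int by blast
  ultimately show ?thesis by (meson ale_subset ale_trans)
qed

text \<open>By comparability some \<open>M\<close> in the family contains all others up to finite
  index, so a cover of \<open>U\<close> would amount to a cover by finitely many cosets of
  \<open>M\<close>; but \<open>U\<close> has finite index.\<close>

lemma avoid_finite_union:
  assumes "finite \<L>" "finite P" and L: "\<And>L. L \<in> \<L> \<Longrightarrow> sg L \<and> invt P L \<and> \<not> UNIV \<lesssim> L"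
  shows "\<exists>g\<in>U. \<forall>L\<in>\<L>. g \<notin> L"
proof (cases "\<L> = {}")
  case True
  then show ?thesis using sg_U sg_e by blast
next
  case False
  have "\<exists>M\<in>\<L>. \<forall>L\<in>\<L>. L \<lesssim> M" using assms(1) False L
  proof (induction \<L> rule: finite_ne_induct)
    case (insert L \<L>)
    then obtain M where M: "M \<in> \<L>" "\<forall>L\<in>\<L>. L \<lesssim> M" by blast
    have "L \<lesssim> M \<or> M \<lesssim> L" using total[of P L M] insert M assms(2) by blast
    then show ?case
    proof
      assume "M \<lesssim> L"
      then have "\<forall>L'\<in>insert L \<L>. L' \<lesssim> L" using M ale_trans by auto
      then show ?thesis by blast
    qed (use M in auto)
  qed simp
  then obtain M where M: "M \<in> \<L>" "\<And>L. L \<in> \<L> \<Longrightarrow> L \<lesssim> M" by blast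
  have "\<Union>\<L> \<lesssim> M" by (rule ale_Union) (use assms M in auto)
  show ?thesis
  proof (rule ccontr)
    assume "\<not> ?thesis"
    then have "U \<subseteq> \<Union>\<L>" by blast
    then have "UNIV \<lesssim> M" using UNIV_ale_U \<open>\<Union>\<L> \<lesssim> M\<close> by (meson ale_subset ale_trans)
    then show False using L M(1) by blast
  qed
qed

end

section \<open>The case without a least almost centralizer\<close>

context tgroup begin

text \<open>The commutator of \<open>u\<close> and \<open>h\<close>, with \<open>h\<close> first so
  that \<open>cm h\<close> is a map that can be iterated.\<close>

definition cm :: "'a \<Rightarrow> 'a \<Rightarrow> 'a" where
  "cm h u = u \<cdot> (h \<cdot> (iv u \<cdot> iv h))"

lemma cm_aut: "\<sigma> \<in> aut P \<Longrightarrow> \<sigma> (cm h u) = cm (\<sigma> h) (\<sigma> u)"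
  by (simp add: cm_def aut_mlt aut_iv)

lemma cm_eq_e: "cm h u = e \<longleftrightarrow> u \<in> cen {h}"
proof -
  have "cm h u = e \<longleftrightarrow> cm h u \<cdot> (h \<cdot> u) = e \<cdot> (h \<cdot> u)" by (simp only: right_cancel)
  also have "\<dots> \<longleftrightarrow> u \<in> cen {h}" by (simp add: cm_def cen_def)
  finally show ?thesis .
qed

lemma aut_image_orb: assumes s: "\<sigma> \<in> aut Q" shows "orb (\<sigma> ` P) (\<sigma> x) = \<sigma> ` orb P x"
proof -
  obtain \<tau> where t: "\<tau> \<in> aut Q" "\<And>x. \<tau> (\<sigma> x) = x" "\<And>x. \<sigma> (\<tau> x) = x" using aut_inverse[OF s] by blast
  have s0: "\<sigma> \<in> aut {}" "\<tau> \<in> aut {}" using s t aut_mono[of "{}" Q] by auto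
  show ?thesis
  proof
    show "\<sigma> ` orb P x \<subseteq> orb (\<sigma> ` P) (\<sigma> x)"
    proof
      fix y assume "y \<in> \<sigma> ` orb P x"
      then obtain \<rho> where r: "\<rho> \<in> aut P" "y = \<sigma> (\<rho> x)" unfolding orb_def by blast
      have "\<sigma> \<circ> (\<rho> \<circ> \<tau>) \<in> aut {}" using s0 r(1) aut_mono[of "{}" P] by (intro aut_comp) auto
      then have "\<sigma> \<circ> (\<rho> \<circ> \<tau>) \<in> aut (\<sigma> ` P)" unfolding aut_def using t(2) aut_fix[OF r(1)] by auto
      moreover have "y = (\<sigma> \<circ> (\<rho> \<circ> \<tau>)) (\<sigma> x)" using r t by simp
      ultimately show "y \<in> orb (\<sigma> ` P) (\<sigma> x)" unfolding orb_def by blast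
    qed
    show "orb (\<sigma> ` P) (\<sigma> x) \<subseteq> \<sigma> ` orb P x"
    proof
      fix y assume "y \<in> orb (\<sigma> ` P) (\<sigma> x)"
      then obtain \<rho> where r: "\<rho> \<in> aut (\<sigma> ` P)" "y = \<rho> (\<sigma> x)" unfolding orb_def by blast
      have "\<tau> \<circ> (\<rho> \<circ> \<sigma>) \<in> aut {}" using s0 r(1) aut_mono[of "{}" "\<sigma> ` P"] by (intro aut_comp) auto
      then have "\<tau> \<circ> (\<rho> \<circ> \<sigma>) \<in> aut P" unfolding aut_def using t(2) aut_fix[OF r(1)] by auto
      moreover have "y = \<sigma> ((\<tau> \<circ> (\<rho> \<circ> \<sigma>)) x)" using r t by simp
      ultimately show "y \<in> \<sigma> ` orb P x" unfolding orb_def by blast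
    qed
  qed
qed

end

context dp_group begin

text \<open>Moving \<open>g\<close> by an automorphism over \<open>P\<close> does not change the
  number of orbits over \<open>insert g P\<close>. The bound has to be independent of
  \<open>g\<close>, since in the end \<open>g\<close> is chosen after it.\<close>

lemma orbit_number_bounded:
  assumes "finite P" obtains N where "\<And>g. card (range (orb (insert g P))) \<le> N"
proof (rule invariant_bounded[OF assms, of "\<lambda>g. card (range (orb (insert g P)))"])
  fix \<sigma> g assume s: "\<sigma> \<in> aut P"
  have P: "insert (\<sigma> g) P = \<sigma> ` insert g P" using aut_fix[OF s] by auto
  have "range (orb (insert (\<sigma> g) P)) = (\<lambda>x. orb (insert (\<sigma> g) P) (\<sigma> x)) ` UNIV"
    using aut_bij[OF s] by (metis bij_is_surj image_image)
  also have "\<dots> = image \<sigma> ` range (orb (insert g P))"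
    unfolding P aut_image_orb[OF s] image_image ..
  finally have "range (orb (insert (\<sigma> g) P)) = image \<sigma> ` range (orb (insert g P))" .
  moreover have "inj_on (image \<sigma>) (range (orb (insert g P)))"
    using aut_bij[OF s] by (meson bij_is_inj inj_on_image inj_on_subset subset_UNIV)
  ultimately show "card (range (orb (insert (\<sigma> g) P))) = card (range (orb (insert g P)))"
    by (simp only: card_image)
qed blast

text \<open>Invariant sets are unions of orbits, so each proper step of the chain consumes a new
  orbit.\<close>

lemma invariant_chain_stops:
  assumes P: "finite P" "card (range (orb P)) \<le> N" and X: "\<And>n. invt P (X n)" "\<And>n. X n \<subseteq> X (Suc n)"
  shows "\<exists>n\<le>N. X (Suc n) = X n"
proof (rule ccontr)
  assume neg: "\<not> ?thesis"
  have fin: "finite (orb P ` Y)" for Y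
    by (rule finite_subset[OF _ finite_orbits[OF P(1)]]) auto
  have "n \<le> card (orb P ` X n)" if "n \<le> Suc N" for n using that
  proof (induction n)
    case (Suc n)
    then have "X (Suc n) \<noteq> X n" using neg by auto
    then obtain x where x: "x \<in> X (Suc n)" "x \<notin> X n" using X(2)[of n] by blast
    have "orb P x \<notin> orb P ` X n"
    proof
      assume "orb P x \<in> orb P ` X n"
      then obtain y where y: "y \<in> X n" "orb P y = orb P x" by auto
      obtain \<sigma> where "\<sigma> \<in> aut P" "x = \<sigma> y" using orb_eqD[OF y(2)] .
      then show False using x(2) y(1) invt_image[OF X(1)] by blast
    qed
    then have "orb P ` X n \<subset> orb P ` X (Suc n)" using x X(2)[of n] by blast
    then have "card (orb P ` X n) < card (orb P ` X (Suc n))" by (rule psubset_card_mono[OF fin])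
    then show ?case using Suc by simp
  qed simp
  from this[of "Suc N"] have "Suc N \<le> card (orb P ` X (Suc N))" by simp
  also have "\<dots> \<le> card (range (orb P))" by (rule card_mono[OF finite_orbits[OF P(1)]]) auto
  finally show False using P(2) by simp
qed

end

locale dp_group_no_least = dp_group +
  assumes finite_FC: "finite FC"
    and no_least: "a \<notin> FC \<Longrightarrow> \<exists>b. b \<notin> FC \<and> \<not> cen {b} \<lesssim> cen {a}"
begin

text \<open>An element of every \<open>D b\<close> outside \<open>FC\<close> would satisfy the
  hypothesis of \<open>abelian_if_least\<close>.\<close>

lemma Inter_D: "(\<Inter>b\<in>-FC. D b) \<subseteq> FC"
proof (rule subsetI, rule ccontr)
  fix x assume x: "x \<in> (\<Inter>b\<in>-FC. D b)" "x \<notin> FC"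
  obtain b where "b \<notin> FC" "\<not> cen {b} \<lesssim> cen {x}" using no_least[OF x(2)] by blast
  then show False using x(1) by (auto simp: D_iff)
qed

lemma not_FC: "- FC \<noteq> {}"
  using finite_FC infinite_UNIV by (metis Compl_empty_eq double_complement)

lemma D_chain: "D b \<subseteq> D c \<or> D c \<subseteq> D b"
  using D_total D_mono by blast

text \<open>Otherwise comparability puts \<open>H\<close> almost inside every \<open>D y\<close>
  with \<open>y\<close> outside \<open>FC\<close>, hence by \<open>ale_chain\<close> almost inside
  their intersection, which is finite.\<close>

lemma small_exists: assumes P: "finite P" "invt P H" and H: "sg H" "infinite H"
  shows "\<exists>y. y \<notin> FC \<and> D y \<lesssim> H"
proof (rule ccontr)
  assume neg: "\<not> ?thesis"
  have "H \<lesssim> D y" if y: "y \<in> - FC" for y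
    using total[of "insert y P" H "D y"] P H y neg invt_mono[OF P(2), of "insert y P"] invt_D[of y "insert y P"] sg_D
    by auto
  then have "H \<lesssim> (\<Inter>b\<in>-FC. D b)"
    using ale_chain[OF P H(1) not_FC, of D] sg_D D_chain D_aut by blast
  then show False using Inter_D finite_FC H(2) ale_finite_right finite_subset by metis
qed

text \<open>Take \<open>c\<close> with infinite centralizer, \<open>D y\<close> almost inside
  \<open>cen {c}\<close>, and let \<open>x\<close> be \<open>c\<close> or \<open>y\<close>,
  whichever has the smaller \<open>D\<close>. Then
  \<open>D x \<lesssim> cen {c} \<lesssim> cen {x}\<close>, and
  \<open>cen {x} \<lesssim> cen {b}\<close> for all \<open>b\<close> in \<open>D x\<close>.\<close>

lemma base_exists: "\<exists>x. x \<notin> FC \<and> D x \<lesssim> cen (D x)"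
proof -
  obtain c where c: "c \<in> U" "c \<notin> FC" using U_minus_FC[OF finite_FC] .
  obtain y where y: "y \<notin> FC" "D y \<lesssim> cen {c}"
    using small_exists[of "{c}" "cen {c}"] c invt_cen1[of c "{c}"] sg_cen unfolding U_def by auto
  obtain x where x: "x \<notin> FC" "x \<in> D c" "x \<in> D y"
    using D_total[of c y] c y D_self by blast
  have "D x \<lesssim> D y" using D_mono[OF x(3)] by (rule ale_subset)
  also note y(2)
  also have "cen {c} \<lesssim> cen {x}" using x(2) by (simp add: D_iff)
  finally have "D x \<lesssim> cen {x}" .
  then have "D x \<lesssim> cen {b}" if "b \<in> D x" for b using that ale_trans unfolding D_iff by blast
  then have "D x \<lesssim> cen (D x)" using ale_cen_all[of "{x}" "D x" "D x"] invt_D[of x "{x}"] sg_D by auto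
  then show ?thesis using x(1) by blast
qed

end

locale dp_group_base = dp_group_no_least +
  fixes x0 assumes x0: "x0 \<notin> FC" "D x0 \<lesssim> cen (D x0)"
begin

text \<open>The center of \<open>D x0\<close>, of finite index in it by the choice of
  \<open>x0\<close>. It is infinite, abelian and normal.\<close>

definition A where "A = D x0 \<inter> cen (D x0)"

text \<open>Inside \<open>A\<close> the commutator maps are homomorphisms; for \<open>y\<close>
  outside \<open>FC\<close> the group stays infinite.\<close>

definition B where "B y = D y \<inter> A"

lemma sg_A: "sg A" and invt_A: "x0 \<in> P \<Longrightarrow> invt P A"
  unfolding A_def by (simp_all add: sg_Int sg_D sg_cen invt_Int invt_D invt_cen)

lemma infinite_A: "infinite A"
  unfolding A_def using ale_infinite_Int[OF x0(2) sg_D sg_cen D_infinite[OF x0(1)]] .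

lemma comm_A: "x \<in> A \<Longrightarrow> y \<in> A \<Longrightarrow> x \<cdot> y = y \<cdot> x"
  unfolding A_def cen_def by blast

lemma normal_cen: assumes "\<And>x g. x \<in> X \<Longrightarrow> g \<cdot> (x \<cdot> iv g) \<in> X" "c \<in> cen X"
  shows "g \<cdot> (c \<cdot> iv g) \<in> cen X"
proof -
  have "(g \<cdot> (c \<cdot> iv g)) \<cdot> x = x \<cdot> (g \<cdot> (c \<cdot> iv g))" if x: "x \<in> X" for x
  proof -
    have "iv g \<cdot> (x \<cdot> g) \<in> X" using assms(1)[OF x, of "iv g"] by simp
    then have c: "c \<cdot> (iv g \<cdot> (x \<cdot> g)) = (iv g \<cdot> (x \<cdot> g)) \<cdot> c" using assms(2) by (simp add: cen_def)
    have "(g \<cdot> (c \<cdot> iv g)) \<cdot> x = g \<cdot> ((c \<cdot> (iv g \<cdot> (x \<cdot> g))) \<cdot> iv g)" by simp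
    also have "\<dots> = x \<cdot> (g \<cdot> (c \<cdot> iv g))" unfolding c by simp
    finally show ?thesis .
  qed
  then show ?thesis unfolding cen_def by blast
qed

lemma A_normal: "x \<in> A \<Longrightarrow> g \<cdot> (x \<cdot> iv g) \<in> A"
  unfolding A_def using D_normal normal_cen[of "D x0" x g] by blast

lemma sg_B: "sg (B y)" and B_A: "B y \<subseteq> A" and B_normal: "x \<in> B y \<Longrightarrow> g \<cdot> (x \<cdot> iv g) \<in> B y"
  unfolding B_def using sg_Int sg_D sg_A D_normal A_normal by blast+

lemma B_chain: "B b \<subseteq> B c \<or> B c \<subseteq> B b"
  unfolding B_def using D_chain[of b c] by blast

lemma invt_B: "x0 \<in> P \<Longrightarrow> y \<in> P \<Longrightarrow> invt P (B y)"
  unfolding B_def by (intro invt_Int invt_D invt_A)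

lemma B_aut: "\<sigma> \<in> aut P \<Longrightarrow> x0 \<in> P \<Longrightarrow> B (\<sigma> y) = \<sigma> ` B y"
  unfolding B_def using invt_image[OF invt_A] by (simp add: D_aut aut_image_Int)

lemma infinite_B: "y \<notin> FC \<Longrightarrow> infinite (B y)"
  unfolding B_def
  by (rule infinite_Int[of "{x0,y}"]) (auto intro: invt_D invt_A sg_D sg_A simp: D_infinite infinite_A)

section \<open>The commutator endomorphisms of \<open>A\<close>\<close>

lemma cm_A: assumes "u \<in> A" shows "cm h u \<in> A"
  unfolding cm_def using sg_mlt[OF sg_A assms A_normal[OF sg_iv[OF sg_A assms], of h]] .

text \<open>\<open>A\<close> is normal and abelian, so the factors \<open>u\<close> and
  \<open>h \<cdot> (iv u \<cdot> iv h)\<close> of a commutator can be rearranged.\<close>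

lemma cm_mlt: assumes "u \<in> A" "v \<in> A" shows "cm h (u \<cdot> v) = cm h u \<cdot> cm h v"
proof -
  let ?k = "\<lambda>u. h \<cdot> (iv u \<cdot> iv h)"
  have k: "?k u \<in> A" "?k v \<in> A" using assms sg_iv[OF sg_A] A_normal by blast+
  have "cm h (u \<cdot> v) = u \<cdot> (v \<cdot> (?k v \<cdot> ?k u))" by (simp add: cm_def)
  also have "v \<cdot> (?k v \<cdot> ?k u) = ?k u \<cdot> (v \<cdot> ?k v)"
    using comm_A[OF k(1) sg_mlt[OF sg_A assms(2) k(2)]] by simp
  finally show ?thesis by (simp add: cm_def)
qed

lemma cm_iv: assumes "u \<in> A" shows "cm h (iv u) = iv (cm h u)"
proof -
  have "cm h u \<cdot> cm h (iv u) = cm h u \<cdot> iv (cm h u)"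
    using cm_mlt[OF assms sg_iv[OF sg_A assms], of h] by (simp add: cm_def)
  then show ?thesis unfolding left_cancel .
qed

lemma cm_e: "cm h e = e"
  by (simp add: cm_def)

lemma sg_cm_image: "sg S \<Longrightarrow> S \<subseteq> A \<Longrightarrow> sg (cm h ` S)"
  unfolding sg_def[of "cm h ` S"]
  using sg_e[of S] cm_e sg_mlt[of S] sg_iv[of S] cm_mlt[of _ _ h] cm_iv[of _ h]
  by (auto simp: subset_iff) (metis image_iff)+

lemma cm_image_ale: assumes "S \<subseteq> A" "T \<subseteq> A" "sg T" "S \<lesssim> T" shows "cm h ` S \<lesssim> cm h ` T"
proof -
  obtain R where R: "finite R" "R \<subseteq> S" "\<forall>s\<in>S. \<exists>r\<in>R. iv r \<cdot> s \<in> T" using ale_rep[OF assms(4,3)] by blast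
  have "\<exists>r\<in>cm h ` R. iv r \<cdot> cm h s \<in> cm h ` T" if s: "s \<in> S" for s
  proof -
    obtain r where r: "r \<in> R" "iv r \<cdot> s \<in> T" using R(3) s by blast
    have A: "r \<in> A" "s \<in> A" using r R(2) s assms(1) by blast+
    have "iv (cm h r) \<cdot> cm h s = cm h (iv r \<cdot> s)"
      using cm_mlt[OF sg_iv[OF sg_A A(1)] A(2), of h] cm_iv[OF A(1), of h] by simp
    then show ?thesis using r by blast
  qed
  then show ?thesis unfolding ale_iff by (intro exI[of _ "cm h ` R"]) (use R(1) in blast)
qed

definition N where "N h y = {u \<in> A. cm h u \<in> B y}"

text \<open>The elements \<open>h\<close> such that \<open>cm h\<close> maps a subgroup of finite
  index of \<open>B x\<close> into \<open>B y\<close>.\<close>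

definition L where "L x y = {h. B x \<lesssim> N h y}"

lemma sg_N: "sg (N h y)"
  unfolding N_def
  by (rule sgI) (auto simp: cm_e cm_mlt cm_iv sg_e[OF sg_A] sg_e[OF sg_B] sg_mlt[OF sg_A] sg_mlt[OF sg_B]
      sg_iv[OF sg_A] sg_iv[OF sg_B])

lemma N_aut: assumes s: "\<sigma> \<in> aut P" "x0 \<in> P" shows "N (\<sigma> h) (\<sigma> y) = \<sigma> ` N h y"
proof (rule aut_image_eqI[OF s(1)])
  fix u
  have "\<sigma> u \<in> A \<longleftrightarrow> u \<in> A" using invt_image[OF invt_A[OF s(2)] s(1)] aut_image_iff[OF s(1)] by metis
  then show "\<sigma> u \<in> N (\<sigma> h) (\<sigma> y) \<longleftrightarrow> u \<in> N h y"
    unfolding N_def by (simp add: cm_aut[OF s(1), symmetric] B_aut[OF s] aut_image_iff[OF s(1)])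
qed

lemma L_aut: assumes s: "\<sigma> \<in> aut P" "x0 \<in> P" shows "L (\<sigma> x) (\<sigma> y) = \<sigma> ` L x y"
  by (rule aut_image_eqI[OF s(1)]) (simp add: L_def N_aut[OF s] B_aut[OF s] ale_aut_iff[OF s(1)])

lemma invt_L: assumes "x0 \<in> P" "x \<in> P" "y \<in> P" shows "invt P (L x y)"
  unfolding invt_def using L_aut[of _ P x y] aut_fix assms by metis

text \<open>From [u, hk] = [u, h] h [u, k] h^-1 and the normality of \<open>B y\<close>.\<close>

lemma N_mlt: "N h y \<inter> N k y \<subseteq> N (h \<cdot> k) y"
proof
  fix u assume "u \<in> N h y \<inter> N k y"
  then have u: "u \<in> A" "cm h u \<in> B y" "cm k u \<in> B y" by (auto simp: N_def)
  have "cm (h \<cdot> k) u = cm h u \<cdot> (h \<cdot> (cm k u \<cdot> iv h))" by (simp add: cm_def)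
  then show "u \<in> N (h \<cdot> k) y" unfolding N_def
    using u sg_mlt[OF sg_B u(2) B_normal[OF u(3), of h]] by simp
qed

lemma N_iv: "N h y \<subseteq> N (iv h) y"
proof
  fix u assume "u \<in> N h y"
  then have u: "u \<in> A" "cm h u \<in> B y" by (auto simp: N_def)
  have "cm (iv h) u = iv h \<cdot> (iv (cm h u) \<cdot> iv (iv h))" by (simp add: cm_def)
  then show "u \<in> N (iv h) y" unfolding N_def
    using u B_normal[OF sg_iv[OF sg_B u(2)], of "iv h"] by simp
qed

lemma sg_L: "sg (L x y)"
proof (rule sgI)
  have "N e y = A" unfolding N_def by (auto simp: cm_def sg_e[OF sg_B])
  then show "e \<in> L x y" unfolding L_def using B_A ale_subset by simp
  show "h \<cdot> k \<in> L x y" if "h \<in> L x y" "k \<in> L x y" for h k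
    using ale_Int2[of "B x" "N h y" "N k y"] that sg_N sg_B N_mlt[of h y k] unfolding L_def
    by (blast intro: ale_mono)
  show "iv h \<in> L x y" if "h \<in> L x y" for h
    using that N_iv[of h y] unfolding L_def by (blast intro: ale_mono)
qed

text \<open>The image of \<open>B x\<close> is comparable with \<open>B y\<close>. If it were almost
  inside \<open>B y\<close>, preimages of coset representatives would put \<open>B x\<close> almost
  inside \<open>N h y\<close>.\<close>

lemma L_complement: assumes "h \<notin> L x y" shows "B y \<lesssim> cm h ` B x"
proof (rule ccontr)
  assume neg: "\<not> B y \<lesssim> cm h ` B x"
  have sg: "sg (cm h ` B x)" by (rule sg_cm_image[OF sg_B B_A])
  have inv: "invt {x0,x,y,h} (cm h ` B x)"
    by (rule invtI) (use cm_aut[of _ "{x0,x,y,h}" h] aut_fix invt_image[OF invt_B[of "{x0,x,y,h}" x]] in fastforce)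
  have "cm h ` B x \<lesssim> B y"
    using total[of "{x0,x,y,h}" "cm h ` B x" "B y"] sg inv sg_B neg invt_B[of "{x0,x,y,h}" y] by auto
  from ale_rep[OF this sg_B]
  obtain R where R: "finite R" "R \<subseteq> cm h ` B x" "\<forall>s\<in>cm h ` B x. \<exists>r\<in>R. iv r \<cdot> s \<in> B y"
    by blast
  obtain R' where R': "finite R'" "R' \<subseteq> B x" "R = cm h ` R'" using finite_subset_image[OF R(1,2)] by blast
  have "\<exists>r\<in>R'. iv r \<cdot> u \<in> N h y" if u: "u \<in> B x" for u
  proof -
    obtain r where r: "r \<in> R'" "iv (cm h r) \<cdot> cm h u \<in> B y" using R(3) R'(3) u by blast
    have A: "r \<in> A" "u \<in> A" using r u R'(2) B_A by blast+
    have "cm h (iv r \<cdot> u) \<in> B y" using r(2) cm_mlt[OF sg_iv[OF sg_A A(1)] A(2), of h] cm_iv[OF A(1), of h] by simp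
    then show ?thesis unfolding N_def using r(1) sg_mlt[OF sg_A sg_iv[OF sg_A A(1)] A(2)] by blast
  qed
  then have "B x \<lesssim> N h y" unfolding ale_iff using R'(1) by blast
  then show False using assms unfolding L_def by blast
qed

text \<open>For \<open>h\<close> in all these groups, \<open>ale_chain\<close> puts
  \<open>B x\<close> almost inside a group whose commutators with \<open>h\<close> lie in the finite
  set \<open>FC\<close>. Elements with equal commutators differ by an element of
  \<open>cen {h}\<close>.\<close>

lemma Inter_L: "(\<Inter>y\<in>-FC. L x y) \<subseteq> acen (B x)"
proof
  fix h assume h: "h \<in> (\<Inter>y\<in>-FC. L x y)"
  let ?M = "{u \<in> A. cm h u \<in> FC}"
  have "B x \<lesssim> (\<Inter>y\<in>-FC. N h y)"
  proof (rule ale_chain[of "{x0,x,h}"])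
    show "invt {x0,x,h} (B x)" by (rule invt_B) auto
    show "N h (\<sigma> y) = \<sigma> ` N h y" if s: "\<sigma> \<in> aut {x0,x,h}" for \<sigma> y
      using N_aut[OF s, of h y] aut_fix[OF s, of h] by simp
    show "N h b \<subseteq> N h c \<or> N h c \<subseteq> N h b" for b c using B_chain[of b c] unfolding N_def by blast
  qed (use h in \<open>auto simp: L_def sg_B sg_N not_FC simp del: Compl_iff\<close>)
  also have "(\<Inter>y\<in>-FC. N h y) \<subseteq> ?M"
  proof
    fix u assume u: "u \<in> (\<Inter>y\<in>-FC. N h y)"
    then have "cm h u \<in> (\<Inter>y\<in>-FC. D y)" unfolding N_def B_def by blast
    moreover have "u \<in> A" using u not_FC unfolding N_def by blast
    ultimately show "u \<in> ?M" using Inter_D by blast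
  qed
  then have "(\<Inter>y\<in>-FC. N h y) \<lesssim> ?M" by (rule ale_subset)
  also have "?M \<lesssim> cen {h}"
  proof -
    have "finite (cm h ` ?M)" by (rule finite_subset[OF _ finite_FC]) blast
    then obtain R where R: "finite R" "R \<subseteq> ?M" "cm h ` ?M = cm h ` R"
      by (meson finite_subset_image subset_refl)
    have "\<exists>r\<in>R. iv r \<cdot> u \<in> cen {h}" if u: "u \<in> ?M" for u
    proof -
      have "cm h u \<in> cm h ` R" using u R(3) by blast
      then obtain r where r: "r \<in> R" "cm h u = cm h r" by blast
      have A: "r \<in> A" "u \<in> A" using r u R(2) by blast+
      have "cm h (iv r \<cdot> u) = e"
        using cm_mlt[OF sg_iv[OF sg_A A(1)] A(2), of h] cm_iv[OF A(1), of h] r(2) by simp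
      then show ?thesis using r(1) cm_eq_e by blast
    qed
    then show ?thesis unfolding ale_iff using R(1) by blast
  qed
  finally show "h \<in> acen (B x)" by (simp add: acen_def)
qed

text \<open>Otherwise \<open>ale_cen_all\<close> gives infinitely many elements of
  \<open>B x\<close> centralizing a subgroup of finite index, and such elements lie in
  \<open>FC\<close>.\<close>

lemma acen_B_infinite_index: assumes x: "x \<notin> FC" shows "\<not> UNIV \<lesssim> acen (B x)"
proof
  assume fin: "UNIV \<lesssim> acen (B x)"
  have "B x \<lesssim> cen (acen (B x))"
    by (rule ale_cen_all[of "{x0,x}"]) (auto intro: invt_B sg_B simp: acen_def)
  then have "infinite (B x \<inter> cen (acen (B x)))" using ale_infinite_Int sg_B sg_cen infinite_B[OF x] by blast
  moreover have "B x \<inter> cen (acen (B x)) \<subseteq> FC"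
  proof
    fix y assume "y \<in> B x \<inter> cen (acen (B x))"
    then have "acen (B x) \<subseteq> cen {y}" unfolding cen_def by auto
    then show "y \<in> FC" using fin unfolding acen_def[of UNIV] by (blast intro: ale_mono)
  qed
  ultimately show False using finite_FC finite_subset by blast
qed

text \<open>The groups \<open>L x y\<close> shrink with \<open>B y\<close>. If all had finite index,
  then by \<open>ale_chain\<close> so would their intersection, which lies in
  \<open>acen (B x)\<close>.\<close>

lemma L_infinite_index: assumes x: "x \<notin> FC" shows "\<exists>y. y \<notin> FC \<and> \<not> UNIV \<lesssim> L x y"
proof (rule ccontr)
  assume neg: "\<not> ?thesis"
  have "UNIV \<lesssim> (\<Inter>y\<in>-FC. L x y)"
  proof (rule ale_chain[of "{x0,x}"])
    show "L x (\<sigma> y) = \<sigma> ` L x y" if s: "\<sigma> \<in> aut {x0,x}" for \<sigma> y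
      using L_aut[OF s, of x y] aut_fix[OF s, of x] by simp
    have mono: "L x b \<subseteq> L x c" if "B b \<subseteq> B c" for b c
      unfolding L_def N_def using that by (auto intro: ale_mono)
    show "L x b \<subseteq> L x c \<or> L x c \<subseteq> L x b" for b c using B_chain[of b c] mono by blast
  qed (use neg in \<open>auto simp: sg_L not_FC invt_UNIV simp del: Compl_iff\<close>)
  then have "UNIV \<lesssim> acen (B x)" using Inter_L by (blast intro: ale_mono)
  then show False using acen_B_infinite_index[OF x] by blast
qed

lemma iterate_A: "u \<in> A \<Longrightarrow> (cm g ^^ n) u \<in> A"
  by (induction n) (simp_all add: cm_A)

lemma iterate_image_Suc: "(cm g ^^ Suc n) ` S = cm g ` (cm g ^^ n) ` S"
  by (simp add: image_image)

lemma sg_iterate: "sg ((cm g ^^ n) ` A)"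
proof (induction n)
  case (Suc n)
  show ?case unfolding iterate_image_Suc by (rule sg_cm_image[OF Suc]) (use iterate_A in blast)
qed (simp add: sg_A)

lemma iterate_aut: "\<sigma> \<in> aut P \<Longrightarrow> g \<in> P \<Longrightarrow> \<sigma> ((cm g ^^ n) u) = (cm g ^^ n) (\<sigma> u)"
  by (induction n) (simp_all add: cm_aut aut_fix)

text \<open>The endomorphism \<open>u \<mapsto> [u, g]\<close> of \<open>A\<close> is nilpotent up to finite groups, uniformly in \<open>g \<in> U\<close>,
  whereas a suitable \<open>g \<in> U\<close> maps each term of a long chain of the groups \<open>B x\<close> onto
  the next one up to finite index.\<close>

lemma contradiction: False
proof -
  \<comment> \<open>\<open>M\<close> is fixed before \<open>g\<close>, because the number of groups
    that \<open>g\<close> has to avoid depends on it.\<close>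
  obtain M where M: "\<And>g. card (range (orb (insert g {x0}))) \<le> M"
    using orbit_number_bounded[of "{x0}"] by blast
  \<comment> \<open>Infinite index of each link lets one \<open>g\<close> avoid the first
    \<open>Suc M\<close> of them at once.\<close>
  obtain x where x: "\<And>n. x n \<notin> FC \<and> \<not> UNIV \<lesssim> L (x n) (x (Suc n))"
  proof -
    have "\<exists>x. \<forall>n::nat. x n \<notin> FC \<and> \<not> UNIV \<lesssim> L (x n) (x (Suc n))"
      by (rule dependent_nat_choice) (use x0 L_infinite_index in blast)+
    then show thesis using that by blast
  qed
  let ?LL = "(\<lambda>n. L (x n) (x (Suc n))) ` {..M}"
  have "\<exists>g\<in>U. \<forall>L\<in>?LL. g \<notin> L"
  proof (rule avoid_finite_union)
    show "finite (insert x0 (x ` {..Suc M}))" by simp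
    show "sg K \<and> invt (insert x0 (x ` {..Suc M})) K \<and> \<not> UNIV \<lesssim> K" if K: "K \<in> ?LL" for K
    proof -
      obtain n where n: "n \<le> M" "K = L (x n) (x (Suc n))" using K by blast
      then show ?thesis using x[of n] sg_L by (auto intro!: invt_L)
    qed
  qed simp
  then obtain g where g: "g \<in> U" "\<And>n. n \<le> M \<Longrightarrow> g \<notin> L (x n) (x (Suc n))" by blast
  \<comment> \<open>By \<open>L_complement\<close> the image of \<open>A\<close> under each iterate
    almost contains a member of the chain, so it is infinite.\<close>
  have large: "B (x n) \<lesssim> (cm g ^^ n) ` A" if "n \<le> Suc M" for n using that
  proof (induction n)
    case 0
    then show ?case using B_A ale_subset by simp
  next
    case (Suc n)
    have "B (x (Suc n)) \<lesssim> cm g ` B (x n)" using L_complement g(2) Suc by simp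
    also have "\<dots> \<lesssim> (cm g ^^ Suc n) ` A" unfolding iterate_image_Suc
      by (rule cm_image_ale) (use B_A iterate_A sg_iterate Suc in auto)
    finally show ?case .
  qed
  define ker where "ker n = {u \<in> A. (cm g ^^ n) u = e}" for n
  have "\<exists>n\<le>M. ker (Suc n) = ker n"
  proof (rule invariant_chain_stops[of "{g, x0}"])
    show "invt {g, x0} (ker n)" for n
    proof (rule invtI)
      fix \<sigma> u assume s: "\<sigma> \<in> aut {g, x0}" and u: "u \<in> ker n"
      have "\<sigma> u \<in> A" using u invt_image[OF invt_A s] unfolding ker_def by blast
      then show "\<sigma> u \<in> ker n" using u iterate_aut[OF s, of g n u] aut_e[OF s] unfolding ker_def by simp
    qed
    show "ker n \<subseteq> ker (Suc n)" for n
    proof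
      fix u assume u: "u \<in> ker n"
      then have "(cm g ^^ Suc n) u = cm g e" unfolding ker_def by simp
      then show "u \<in> ker (Suc n)" using u cm_e unfolding ker_def by simp
    qed
    show "card (range (orb {g, x0})) \<le> M" using M[of g] by simp
  qed simp
  then obtain n where n: "n \<le> M" "ker (Suc n) = ker n" by blast
  have "infinite ((cm g ^^ n) ` A)"
    using large[of n] n(1) infinite_B x ale_finite_right by (meson le_SucI)
  moreover have "infinite (cen {g} \<inter> A)"
    by (rule infinite_Int[of "{g,x0}"]) (use g(1) in \<open>auto intro: invt_cen1 invt_A sg_cen sg_A simp: U_def infinite_A\<close>)
  moreover have "invt {g,x0} ((cm g ^^ n) ` A)"
  proof (rule invtI)
    fix \<sigma> w assume s: "\<sigma> \<in> aut {g, x0}" and "w \<in> (cm g ^^ n) ` A"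
    then obtain u where u: "u \<in> A" "w = (cm g ^^ n) u" by blast
    have "\<sigma> u \<in> A" using u invt_image[OF invt_A s] by blast
    then show "\<sigma> w \<in> (cm g ^^ n) ` A" using u(2) iterate_aut[OF s, of g n u] by simp
  qed
  ultimately have "infinite ((cen {g} \<inter> A) \<inter> (cm g ^^ n) ` A)"
    by (intro infinite_Int[of "{g,x0}"]) (auto intro: invt_Int invt_cen1 invt_A sg_cen sg_A sg_Int sg_iterate)
  \<comment> \<open>If \<open>w = (cm g ^^ n) u\<close> commutes with \<open>g\<close>, then
    \<open>u\<close> is in \<open>ker (Suc n) = ker n\<close>, so \<open>w = e\<close>.\<close>
  moreover have "(cen {g} \<inter> A) \<inter> (cm g ^^ n) ` A \<subseteq> {e}"
  proof
    fix w assume w: "w \<in> (cen {g} \<inter> A) \<inter> (cm g ^^ n) ` A"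
    then obtain u where u: "u \<in> A" "w = (cm g ^^ n) u" by blast
    have "cm g w = e" using w cm_eq_e by blast
    then have "u \<in> ker (Suc n)" unfolding ker_def using u by simp
    then have "u \<in> ker n" unfolding n(2) .
    then show "w \<in> {e}" unfolding ker_def using u(2) by simp
  qed
  ultimately show False using finite_subset by blast
qed

end

context dp_group begin

theorem infinite_invariant_abelian_subgroup:
  "\<exists>A. sg A \<and> infinite A \<and> abelian A \<and> invt {} A"
proof (rule ccontr)
  assume neg: "\<not> ?thesis"
  have fin: "finite FC" using abelian_if_infinite_FC neg by blast
  have "\<exists>b. b \<notin> FC \<and> \<not> cen {b} \<lesssim> cen {a}" if "a \<notin> FC" for a
    using abelian_if_least[OF fin that] neg by blast
  then interpret dp_group_no_least mlt e iv by unfold_locales (use fin in auto)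
  obtain x where "x \<notin> FC" "D x \<lesssim> cen (D x)" using base_exists by blast
  then interpret dp_group_base mlt e iv x by unfold_locales
  show False by (rule contradiction)
qed

end

section \<open>Types in omega-categorical structures\<close>

instance gterm :: countable by countable_datatype
instance gform :: countable by countable_datatype

section \<open>Renaming of variables\<close>

primrec trename :: "(nat \<Rightarrow> nat) \<Rightarrow> gterm \<Rightarrow> gterm" where
  "trename r (Var n) = Var (r n)"
| "trename r (Times s t) = Times (trename r s) (trename r t)"

text \<open>Renamings may identify variables: \<open>var_inst\<close> below uses a constant
  one.\<close>

primrec frename :: "gform \<Rightarrow> (nat \<Rightarrow> nat) \<Rightarrow> gform" where
  "frename (Eq s t) r = Eq (trename r s) (trename r t)"
| "frename (Neg \<phi>) r = Neg (frename \<phi> r)"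
| "frename (And \<phi> \<psi>) r = And (frename \<phi> r) (frename \<psi> r)"
| "frename (Exists \<phi>) r = Exists (frename \<phi> (case_nat 0 (\<lambda>n. Suc (r n))))"

lemma gval_trename: "gval M e (trename r t) = gval M (\<lambda>n. e (r n)) t"
  by (induction t) auto

lemma gsat_frename: "gsat M e (frename \<phi> r) \<longleftrightarrow> gsat M (\<lambda>n. e (r n)) \<phi>"
proof (induction \<phi> arbitrary: e r)
  case (Exists \<phi>)
  have "(\<lambda>n. case_nat c e (case_nat 0 (\<lambda>n. Suc (r n)) n)) = case_nat c (\<lambda>n. e (r n))" for c
    by (auto simp: fun_eq_iff split: nat.split)
  then show ?case by (simp add: Exists)
qed (auto simp: gval_trename)

lemma tvars_trename: "tvars (trename r t) = r ` tvars t"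
  by (induction t) auto

lemma fvars_frename: "fvars (frename \<phi> r) = r ` fvars \<phi>"
proof (induction \<phi> arbitrary: r)
  case (Exists \<phi>)
  have "Suc n \<in> case_nat 0 (\<lambda>n. Suc (r n)) ` fvars \<phi> \<longleftrightarrow> n \<in> r ` {n. Suc n \<in> fvars \<phi>}" for n
  proof
    assume "Suc n \<in> case_nat 0 (\<lambda>n. Suc (r n)) ` fvars \<phi>"
    then obtain k where "k \<in> fvars \<phi>" "Suc n = case_nat 0 (\<lambda>n. Suc (r n)) k" by blast
    then show "n \<in> r ` {n. Suc n \<in> fvars \<phi>}" by (cases k) auto
  qed force
  then show ?case by (simp add: Exists set_eq_iff)
qed (auto simp: tvars_trename)

lemma finite_tvars: "finite (tvars t)"
  by (induction t) auto

lemma finite_fvars: "finite (fvars \<phi>)"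
proof (induction \<phi>)
  case (Exists \<phi>)
  then show ?case using finite_vimageI[of "fvars \<phi>" Suc] by (simp add: vimage_def)
qed (auto simp: finite_tvars)

lemma gval_cong: "(\<And>n. n \<in> tvars t \<Longrightarrow> e n = e' n) \<Longrightarrow> gval M e t = gval M e' t"
  by (induction t) auto

lemma gsat_cong: "(\<And>n. n \<in> fvars \<phi> \<Longrightarrow> e n = e' n) \<Longrightarrow> gsat M e \<phi> \<longleftrightarrow> gsat M e' \<phi>"
proof (induction \<phi> arbitrary: e e')
  case (Eq s t)
  then show ?case using gval_cong[of s e e'] gval_cong[of t e e'] by auto
next
  case (Exists \<phi>)
  have "gsat M (case_nat c e) \<phi> \<longleftrightarrow> gsat M (case_nat c e') \<phi>" for c
    by (rule Exists.IH) (use Exists.prems in \<open>auto split: nat.split\<close>)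
  then show ?case by simp
next
  case (And \<phi> \<psi>)
  have "gsat M e \<phi> \<longleftrightarrow> gsat M e' \<phi>" by (rule And.IH(1)) (use And.prems in auto)
  moreover have "gsat M e \<psi> \<longleftrightarrow> gsat M e' \<psi>" by (rule And.IH(2)) (use And.prems in auto)
  ultimately show ?case by simp
next
  case (Neg \<phi>)
  have "gsat M e \<phi> \<longleftrightarrow> gsat M e' \<phi>" by (rule Neg.IH) (use Neg.prems in auto)
  then show ?case by simp
qed

text \<open>A sentence, so it adds no free variables; its truth uses that the universe is
  nonempty.\<close>

definition fTrue :: gform where "fTrue = Exists (Eq (Var 0) (Var 0))"

definition fConj :: "gform list \<Rightarrow> gform" where "fConj \<phi>s = foldr And \<phi>s fTrue"

definition fAll :: "gform \<Rightarrow> gform" where "fAll \<phi> = Neg (Exists (Neg \<phi>))"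

definition fImp :: "gform \<Rightarrow> gform \<Rightarrow> gform" where "fImp \<phi> \<psi> = Neg (And \<phi> (Neg \<psi>))"

lemma fvars_fTrue [simp]: "fvars fTrue = {}" by (auto simp: fTrue_def)

lemma fvars_fConj [simp]: "fvars (fConj \<phi>s) = (\<Union>\<phi>\<in>set \<phi>s. fvars \<phi>)"
  unfolding fConj_def by (induction \<phi>s) auto

lemma fvars_fAll [simp]: "fvars (fAll \<phi>) = {n. Suc n \<in> fvars \<phi>}" by (simp add: fAll_def)

lemma fvars_fImp [simp]: "fvars (fImp \<phi> \<psi>) = fvars \<phi> \<union> fvars \<psi>" by (simp add: fImp_def)

lemma gsat_fTrue: "univ M \<noteq> {} \<Longrightarrow> gsat M e fTrue" by (auto simp: fTrue_def)

lemma gsat_fConj: "univ M \<noteq> {} \<Longrightarrow> gsat M e (fConj \<phi>s) \<longleftrightarrow> (\<forall>\<phi>\<in>set \<phi>s. gsat M e \<phi>)"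
  unfolding fConj_def by (induction \<phi>s) (auto simp: gsat_fTrue)

lemma gsat_fAll [simp]: "gsat M e (fAll \<phi>) \<longleftrightarrow> (\<forall>c\<in>univ M. gsat M (case_nat c e) \<phi>)"
  by (simp add: fAll_def)

lemma gsat_fImp [simp]: "gsat M e (fImp \<phi> \<psi>) \<longleftrightarrow> (gsat M e \<phi> \<longrightarrow> gsat M e \<psi>)"
  by (simp add: fImp_def)

text \<open>The environment that lists \<open>l\<close> and then continues with \<open>e\<close>.
  \<open>app_Cons\<close> fits one quantifier in front of the tuple, \<open>app_snoc\<close> the
  outermost quantifier of a block.\<close>

definition app :: "'a list \<Rightarrow> (nat \<Rightarrow> 'a) \<Rightarrow> nat \<Rightarrow> 'a" where
  "app l e k = (if k < length l then l ! k else e (k - length l))"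

lemma app_Nil [simp]: "app [] e = e" by (simp add: app_def fun_eq_iff)

lemma app_Cons: "app (c # l) e = case_nat c (app l e)"
  by (auto simp: app_def fun_eq_iff split: nat.split)

lemma app_snoc: "app (l @ [c]) e = app l (case_nat c e)"
proof
  fix k
  consider "k < length l" | "k = length l" | d where "k = Suc (length l + d)"
    by (metis less_imp_Suc_add linorder_neqE_nat)
  then show "app (l @ [c]) e k = app l (case_nat c e) k"
    by cases (auto simp: app_def nth_append)
qed

lemma app_cong: "fvars \<phi> \<subseteq> {..<length l} \<Longrightarrow> gsat M (app l e) \<phi> \<longleftrightarrow> gsat M ((!) l) \<phi>"
  by (rule gsat_cong) (auto simp: app_def)

lemma range_app: "set l \<subseteq> A \<Longrightarrow> range e \<subseteq> A \<Longrightarrow> range (app l e) \<subseteq> A"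
  by (auto simp: app_def subset_iff)

lemma range_case_nat: "c \<in> A \<Longrightarrow> range e \<subseteq> A \<Longrightarrow> range (case_nat c e) \<subseteq> A"
  by (auto simp: image_subset_iff split: nat.split)

text \<open>The Tarski--Vaught criterion for an elementary substructure.\<close>

definition elementary :: "'m gstruct \<Rightarrow> 'm set \<Rightarrow> bool" where
  "elementary M S \<longleftrightarrow> S \<noteq> {} \<and> S \<subseteq> univ M \<and>
     (\<forall>\<phi> e. range e \<subseteq> S \<longrightarrow> (\<exists>c\<in>univ M. gsat M (case_nat c e) \<phi>) \<longrightarrow> (\<exists>c\<in>S. gsat M (case_nat c e) \<phi>))"

abbreviation substr :: "'m gstruct \<Rightarrow> 'm set \<Rightarrow> 'm gstruct" where
  "substr M S \<equiv> \<lparr>univ = S, mul = mul M\<rparr>"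

lemma elemD: "elementary M S \<Longrightarrow> range e \<subseteq> S \<Longrightarrow> c \<in> univ M \<Longrightarrow> gsat M (case_nat c e) \<phi> \<Longrightarrow> \<exists>c\<in>S. gsat M (case_nat c e) \<phi>"
  unfolding elementary_def by blast

lemma gval_substr: "gval (substr M S) e t = gval M e t"
  by (induction t) auto

lemma elem_gsat: assumes "elementary M S" shows "range e \<subseteq> S \<Longrightarrow> gsat (substr M S) e \<phi> \<longleftrightarrow> gsat M e \<phi>"
proof (induction \<phi> arbitrary: e)
  case (Exists \<phi>)
  have "(\<exists>c\<in>S. gsat (substr M S) (case_nat c e) \<phi>) \<longleftrightarrow> (\<exists>c\<in>S. gsat M (case_nat c e) \<phi>)"
    using Exists.IH[OF range_case_nat] Exists.prems by blast
  also have "\<dots> \<longleftrightarrow> (\<exists>c\<in>univ M. gsat M (case_nat c e) \<phi>)"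
  proof
    assume "\<exists>c\<in>S. gsat M (case_nat c e) \<phi>"
    then show "\<exists>c\<in>univ M. gsat M (case_nat c e) \<phi>" using assms unfolding elementary_def by blast
  next
    assume "\<exists>c\<in>univ M. gsat M (case_nat c e) \<phi>"
    then show "\<exists>c\<in>S. gsat M (case_nat c e) \<phi>" using elemD[OF assms Exists.prems] by blast
  qed
  finally show ?case by simp
qed (auto simp: gval_substr)

lemma elem_mul: assumes "elementary M S" "is_struct M" "x \<in> S" "y \<in> S" shows "mul M x y \<in> S"
proof -
  have "mul M x y \<in> univ M" using assms unfolding elementary_def is_struct_def by blast
  \<comment> \<open>The product is the only solution of an equation with parameters in
    \<open>S\<close>.\<close>
  then have "\<exists>c\<in>S. gsat M (case_nat c (case_nat x (\<lambda>_. y))) (Eq (Var 0) (Times (Var (Suc 0)) (Var (Suc (Suc 0)))))"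
    using assms by (intro elemD[of M S _ "mul M x y"]) (auto split: nat.splits)
  then show ?thesis by simp
qed

lemma elem_is_struct: "elementary M S \<Longrightarrow> is_struct M \<Longrightarrow> is_struct (substr M S)"
  using elem_mul[of M S] unfolding is_struct_def elementary_def by auto

text \<open>If \<open>S\<close> were finite, the formula saying that a variable differs from each of
  its elements would have a solution in \<open>M\<close> but none in \<open>S\<close>.\<close>

lemma elem_infinite: assumes "elementary M S" "infinite (univ M)" shows "infinite S"
proof
  assume fin: "finite S"
  obtain l where l: "set l = S" using finite_list[OF fin] by blast
  obtain d where d: "d \<in> S" using assms unfolding elementary_def by blast
  have ne: "univ M \<noteq> {}" using assms by auto
  obtain c where c: "c \<in> univ M" "c \<notin> S" using assms fin by (meson finite_subset subsetI)
  let ?\<phi> = "fConj (map (\<lambda>i. Neg (Eq (Var 0) (Var (Suc i)))) [0..<length l])"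
  have e: "range (app l (\<lambda>_. d)) \<subseteq> S" using range_app[of l S] l d by auto
  have "gsat M (case_nat c (app l (\<lambda>_. d))) ?\<phi>"
    unfolding gsat_fConj[OF ne] using c l by (auto simp: app_def in_set_conv_nth)
  then obtain c' where c': "c' \<in> S" "gsat M (case_nat c' (app l (\<lambda>_. d))) ?\<phi>"
    using elemD[OF assms(1) e c(1)] by blast
  have "c' \<noteq> l ! i" if "i < length l" for i
    using c'(2) that unfolding gsat_fConj[OF ne] by (auto simp: app_def)
  then show False using c'(1) l by (metis in_set_conv_nth)
qed

lemma gval_univ: "is_struct M \<Longrightarrow> range e \<subseteq> univ M \<Longrightarrow> gval M e t \<in> univ M"
  by (induction t) (auto simp: is_struct_def)

lemma gsat_isomorphism:
  assumes f: "bij_betw f (univ M) (univ N)" "\<And>x y. x \<in> univ M \<Longrightarrow> y \<in> univ M \<Longrightarrow> f (mul M x y) = mul N (f x) (f y)"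
    and M: "is_struct M"
  shows "range e \<subseteq> univ M \<Longrightarrow> gsat N (\<lambda>n. f (e n)) \<phi> \<longleftrightarrow> gsat M e \<phi>"
proof (induction \<phi> arbitrary: e)
  case (Eq s t)
  have v: "gval N (\<lambda>n. f (e n)) u = f (gval M e u)" for u
    by (induction u) (use f gval_univ[OF M Eq] in auto)
  show ?case unfolding gsat.simps v
    using inj_on_eq_iff[OF bij_betw_imp_inj_on[OF f(1)] gval_univ[OF M Eq] gval_univ[OF M Eq]] .
next
  case (Exists \<phi>)
  have c: "(\<lambda>n. f (case_nat c e n)) = case_nat (f c) (\<lambda>n. f (e n))" for c
    by (auto simp: fun_eq_iff split: nat.split)
  have "gsat N (\<lambda>n. f (e n)) (Exists \<phi>) \<longleftrightarrow> (\<exists>c\<in>univ M. gsat N (case_nat (f c) (\<lambda>n. f (e n))) \<phi>)"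
    unfolding gsat.simps bij_betw_imp_surj_on[OF f(1), symmetric] by blast
  also have "\<dots> \<longleftrightarrow> (\<exists>c\<in>univ M. gsat M (case_nat c e) \<phi>)"
  proof (rule bex_cong[OF refl])
    fix c assume "c \<in> univ M"
    from Exists.IH[OF range_case_nat[OF this Exists.prems]]
    show "gsat N (case_nat (f c) (\<lambda>n. f (e n))) \<phi> \<longleftrightarrow> gsat M (case_nat c e) \<phi>" unfolding c .
  qed
  finally show ?case by simp
qed auto

text \<open>Categoricity is stated for countable elementary submodels of one saturated structure, so
  that all types can be compared inside \<open>C\<close>.\<close>

locale categorical_struct =
  fixes C :: "'m gstruct"
  assumes struct: "is_struct C"
    and saturated: "aleph1_saturated C"
    and categorical: "elementary C S \<Longrightarrow> countable S \<Longrightarrow> elementary C S' \<Longrightarrow> countable S' \<Longrightarrow>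
       isomorphic (substr C S) (substr C S')"
begin

abbreviation sat :: "'m list \<Rightarrow> gform \<Rightarrow> bool" where "sat l \<phi> \<equiv> gsat C ((!) l) \<phi>"

definition tup :: "nat \<Rightarrow> 'm list set" where "tup n = {l. length l = n \<and> set l \<subseteq> univ C}"

text \<open>Equality of complete types over the empty set, computed in \<open>C\<close>.\<close>

definition eqv :: "'m list \<Rightarrow> 'm list \<Rightarrow> bool" where
  "eqv l l' \<longleftrightarrow> length l = length l' \<and> (\<forall>\<phi>. fvars \<phi> \<subseteq> {..<length l} \<longrightarrow> sat l \<phi> = sat l' \<phi>)"

text \<open>Satisfiability is left to \<open>isolated\<close>; an inconsistent formula counts
  here.\<close>

definition isolates :: "gform \<Rightarrow> nat \<Rightarrow> bool" where
  "isolates \<chi> n \<longleftrightarrow> fvars \<chi> \<subseteq> {..<n} \<and> (\<forall>l\<in>tup n. \<forall>l'\<in>tup n. sat l \<chi> \<longrightarrow> sat l' \<chi> \<longrightarrow> eqv l l')"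

definition isolated :: "'m list \<Rightarrow> bool" where
  "isolated l \<longleftrightarrow> (\<exists>\<chi>. isolates \<chi> (length l) \<and> sat l \<chi>)"

lemma univ_ne: "univ C \<noteq> {}"
  using struct by (simp add: is_struct_def)

lemma eqv_sym: "eqv l l' \<Longrightarrow> eqv l' l" and eqv_trans: "eqv l l' \<Longrightarrow> eqv l' l'' \<Longrightarrow> eqv l l''"
  and eqv_length: "eqv l l' \<Longrightarrow> length l = length l'"
  and eqv_sat: "eqv l l' \<Longrightarrow> fvars \<phi> \<subseteq> {..<length l} \<Longrightarrow> sat l \<phi> = sat l' \<phi>"
  by (auto simp: eqv_def)

lemma isolated_eqv: assumes "isolated l" "eqv l l'" shows "isolated l'"
proof -
  obtain \<chi> where "isolates \<chi> (length l)" "sat l \<chi>" using assms(1) unfolding isolated_def by blast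
  then show ?thesis using eqv_sat[OF assms(2), of \<chi>] eqv_length[OF assms(2)]
    unfolding isolated_def isolates_def by metis
qed

lemma eqv_select:
  assumes "eqv l l'" "\<forall>i\<in>set ks. i < length l"
  shows "eqv (map ((!) l) ks) (map ((!) l') ks)"
  unfolding eqv_def
proof (intro conjI allI impI)
  fix \<phi> assume v: "fvars \<phi> \<subseteq> {..<length (map ((!) l) ks)}"
  have "sat (map ((!) k) ks) \<phi> \<longleftrightarrow> sat k (frename \<phi> ((!) ks))" for k
    unfolding gsat_frename by (rule gsat_cong) (use v in auto)
  moreover have "fvars (frename \<phi> ((!) ks)) \<subseteq> {..<length l}"
    unfolding fvars_frename using assms(2) v by (auto simp: subset_iff)
  ultimately show "sat (map ((!) l) ks) \<phi> = sat (map ((!) l') ks) \<phi>" using eqv_sat[OF assms(1)] by simp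
qed simp

lemma isomorphism_eqv:
  assumes "elementary C S" "elementary C S'" "bij_betw f S S'" "\<And>x y. x \<in> S \<Longrightarrow> y \<in> S \<Longrightarrow> f (mul C x y) = mul C (f x) (f y)"
    "set l \<subseteq> S"
  shows "eqv l (map f l)"
  unfolding eqv_def
proof (intro conjI allI impI)
  fix \<phi> assume v: "fvars \<phi> \<subseteq> {..<length l}"
  \<comment> \<open>A default value from \<open>S\<close> fills the variables beyond the tuple and
    keeps the environment inside \<open>S\<close>.\<close>
  obtain d where d: "d \<in> S" using assms unfolding elementary_def by blast
  let ?e = "app l (\<lambda>_. d)"
  have e: "range ?e \<subseteq> S" using assms(5) d by (intro range_app) auto
  have fe: "(\<lambda>n. f (?e n)) = app (map f l) (\<lambda>_. f d)" by (auto simp: app_def)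
  have e': "range (\<lambda>n. f (?e n)) \<subseteq> S'" using e assms(3) unfolding bij_betw_def by blast
  have "sat l \<phi> \<longleftrightarrow> gsat C ?e \<phi>" using app_cong[OF v] by blast
  also have "\<dots> \<longleftrightarrow> gsat (substr C S) ?e \<phi>" using elem_gsat[OF assms(1) e] by blast
  also have "\<dots> \<longleftrightarrow> gsat (substr C S') (\<lambda>n. f (?e n)) \<phi>"
    by (rule gsat_isomorphism[symmetric]) (use assms e elem_is_struct[OF assms(1) struct] in auto)
  also have "\<dots> \<longleftrightarrow> gsat C (app (map f l) (\<lambda>_. f d)) \<phi>" using elem_gsat[OF assms(2) e'] fe by simp
  also have "\<dots> \<longleftrightarrow> sat (map f l) \<phi>" by (rule app_cong) (use v in simp)
  finally show "sat l \<phi> = sat (map f l) \<phi>" .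
qed simp

text \<open>Saturation is given for one variable. The tail is realised first, for the formulas
  saying that each finite part of \<open>p\<close> has a suitable head; saturation over the tail and
  \<open>e\<close> then yields the head.\<close>

lemma tuple_saturation:
  assumes "range e \<subseteq> univ C" "\<And>q. finite q \<Longrightarrow> q \<subseteq> p \<Longrightarrow> \<exists>l\<in>tup n. \<forall>\<phi>\<in>q. gsat C (app l e) \<phi>"
  shows "\<exists>l\<in>tup n. \<forall>\<phi>\<in>p. gsat C (app l e) \<phi>"
  using assms(2)
proof (induction n arbitrary: p)
  case 0
  have "gsat C e \<phi>" if "\<phi> \<in> p" for \<phi> using 0[of "{\<phi>}"] that by (auto simp: tup_def)
  then show ?case by (auto simp: tup_def)
next
  case (Suc n)
  define p' where "p' = {Exists (fConj qs) |qs. set qs \<subseteq> p}"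
  have "\<exists>l\<in>tup n. \<forall>\<phi>\<in>q'. gsat C (app l e) \<phi>" if q': "finite q'" "q' \<subseteq> p'" for q'
  proof -
    have "\<exists>qs. set qs \<subseteq> p \<and> \<phi> = Exists (fConj qs)" if "\<phi> \<in> q'" for \<phi> using that q' unfolding p'_def by blast
    then obtain Q where Q: "\<And>\<phi>. \<phi> \<in> q' \<Longrightarrow> set (Q \<phi>) \<subseteq> p \<and> \<phi> = Exists (fConj (Q \<phi>))" by metis
    obtain l where l: "l \<in> tup (Suc n)" "\<forall>\<phi>\<in>(\<Union>\<phi>\<in>q'. set (Q \<phi>)). gsat C (app l e) \<phi>"
      using Suc.prems[of "\<Union>\<phi>\<in>q'. set (Q \<phi>)"] q'(1) Q by blast
    obtain c l' where cl: "l = c # l'" "c \<in> univ C" "l' \<in> tup n" using l(1) by (cases l) (auto simp: tup_def)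
    have "gsat C (app l' e) \<phi>" if \<phi>: "\<phi> \<in> q'" for \<phi>
    proof -
      have "gsat C (case_nat c (app l' e)) (fConj (Q \<phi>))"
        unfolding gsat_fConj[OF univ_ne] using l(2) \<phi> unfolding cl(1) app_Cons by blast
      then have "gsat C (app l' e) (Exists (fConj (Q \<phi>)))" using cl(2) by auto
      then show ?thesis using Q[OF \<phi>] by simp
    qed
    then show ?thesis using cl(3) by blast
  qed
  then obtain l where l: "l \<in> tup n" "\<forall>\<phi>\<in>p'. gsat C (app l e) \<phi>" using Suc.IH[of p'] by blast
  have r: "range (app l e) \<subseteq> univ C" using l(1) assms(1) by (intro range_app) (auto simp: tup_def)
  have "\<exists>c\<in>univ C. \<forall>\<phi>\<in>q. gsat C (case_nat c (app l e)) \<phi>" if q: "finite q" "q \<subseteq> p" for q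
  proof -
    obtain qs where qs: "set qs = q" using finite_list[OF q(1)] by blast
    then have "Exists (fConj qs) \<in> p'" unfolding p'_def using q(2) by blast
    then have "gsat C (app l e) (Exists (fConj qs))" using l(2) by blast
    then show ?thesis unfolding gsat.simps gsat_fConj[OF univ_ne] qs .
  qed
  then obtain c where c: "c \<in> univ C" "\<forall>\<phi>\<in>p. gsat C (case_nat c (app l e)) \<phi>"
    using saturated[unfolded aleph1_saturated_def, rule_format, OF r, of p] by blast
  have "c # l \<in> tup (Suc n)" using c l by (auto simp: tup_def)
  then show ?case using c(2) unfolding app_Cons[symmetric] by blast
qed

text \<open>A Henkin-style enumeration: each existential demand over earlier elements is met at some
  later stage, while the finite stages keep \<open>Good\<close>. Taking inclusion in the universe
  for \<open>Good\<close> gives countable submodels, adding isolation gives the atomic one.\<close>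

lemma generic_model:
  assumes start: "Good l0" and sub: "\<And>l. Good l \<Longrightarrow> set l \<subseteq> univ C"
    and step: "\<And>l \<phi>. Good l \<Longrightarrow> fvars \<phi> \<subseteq> {..length l} \<Longrightarrow> \<exists>c\<in>univ C. gsat C (case_nat c ((!) l)) \<phi> \<Longrightarrow>
      \<exists>c\<in>univ C. Good (l @ [c]) \<and> gsat C (case_nat c ((!) l)) \<phi>"
  shows "\<exists>t. elementary C (range t) \<and> (\<forall>i<length l0. t i = l0 ! i) \<and> (\<forall>k\<ge>length l0. Good (map t [0..<k]))"
proof -
  \<comment> \<open>The code of a formula is the first component of infinitely many
    \<open>k\<close>, so the formula comes up again after its parameters have appeared.\<close>
  define form :: "nat \<Rightarrow> gform" where "form k = from_nat (fst (prod_decode k))" for k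
  define R where "R l c \<longleftrightarrow> c \<in> univ C \<and> (fvars (form (length l)) \<subseteq> {..length l} \<longrightarrow>
      (\<exists>c\<in>univ C. gsat C (case_nat c ((!) l)) (form (length l))) \<longrightarrow> gsat C (case_nat c ((!) l)) (form (length l)))" for l c
  have "\<exists>c. Good (l @ [c]) \<and> R l c" if l: "Good l" for l
  proof (cases "fvars (form (length l)) \<subseteq> {..length l} \<and> (\<exists>c\<in>univ C. gsat C (case_nat c ((!) l)) (form (length l)))")
    case True
    then show ?thesis unfolding R_def using step[OF l] by blast
  next
    case False
    have "\<exists>c\<in>univ C. gsat C (case_nat c ((!) l)) fTrue" using univ_ne gsat_fTrue[OF univ_ne] by blast
    then obtain c where "c \<in> univ C" "Good (l @ [c])" using step[OF l, of fTrue] by auto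
    then show ?thesis unfolding R_def using False by blast
  qed
  then obtain t where t: "\<forall>i<length l0. t i = l0 ! i"
    "\<forall>k\<ge>length l0. Good (map t [0..<k]) \<and> R (map t [0..<k]) (t k)"
    using list_sequence[of Good l0 R] start by blast
  have "elementary C (range t)" unfolding elementary_def
  proof (intro conjI allI impI)
    show "range t \<noteq> {}" by simp
    show sub: "range t \<subseteq> univ C"
    proof
      fix x assume "x \<in> range t"
      then obtain i where i: "x = t i" by blast
      have "length l0 \<le> Suc i + length l0" by simp
      then have "Good (map t [0..<Suc i + length l0])" using t(2) by blast
      then have "set (map t [0..<Suc i + length l0]) \<subseteq> univ C" by (rule sub)
      moreover have "t i \<in> set (map t [0..<Suc i + length l0])" by (auto simp del: upt_Suc)
      ultimately show "x \<in> univ C" unfolding i by blast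
    qed
    fix \<phi> and e :: "nat \<Rightarrow> 'm" assume e: "range e \<subseteq> range t" and ex: "\<exists>c\<in>univ C. gsat C (case_nat c e) \<phi>"
    have "\<forall>n. \<exists>i. e n = t i" using e unfolding image_subset_iff by blast
    then obtain r where r: "\<And>n. e n = t (r n)" by metis
    define \<psi> where "\<psi> = frename \<phi> (case_nat 0 (\<lambda>n. Suc (r n)))"
    have \<psi>: "gsat C (case_nat c t) \<psi> \<longleftrightarrow> gsat C (case_nat c e) \<phi>" for c
      unfolding \<psi>_def gsat_frename by (rule gsat_cong) (auto simp: r split: nat.split)
    obtain m where m: "fvars \<psi> \<subseteq> {..m}" using finite_fvars[of \<psi>] finite_nat_set_iff_bounded_le by auto
    \<comment> \<open>The second component forces the stage to come after \<open>l0\<close> and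
      after all parameters of \<open>\<psi>\<close>.\<close>
    define k where "k = prod_encode (to_nat \<psi>, m + length l0)"
    have k: "k \<ge> m" "k \<ge> length l0" "form k = \<psi>"
      using le_prod_encode_2[of "m + length l0" "to_nat \<psi>"] by (simp_all add: k_def form_def)
    have cong: "gsat C (case_nat c ((!) (map t [0..<k]))) \<psi> \<longleftrightarrow> gsat C (case_nat c t) \<psi>" for c
      by (rule gsat_cong) (use m k(1) in \<open>auto split: nat.split\<close>)
    have "R (map t [0..<k]) (t k)" using t(2) k(2) by blast
    moreover have "fvars \<psi> \<subseteq> {..k}" using m k(1) by auto
    ultimately have "gsat C (case_nat (t k) t) \<psi>"
      using ex unfolding R_def by (simp add: k(3) cong \<psi>)
    then show "\<exists>c\<in>range t. gsat C (case_nat c e) \<phi>" unfolding \<psi> by blast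
  qed
  then show ?thesis using t by blast
qed

lemma loewenheim_skolem: assumes "set l \<subseteq> univ C"
  obtains S where "elementary C S" "countable S" "set l \<subseteq> S"
proof -
  obtain t where t: "elementary C (range t)" "\<forall>i<length l. t i = l ! i"
    using generic_model[of "\<lambda>l. set l \<subseteq> univ C" l] assms by auto
  have "set l \<subseteq> range t" using t(2) by (metis in_set_conv_nth rangeI subsetI)
  then show thesis using that[of "range t"] t(1) by simp
qed

text \<open>\<open>l\<close> lies in some countable elementary submodel, and an isomorphism of that
  model with \<open>S\<close> preserves types.\<close>

lemma types_in_model: assumes "elementary C S" "countable S" "l \<in> tup n"
  shows "\<exists>l'. set l' \<subseteq> S \<and> eqv l l'"
proof -
  obtain S1 where S1: "elementary C S1" "countable S1" "set l \<subseteq> S1"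
    using loewenheim_skolem[of l] assms(3) unfolding tup_def by blast
  obtain f where f: "bij_betw f S1 S" "\<forall>x\<in>S1. \<forall>y\<in>S1. f (mul C x y) = mul C (f x) (f y)"
    using categorical[OF S1(1,2) assms(1,2)] unfolding isomorphic_def by auto
  have "set (map f l) \<subseteq> S" using f(1) S1(3) unfolding bij_betw_def by auto
  moreover have "eqv l (map f l)" by (rule isomorphism_eqv[OF S1(1) assms(1) f(1)]) (use f S1 in auto)
  ultimately show ?thesis by blast
qed

text \<open>The countable models realise only countably many types, so a formula without isolated types
  could be shrunk step by step to avoid all of them.\<close>

lemma isolated_types_dense: assumes "fvars \<phi> \<subseteq> {..<n}" "l \<in> tup n" "sat l \<phi>"
  shows "\<exists>l\<in>tup n. isolated l \<and> sat l \<phi>"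
proof (rule ccontr)
  assume neg: "\<not> ?thesis"
  obtain S where S: "elementary C S" "countable S" using loewenheim_skolem[of "[]"] by auto
  define X where "X = {l. set l \<subseteq> S \<and> length l = n}"
  have "countable X" by (rule countable_subset[OF _ countable_lists[OF S(2)]]) (auto simp: X_def lists_eq_set)
  moreover have "X \<noteq> {}"
  proof -
    obtain d where "d \<in> S" using S unfolding elementary_def by blast
    then have "replicate n d \<in> X" by (auto simp: X_def)
    then show ?thesis by blast
  qed
  ultimately have "range (from_nat_into X) = X" by (intro range_from_nat_into)
  then obtain s where s: "range (s :: nat \<Rightarrow> 'm list) = X" by blast
  have sX: "s k \<in> tup n" for k using s S(1) unfolding X_def tup_def elementary_def by auto
  define P where "P k \<psi> \<longleftrightarrow> fvars \<psi> \<subseteq> {..<n} \<and> (\<exists>l\<in>tup n. sat l \<psi>) \<and> (\<forall>l. sat l \<psi> \<longrightarrow> sat l \<phi>)" for k :: nat and \<psi>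
  have "\<exists>F. \<forall>k. P k (F k) \<and> ((\<forall>l. sat l (F (Suc k)) \<longrightarrow> sat l (F k)) \<and> \<not> sat (s k) (F (Suc k)))"
  proof (rule dependent_nat_choice)
    show "\<exists>\<psi>. P 0 \<psi>" using assms unfolding P_def by blast
    fix \<psi> k assume P: "P k \<psi>"
    show "\<exists>\<psi>'. P (Suc k) \<psi>' \<and> ((\<forall>l. sat l \<psi>' \<longrightarrow> sat l \<psi>) \<and> \<not> sat (s k) \<psi>')"
    proof (cases "sat (s k) \<psi>")
      case False
      then show ?thesis using P unfolding P_def by (intro exI[of _ \<psi>]) auto
    next
      case True
      have "sat (s k) \<phi>" using True P unfolding P_def by blast
      then have "\<not> isolated (s k)" using neg sX by blast
      then have "\<not> isolates \<psi> n" using True sX[of k] unfolding isolated_def tup_def by blast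
      then obtain l1 l2 where l12: "l1 \<in> tup n" "l2 \<in> tup n" "sat l1 \<psi>" "sat l2 \<psi>" "\<not> eqv l1 l2"
        using P unfolding isolates_def P_def by blast
      \<comment> \<open>As \<open>\<psi>\<close> does not isolate the type of \<open>s k\<close>,
        some tuple satisfies it with another type; a formula separating the two is added on the side
        of that tuple.\<close>
      have "\<exists>l\<in>tup n. sat l \<psi> \<and> \<not> eqv (s k) l"
        using l12 eqv_sym eqv_trans by blast
      then obtain l where l: "l \<in> tup n" "sat l \<psi>" "\<not> eqv (s k) l" by blast
      then obtain \<theta> where \<theta>: "fvars \<theta> \<subseteq> {..<n}" "sat (s k) \<theta> \<noteq> sat l \<theta>"
        using sX[of k] unfolding eqv_def tup_def by auto
      define \<psi>' where "\<psi>' = And \<psi> (if sat l \<theta> then \<theta> else Neg \<theta>)"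
      have "P (Suc k) \<psi>'" using P \<theta> l unfolding P_def \<psi>'_def by auto
      moreover have "\<not> sat (s k) \<psi>'" using \<theta> unfolding \<psi>'_def by auto
      moreover have "\<forall>l. sat l \<psi>' \<longrightarrow> sat l \<psi>" unfolding \<psi>'_def by auto
      ultimately show ?thesis by blast
    qed
  qed
  then obtain F where F: "\<And>k. P k (F k)" "\<And>k l. sat l (F (Suc k)) \<Longrightarrow> sat l (F k)" "\<And>k. \<not> sat (s k) (F (Suc k))"
    by blast
  have mono: "sat l (F (k + d)) \<Longrightarrow> sat l (F k)" for l k d by (induction d) (auto dest: F(2))
  obtain d where d: "d \<in> univ C" using univ_ne by blast
  have cong: "gsat C (app l (\<lambda>_. d)) (F k) \<longleftrightarrow> sat l (F k)" if "l \<in> tup n" for l k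
    by (rule app_cong) (use F(1)[of k] that in \<open>auto simp: P_def tup_def\<close>)
  \<comment> \<open>The type of a tuple satisfying every \<open>F k\<close> is realised in
    \<open>S\<close> by some \<open>s k\<close>, which \<open>F (Suc k)\<close> has
    excluded.\<close>
  have "\<exists>l\<in>tup n. \<forall>\<phi>\<in>range F. gsat C (app l (\<lambda>_. d)) \<phi>"
  proof (rule tuple_saturation)
    show "range (\<lambda>_::nat. d) \<subseteq> univ C" using d by auto
    fix q assume q: "finite q" "q \<subseteq> range F"
    obtain K where K: "finite K" "q = F ` K" using finite_subset_image[OF q] by blast
    obtain m where m: "\<forall>k\<in>K. k \<le> m" using K(1) finite_nat_set_iff_bounded_le by blast
    obtain l where l: "l \<in> tup n" "sat l (F m)" using F(1)[of m] unfolding P_def by blast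
    have "sat l (F k)" if k: "k \<in> K" for k using mono[of l k "m - k"] l m k by simp
    then show "\<exists>l\<in>tup n. \<forall>\<phi>\<in>q. gsat C (app l (\<lambda>_. d)) \<phi>" using l(1) cong K(2) by auto
  qed
  then obtain l where l: "l \<in> tup n" "\<And>k. sat l (F k)" using cong by auto
  obtain l' where l': "set l' \<subseteq> S" "eqv l l'" using types_in_model[OF S l(1)] by blast
  have "l' \<in> X" using l' l(1) eqv_length[OF l'(2)] unfolding X_def tup_def by simp
  then obtain k where k: "l' = s k" using s by blast
  have "fvars (F (Suc k)) \<subseteq> {..<length l}" using F(1)[of "Suc k"] l(1) unfolding P_def tup_def by simp
  then have "sat (s k) (F (Suc k))" using eqv_sat[OF l'(2)] l(2) k by blast
  then show False using F(3) by blast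
qed

text \<open>The formula asking for an extension that satisfies \<open>\<chi>\<close> belongs to the
  common type; a witness for \<open>l'\<close> can be taken in any elementary \<open>S\<close>
  around \<open>l'\<close>.\<close>

lemma eqv_extend:
  assumes "eqv l l'" "c \<in> univ C" "fvars \<chi> \<subseteq> {..length l}" "sat (l @ [c]) \<chi>"
    and S: "elementary C S" "set l' \<subseteq> S"
  shows "\<exists>c'\<in>S. sat (l' @ [c']) \<chi>"
proof -
  \<comment> \<open>The last entry becomes variable 0, where \<open>Exists\<close> binds it.\<close>
  define r where "r k = (if k = length l then 0 else Suc k)" for k
  have r: "gsat C (case_nat c e) (frename \<chi> r) \<longleftrightarrow> sat (k @ [c]) \<chi>"
    if "length k = length l" "\<And>i. i < length l \<Longrightarrow> e i = k ! i" for c e k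
    unfolding gsat_frename by (rule gsat_cong) (use assms(3) that in \<open>auto simp: r_def nth_append\<close>)
  have v: "fvars (Exists (frename \<chi> r)) \<subseteq> {..<length l}"
    using assms(3) by (auto simp: fvars_frename r_def subset_iff split: if_splits)
  have "sat l (Exists (frename \<chi> r))" using assms(2,4) r[of l "(!) l"] by auto
  then have "sat l' (Exists (frename \<chi> r))" using eqv_sat[OF assms(1) v] by blast
  then obtain c1 where c1: "c1 \<in> univ C" "sat (l' @ [c1]) \<chi>"
    using r[of l' "(!) l'"] eqv_length[OF assms(1)] by auto
  obtain d where d: "d \<in> S" using S unfolding elementary_def by blast
  have e: "gsat C (case_nat c (app l' (\<lambda>_. d))) (frename \<chi> r) \<longleftrightarrow> sat (l' @ [c]) \<chi>" for c
    by (rule r) (use eqv_length[OF assms(1)] in \<open>auto simp: app_def\<close>)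
  have "range (app l' (\<lambda>_. d)) \<subseteq> S" using S(2) d by (intro range_app) auto
  then show ?thesis using elemD[OF S(1) _ c1(1), of "app l' (\<lambda>_. d)" "frename \<chi> r"] c1(2) unfolding e by blast
qed

lemma elem_univ: "elementary C (univ C)"
  using univ_ne unfolding elementary_def by blast

text \<open>With \<open>\<chi>\<close> isolating \<open>l\<close>, the formula
  \<open>And \<chi> \<phi>'\<close> has an isolated solution \<open>k @ [c1]\<close>. Since
  \<open>k\<close> satisfies \<open>\<chi>\<close>, it has the type of \<open>l\<close>, so a last
  entry with the same isolating formula exists over \<open>l\<close>.\<close>

lemma atomic_model: obtains t where "elementary C (range t)" "\<And>k. isolated (map t [0..<k])"
proof -
  have "\<exists>t. elementary C (range t) \<and> (\<forall>i<length ([] :: 'm list). t i = [] ! i) \<and>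
      (\<forall>k\<ge>length ([] :: 'm list). set (map t [0..<k]) \<subseteq> univ C \<and> isolated (map t [0..<k]))"
  proof (rule generic_model[where Good = "\<lambda>l. set l \<subseteq> univ C \<and> isolated l" and ?l0.0 = "[]"])
    have "isolates fTrue 0" unfolding isolates_def tup_def by (auto simp: eqv_def)
    then have "isolated []" unfolding isolated_def using gsat_fTrue[OF univ_ne] by auto
    then show "set [] \<subseteq> univ C \<and> isolated []" by simp
    fix l \<phi> assume l: "set l \<subseteq> univ C \<and> isolated l" and v: "fvars \<phi> \<subseteq> {..length l}"
      and "\<exists>c\<in>univ C. gsat C (case_nat c ((!) l)) \<phi>"
    then obtain c where c: "c \<in> univ C" "gsat C (case_nat c ((!) l)) \<phi>" by blast
    let ?n = "length l"
    obtain \<chi> where \<chi>: "isolates \<chi> ?n" "sat l \<chi>" using l unfolding isolated_def by blast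
    define \<phi>' where "\<phi>' = frename \<phi> (case_nat ?n (\<lambda>i. i))"
    have \<phi>': "sat (k @ [c]) \<phi>' \<longleftrightarrow> gsat C (case_nat c ((!) k)) \<phi>" if "length k = ?n" for k c
      unfolding \<phi>'_def gsat_frename
      by (rule gsat_cong) (use v that in \<open>auto simp: nth_append split: nat.split\<close>)
    have \<chi>': "sat (k @ [c]) \<chi> \<longleftrightarrow> sat k \<chi>" if "length k = ?n" for k c
      by (rule gsat_cong) (use \<chi>(1) that in \<open>auto simp: isolates_def nth_append\<close>)
    have v': "fvars (And \<chi> \<phi>') \<subseteq> {..<Suc ?n}"
      using \<chi>(1) v by (auto simp: isolates_def \<phi>'_def fvars_frename split: nat.splits)
    have "sat (l @ [c]) (And \<chi> \<phi>')" using \<chi>(2) c(2) by (simp add: \<phi>' \<chi>')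
    moreover have "l @ [c] \<in> tup (Suc ?n)" using l c by (simp add: tup_def)
    ultimately obtain l1 where l1: "l1 \<in> tup (Suc ?n)" "isolated l1" "sat l1 (And \<chi> \<phi>')"
      using isolated_types_dense[OF v'] by blast
    obtain k c1 where k: "l1 = k @ [c1]" using l1(1) by (cases l1 rule: rev_cases) (auto simp: tup_def)
    have kn: "length k = ?n" "k \<in> tup ?n" "c1 \<in> univ C" using l1(1) k by (auto simp: tup_def)
    have "sat k \<chi>" using l1(3) kn unfolding k by (simp add: \<chi>')
    then have "eqv k l" using \<chi> l kn unfolding isolates_def by (auto simp: tup_def)
    obtain \<chi>1 where \<chi>1: "isolates \<chi>1 (Suc ?n)" "sat l1 \<chi>1"
      using l1(1,2) unfolding isolated_def by (auto simp: tup_def)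
    have vv: "fvars (And \<chi>1 \<phi>') \<subseteq> {..length k}"
      using \<chi>1(1) v' kn(1) unfolding isolates_def by auto
    have ss: "sat (k @ [c1]) (And \<chi>1 \<phi>')" using \<chi>1(2) l1(3) unfolding k by simp
    obtain c' where c': "c' \<in> univ C" "sat (l @ [c']) (And \<chi>1 \<phi>')"
      using eqv_extend[OF \<open>eqv k l\<close> kn(3) vv ss elem_univ] l by blast
    have "isolated (l @ [c'])" unfolding isolated_def using \<chi>1(1) c'(2) by auto
    then show "\<exists>c\<in>univ C. (set (l @ [c]) \<subseteq> univ C \<and> isolated (l @ [c])) \<and> gsat C (case_nat c ((!) l)) \<phi>"
      using c' l by (intro bexI[of _ c']) (auto simp: \<phi>')
  qed auto
  then show thesis using that by auto
qed

lemma gsat_Exists_power: "gsat C e ((Exists ^^ n) \<phi>) \<longleftrightarrow> (\<exists>l\<in>tup n. gsat C (app l e) \<phi>)"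
proof (induction n arbitrary: e)
  case 0
  show ?case by (auto simp: tup_def)
next
  case (Suc n)
  have "gsat C e ((Exists ^^ Suc n) \<phi>) \<longleftrightarrow> (\<exists>c\<in>univ C. \<exists>l\<in>tup n. gsat C (app (l @ [c]) e) \<phi>)"
    by (simp add: Suc app_snoc)
  also have "\<dots> \<longleftrightarrow> (\<exists>l\<in>tup (Suc n). gsat C (app l e) \<phi>)"
  proof
    assume "\<exists>c\<in>univ C. \<exists>l\<in>tup n. gsat C (app (l @ [c]) e) \<phi>"
    then obtain c l where "c \<in> univ C" "l \<in> tup n" "gsat C (app (l @ [c]) e) \<phi>" by blast
    then show "\<exists>l\<in>tup (Suc n). gsat C (app l e) \<phi>" by (intro bexI[of _ "l @ [c]"]) (auto simp: tup_def)
  next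
    assume "\<exists>l\<in>tup (Suc n). gsat C (app l e) \<phi>"
    then obtain l where l: "l \<in> tup (Suc n)" "gsat C (app l e) \<phi>" by blast
    then obtain k c where k: "l = k @ [c]" by (cases l rule: rev_cases) (auto simp: tup_def)
    then have "c \<in> univ C" "k \<in> tup n" using l(1) by (auto simp: tup_def)
    then show "\<exists>c\<in>univ C. \<exists>l\<in>tup n. gsat C (app (l @ [c]) e) \<phi>" using l(2) k by blast
  qed
  finally show ?case .
qed

lemma fvars_Exists_power: "fvars ((Exists ^^ n) \<phi>) = {k. n + k \<in> fvars \<phi>}"
  by (induction n) (auto simp: add.commute)

text \<open>The isolating formula says that the tuple is selected from some tuple satisfying
  \<open>\<chi>\<close>; any two of those are equivalent, and so are their selections.\<close>

lemma isolated_select: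
  assumes l: "isolated l" "set l \<subseteq> univ C" and ks: "\<forall>i\<in>set ks. i < length l"
  shows "isolated (map ((!) l) ks)"
proof -
  obtain \<chi> where \<chi>: "isolates \<chi> (length l)" "sat l \<chi>" using l(1) unfolding isolated_def by blast
  let ?k = "length l" and ?n = "length ks"
  have ksj: "ks ! j < ?k" if "j < ?n" for j using ks that by simp
  \<comment> \<open>The first \<open>?k\<close> variables get quantified; variable
    \<open>?k + j\<close> is entry \<open>j\<close> of the selected tuple.\<close>
  define \<theta> where "\<theta> = And \<chi> (fConj (map (\<lambda>j. Eq (Var (?k + j)) (Var (ks ! j))) [0..<?n]))"
  let ?\<psi> = "(Exists ^^ ?k) \<theta>"
  have \<psi>: "sat s ?\<psi> \<longleftrightarrow> (\<exists>k\<in>tup ?k. sat k \<chi> \<and> s = map ((!) k) ks)" if s: "length s = ?n" for s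
  proof -
    have "gsat C (app k ((!) s)) \<theta> \<longleftrightarrow> sat k \<chi> \<and> s = map ((!) k) ks" if k: "k \<in> tup ?k" for k
    proof -
      have "gsat C (app k ((!) s)) \<chi> \<longleftrightarrow> sat k \<chi>"
        by (rule app_cong) (use \<chi>(1) k in \<open>auto simp: isolates_def tup_def\<close>)
      moreover have "gsat C (app k ((!) s)) (fConj (map (\<lambda>j. Eq (Var (?k + j)) (Var (ks ! j))) [0..<?n]))
          \<longleftrightarrow> (\<forall>j<?n. s ! j = k ! (ks ! j))"
        unfolding gsat_fConj[OF univ_ne] using ks k by (auto simp: app_def tup_def)
      moreover have "(\<forall>j<?n. s ! j = k ! (ks ! j)) \<longleftrightarrow> s = map ((!) k) ks"
        using s by (auto simp: list_eq_iff_nth_eq)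
      ultimately show ?thesis unfolding \<theta>_def by simp
    qed
    then show ?thesis unfolding gsat_Exists_power by blast
  qed
  have "isolates ?\<psi> ?n" unfolding isolates_def
  proof (intro conjI ballI impI)
    show "fvars ?\<psi> \<subseteq> {..<?n}" unfolding fvars_Exists_power \<theta>_def
      using \<chi>(1) ksj by (fastforce simp: isolates_def)
    fix s s' assume s: "s \<in> tup ?n" "s' \<in> tup ?n" "sat s ?\<psi>" "sat s' ?\<psi>"
    then obtain k k' where k: "k \<in> tup ?k" "sat k \<chi>" "s = map ((!) k) ks"
      "k' \<in> tup ?k" "sat k' \<chi>" "s' = map ((!) k') ks"
      using \<psi> unfolding tup_def by auto
    then have "eqv k k'" using \<chi>(1) unfolding isolates_def by blast
    then show "eqv s s'" unfolding k(3,6) by (rule eqv_select) (use k(1) ks in \<open>simp add: tup_def\<close>)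
  qed
  moreover have "sat (map ((!) l) ks) ?\<psi>" using \<psi>[of "map ((!) l) ks"] \<chi>(2) l(2) by (auto simp: tup_def)
  ultimately show ?thesis unfolding isolated_def by auto
qed

text \<open>The atomic model realises every type. Its tuples take entries of \<open>t\<close> in any
  order and with repetitions, hence \<open>isolated_select\<close>.\<close>

lemma all_isolated: assumes "l \<in> tup n" shows "isolated l"
proof -
  obtain t where t: "elementary C (range t)" "\<And>k. isolated (map t [0..<k])" using atomic_model by blast
  obtain l' where l': "set l' \<subseteq> range t" "eqv l l'" using types_in_model[OF t(1) _ assms] by auto
  define ks where "ks = map (\<lambda>x. SOME i. t i = x) l'"
  have l'_is: "l' = map t ks"
  proof (rule nth_equalityI)
    fix i assume i: "i < length l'"
    have "l' ! i \<in> range t" using l'(1) nth_mem[OF i] by (rule subsetD)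
    then have "\<exists>j. t j = l' ! i" by auto
    then have "t (SOME j. t j = l' ! i) = l' ! i" by (rule someI_ex)
    then show "l' ! i = map t ks ! i" using i by (simp add: ks_def)
  qed (simp add: ks_def)
  obtain k where k: "\<forall>i\<in>set ks. i < k" using finite_nat_set_iff_bounded[of "set ks"] by auto
  have "isolated (map ((!) (map t [0..<k])) ks)"
    by (rule isolated_select) (use t k in \<open>auto simp: elementary_def\<close>)
  moreover have "map ((!) (map t [0..<k])) ks = l'" unfolding l'_is using k by simp
  ultimately show ?thesis using isolated_eqv eqv_sym[OF l'(2)] by simp
qed

text \<open>The Ryll-Nardzewski theorem.\<close>

lemma finitely_many_types:
  obtains q where "finite q" "\<And>\<chi>. \<chi> \<in> q \<Longrightarrow> isolates \<chi> n" "\<And>l. l \<in> tup n \<Longrightarrow> \<exists>\<chi>\<in>q. sat l \<chi>"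
proof (rule ccontr)
  assume neg: "\<not> thesis"
  obtain d where d: "d \<in> univ C" using univ_ne by blast
  have cong: "gsat C (app l (\<lambda>_. d)) \<chi> \<longleftrightarrow> sat l \<chi>" if "l \<in> tup n" "isolates \<chi> n" for l \<chi>
    by (rule app_cong) (use that in \<open>auto simp: isolates_def tup_def\<close>)
  \<comment> \<open>If no finite set of isolating formulas covers all tuples, their negations are
    finitely satisfiable, and saturation yields a tuple that is not isolated.\<close>
  have "\<exists>l\<in>tup n. \<forall>\<phi>\<in>Neg ` {\<chi>. isolates \<chi> n}. gsat C (app l (\<lambda>_. d)) \<phi>"
  proof (rule tuple_saturation)
    show "range (\<lambda>_::nat. d) \<subseteq> univ C" using d by auto
    fix q assume q: "finite q" "q \<subseteq> Neg ` {\<chi>. isolates \<chi> n}"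
    obtain K where K: "K \<subseteq> {\<chi>. isolates \<chi> n}" "finite K" "q = Neg ` K" using finite_subset_image[OF q] by blast
    have "\<not> (\<forall>l\<in>tup n. \<exists>\<chi>\<in>K. sat l \<chi>)" using neg that[of K] K by blast
    then obtain l where "l \<in> tup n" "\<forall>\<chi>\<in>K. \<not> sat l \<chi>" by blast
    then show "\<exists>l\<in>tup n. \<forall>\<phi>\<in>q. gsat C (app l (\<lambda>_. d)) \<phi>" using K cong by (intro bexI[of _ l]) auto
  qed
  then obtain l where l: "l \<in> tup n" "\<And>\<chi>. isolates \<chi> n \<Longrightarrow> \<not> sat l \<chi>" using cong by auto
  then show False using all_isolated[OF l(1)] unfolding isolated_def tup_def by auto
qed

end

section \<open>The countable model\<close>

context categorical_struct begin

text \<open>A formula isolating \<open>a @ [c]\<close> determines the whole type, so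
  \<open>eqv_extend\<close> for this one formula is enough.\<close>

lemma eqv_extend_eqv:
  assumes "eqv a b" "c \<in> univ C" "set a \<subseteq> univ C" and S: "elementary C S" "set b \<subseteq> S"
  shows "\<exists>d\<in>S. eqv (a @ [c]) (b @ [d])"
proof -
  have "a @ [c] \<in> tup (Suc (length a))" using assms by (simp add: tup_def)
  then have "isolated (a @ [c])" by (rule all_isolated)
  then obtain \<chi> where \<chi>: "isolates \<chi> (Suc (length a))" "sat (a @ [c]) \<chi>"
    unfolding isolated_def by auto
  have "fvars \<chi> \<subseteq> {..length a}" using \<chi>(1) unfolding isolates_def by auto
  then obtain d where d: "d \<in> S" "sat (b @ [d]) \<chi>"
    using eqv_extend[OF assms(1,2) _ \<chi>(2) S] by blast
  have "b @ [d] \<in> tup (Suc (length a))"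
    using S d eqv_length[OF assms(1)] unfolding tup_def elementary_def by auto
  then have "eqv (a @ [c]) (b @ [d])"
    using \<chi> d(2) \<open>a @ [c] \<in> tup (Suc (length a))\<close> unfolding isolates_def by blast
  then show ?thesis using d(1) by blast
qed

text \<open>By back and forth, since all types are isolated.\<close>

lemma homogeneous:
  assumes S: "elementary C S" "countable S" and l: "eqv l l'" "set l \<subseteq> S" "set l' \<subseteq> S"
  shows "\<exists>\<sigma>. bij_betw \<sigma> S S \<and> (\<forall>x\<in>S. \<forall>y\<in>S. \<sigma> (mul C x y) = mul C (\<sigma> x) (\<sigma> y)) \<and> map \<sigma> l = l'"
proof -
  have SC: "S \<subseteq> univ C" and ne: "S \<noteq> {}" using S unfolding elementary_def by auto
  \<comment> \<open>The index is halved and decoded as a pair, so each element of \<open>S\<close>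
    recurs at arbitrarily late even and odd stages: even ones extend the domain, odd ones the
    range.\<close>
  define s where "s k = from_nat_into S (fst (prod_decode (k div 2)))" for k
  have s: "s k \<in> S" for k unfolding s_def by (rule from_nat_into[OF ne])
  have s_onto: "\<exists>k\<ge>K. s k = x \<and> even k" "\<exists>k\<ge>K. s k = x \<and> odd k" if x: "x \<in> S" for x K
  proof -
    obtain m where m: "from_nat_into S m = x" using from_nat_into_surj[OF S(2) x] by blast
    let ?k = "2 * prod_encode (m, K)"
    have "K \<le> prod_encode (m, K)" by (rule le_prod_encode_2)
    then have "K \<le> ?k" "K \<le> Suc ?k" "even ?k" "odd (Suc ?k)" by simp_all
    moreover have "s ?k = x" "s (Suc ?k) = x" unfolding s_def using m by simp_all
    ultimately show "\<exists>k\<ge>K. s k = x \<and> even k" "\<exists>k\<ge>K. s k = x \<and> odd k"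
      by blast+
  qed
  define Good where "Good zs \<longleftrightarrow> set zs \<subseteq> S \<times> S \<and> eqv (map fst zs) (map snd zs)" for zs
  define R where "R zs z \<longleftrightarrow> (if even (length zs) then fst z else snd z) = s (length zs)" for zs :: "('m \<times> 'm) list" and z
  have len: "length l = length l'" using eqv_length[OF l(1)] .
  have start: "Good (zip l l')"
    unfolding Good_def using l len by (auto dest: set_zip_leftD set_zip_rightD)
  have step: "\<exists>z. Good (zs @ [z]) \<and> R zs z" if zs: "Good zs" for zs
  proof -
    have zS: "set (map fst zs) \<subseteq> S" "set (map snd zs) \<subseteq> S" and eq: "eqv (map fst zs) (map snd zs)"
      using zs unfolding Good_def by auto
    let ?c = "s (length zs)"
    have c: "?c \<in> univ C" using s SC by blast
    show ?thesis
    proof (cases "even (length zs)")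
      case True
      obtain d where "d \<in> S" "eqv (map fst zs @ [?c]) (map snd zs @ [d])"
        using eqv_extend_eqv[OF eq c _ S(1) zS(2)] zS SC by blast
      then show ?thesis using zs s True unfolding Good_def R_def by (intro exI[of _ "(?c, d)"]) auto
    next
      case False
      obtain d where "d \<in> S" "eqv (map snd zs @ [?c]) (map fst zs @ [d])"
        using eqv_extend_eqv[OF eqv_sym[OF eq] c _ S(1) zS(1)] zS SC by blast
      then show ?thesis using zs s False eqv_sym unfolding Good_def R_def by (intro exI[of _ "(d, ?c)"]) auto
    qed
  qed
  obtain t where t: "\<And>i. i < length (zip l l') \<Longrightarrow> t i = zip l l' ! i"
    "\<And>k. k \<ge> length (zip l l') \<Longrightarrow> Good (map t [0..<k]) \<and> R (map t [0..<k]) (t k)"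
    using list_sequence[of Good "zip l l'" R, OF start step] by blast
  define K where "K = length (zip l l')"
  define a where "a i = fst (t i)" for i
  define b where "b i = snd (t i)" for i
  have ab: "eqv (map a [0..<k]) (map b [0..<k])" and abS: "set (map a [0..<k]) \<subseteq> S" "set (map b [0..<k]) \<subseteq> S"
    if "k \<ge> K" for k
  proof -
    have "Good (map t [0..<k])" using t(2) that unfolding K_def by blast
    then show "eqv (map a [0..<k]) (map b [0..<k])" "set (map a [0..<k]) \<subseteq> S" "set (map b [0..<k]) \<subseteq> S"
      unfolding Good_def by (auto simp: comp_def a_def[abs_def] b_def[abs_def])
  qed
  have aS: "a i \<in> S" and bS: "b i \<in> S" for i
    using abS[of "Suc i + K"] by (auto simp: image_subset_iff simp del: upt_Suc)
  \<comment> \<open>A formula sees only finitely many variables, so equivalent initial segments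
    suffice. Injectivity and multiplicativity of \<open>\<sigma>\<close> are instances.\<close>
  have sat: "gsat C a \<phi> \<longleftrightarrow> gsat C b \<phi>" for \<phi>
  proof -
    obtain m where m: "fvars \<phi> \<subseteq> {..<m}" using finite_fvars[of \<phi>] finite_nat_iff_bounded by auto
    have v: "fvars \<phi> \<subseteq> {..<length (map a [0..<m + K])}" using m by auto
    have "gsat C a \<phi> \<longleftrightarrow> sat (map a [0..<m + K]) \<phi>" by (rule gsat_cong) (use m in auto)
    also have "\<dots> \<longleftrightarrow> sat (map b [0..<m + K]) \<phi>" by (rule eqv_sat[OF ab v]) simp
    also have "\<dots> \<longleftrightarrow> gsat C b \<phi>" by (rule gsat_cong) (use m in auto)
    finally show ?thesis .
  qed
  have inj: "a i = a k \<longleftrightarrow> b i = b k" for i k using sat[of "Eq (Var i) (Var k)"] by simp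
  have onto: "\<exists>i. a i = x" "\<exists>i. b i = x" if x: "x \<in> S" for x
  proof -
    obtain k where k: "k \<ge> K" "s k = x" "even k" using s_onto(1)[OF x] by blast
    have "R (map t [0..<k]) (t k)" using t(2) k(1) unfolding K_def by blast
    then show "\<exists>i. a i = x" using k unfolding R_def a_def by auto
    obtain k where k: "k \<ge> K" "s k = x" "odd k" using s_onto(2)[OF x] by blast
    have "R (map t [0..<k]) (t k)" using t(2) k(1) unfolding K_def by blast
    then show "\<exists>i. b i = x" using k unfolding R_def b_def by auto
  qed
  define \<sigma> where "\<sigma> x = b (SOME i. a i = x)" for x
  have \<sigma>: "\<sigma> (a i) = b i" for i
  proof -
    have "a (SOME k. a k = a i) = a i" by (rule someI[of _ i]) simp
    then show ?thesis unfolding \<sigma>_def using inj by blast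
  qed
  have "bij_betw \<sigma> S S" unfolding bij_betw_def
  proof
    show "inj_on \<sigma> S"
    proof (rule inj_onI)
      fix x y assume "x \<in> S" "y \<in> S" "\<sigma> x = \<sigma> y"
      moreover obtain i k where "a i = x" "a k = y" using onto(1) calculation by metis
      ultimately show "x = y" using \<sigma> inj by metis
    qed
    show "\<sigma> ` S = S"
    proof
      show "\<sigma> ` S \<subseteq> S" unfolding \<sigma>_def using bS by blast
      show "S \<subseteq> \<sigma> ` S"
      proof
        fix y assume "y \<in> S"
        then obtain i where "b i = y" using onto(2) by blast
        then show "y \<in> \<sigma> ` S" using \<sigma>[of i] aS[of i] by (metis imageI)
      qed
    qed
  qed
  moreover have "\<sigma> (mul C x y) = mul C (\<sigma> x) (\<sigma> y)" if xy: "x \<in> S" "y \<in> S" for x y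
  proof -
    obtain i where i: "a i = x" using onto(1)[OF xy(1)] by blast
    obtain k where k: "a k = y" using onto(1)[OF xy(2)] by blast
    obtain m where m: "a m = mul C x y" using onto(1)[OF elem_mul[OF S(1) struct xy]] by blast
    have "b m = mul C (b i) (b k)" using sat[of "Eq (Var m) (Times (Var i) (Var k))"] m i k by simp
    then show ?thesis using \<sigma>[of m] \<sigma>[of i] \<sigma>[of k] m i k by simp
  qed
  moreover have "map \<sigma> l = l'"
  proof (rule nth_equalityI)
    fix i assume "i < length (map \<sigma> l)"
    then have "i < length (zip l l')" "i < length l" "i < length l'" using len by auto
    then have "a i = l ! i" "b i = l' ! i" using t(1)[of i] unfolding a_def b_def by auto
    then show "map \<sigma> l ! i = l' ! i" using \<sigma>[of i] \<open>i < length l\<close> by simp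
  qed (use len in simp)
  ultimately show ?thesis by blast
qed

end

lemma nth_Cons_case: "(!) (x # xs) = case_nat x ((!) xs)"
  by (auto simp: fun_eq_iff split: nat.split)

text \<open>The countable submodel is transported to \<open>nat\<close> along \<open>j\<close>, so
  that the group fills its type. Saturation and dp-minimality continue to refer to
  \<open>C\<close>.\<close>

locale dp_model = categorical_struct C + tgroup mlt e iv
  for C :: "'m gstruct" and mlt :: "nat \<Rightarrow> nat \<Rightarrow> nat" (infixl "\<cdot>" 70) and e iv +
  fixes j :: "nat \<Rightarrow> 'm"
  assumes inj_j: "inj j" and elem_j: "elementary C (range j)" and j_mlt: "j (x \<cdot> y) = mul C (j x) (j y)"
    and dp: "\<not> (\<exists>\<phi> \<psi> m n (a :: nat \<Rightarrow> 'm list) (b :: nat \<Rightarrow> 'm list).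
          fvars \<phi> \<subseteq> {..m} \<and> fvars \<psi> \<subseteq> {..n} \<and>
          (\<forall>i. length (a i) = m \<and> set (a i) \<subseteq> univ C) \<and>
          (\<forall>j. length (b j) = n \<and> set (b j) \<subseteq> univ C) \<and>
          (\<forall>i j. \<exists>c\<in>univ C.
             (\<forall>i'. holds_at C \<phi> c (a i') \<longleftrightarrow> i' = i) \<and>
             (\<forall>j'. holds_at C \<psi> c (b j') \<longleftrightarrow> j' = j)))"
begin

lemma j_univ: "j x \<in> univ C"
  using elem_j unfolding elementary_def by blast

lemma tup_j: "length l = n \<Longrightarrow> map j l \<in> tup n"
  using j_univ by (auto simp: tup_def)

lemma eqv_aut: assumes "eqv (map j l) (map j l')" obtains \<sigma> where "\<sigma> \<in> aut {}" "map \<sigma> l = l'"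
proof -
  obtain f where f: "bij_betw f (range j) (range j)"
      "\<And>x y. f (mul C (j x) (j y)) = mul C (f (j x)) (f (j y))" "map f (map j l) = map j l'"
    using homogeneous[OF elem_j _ assms] by auto
  define \<sigma> where "\<sigma> x = inv_into UNIV j (f (j x))" for x
  have \<sigma>: "j (\<sigma> x) = f (j x)" for x
    unfolding \<sigma>_def using f(1) unfolding bij_betw_def by (intro f_inv_into_f) auto
  have "\<sigma> \<in> aut {}"
  proof (rule autI)
    show "bij \<sigma>" unfolding bij_def
    proof
      show "inj \<sigma>"
      proof (rule injI)
        fix x y assume "\<sigma> x = \<sigma> y"
        then have "f (j x) = f (j y)" using \<sigma> by metis
        then show "x = y" using f(1) inj_j unfolding bij_betw_def by (meson injD inj_onD rangeI)
      qed
      show "surj \<sigma>"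
        unfolding surj_def
      proof
        fix y
        have "j y \<in> f ` range j" using f(1) unfolding bij_betw_def by simp
        then obtain x where "j y = f (j x)" by blast
        then have "y = \<sigma> x" using \<sigma>[of x] inj_j by (metis injD)
        then show "\<exists>x. y = \<sigma> x" by blast
      qed
    qed
    show "\<sigma> (x \<cdot> y) = \<sigma> x \<cdot> \<sigma> y" for x y
      by (rule injD[OF inj_j]) (simp add: \<sigma> j_mlt f(2))
  qed simp
  moreover have "map \<sigma> l = l'"
  proof -
    have "map j (map \<sigma> l) = map f (map j l)" by (simp add: \<sigma>)
    then have "map j (map \<sigma> l) = map j l'" unfolding f(3) .
    then show ?thesis using inj_j inj_map_eq_map by blast
  qed
  ultimately show thesis using that by blast
qed

text \<open>Tuples satisfying one isolating formula are conjugate, so an invariant set is defined by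
  a finite disjunction of such formulas.\<close>

lemma invariant_definable:
  assumes "\<And>l. l \<in> X \<Longrightarrow> length l = n" "\<And>\<sigma> l. \<sigma> \<in> aut {} \<Longrightarrow> l \<in> X \<Longrightarrow> map \<sigma> l \<in> X"
  obtains \<phi> where "fvars \<phi> \<subseteq> {..<n}" "\<And>l. length l = n \<Longrightarrow> sat (map j l) \<phi> \<longleftrightarrow> l \<in> X"
proof -
  obtain q where q: "finite q" "\<And>\<chi>. \<chi> \<in> q \<Longrightarrow> isolates \<chi> n" "\<And>l. l \<in> tup n \<Longrightarrow> \<exists>\<chi>\<in>q. sat l \<chi>"
    by (rule finitely_many_types) blast
  define q' where "q' = {\<chi> \<in> q. \<exists>l\<in>X. sat (map j l) \<chi>}"
  obtain qs where qs: "set qs = q'" using finite_list[of q'] q(1) unfolding q'_def by auto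
  define \<phi> where "\<phi> = Neg (fConj (map Neg qs))"
  have "fvars \<phi> \<subseteq> {..<n}" unfolding \<phi>_def using qs q(2) unfolding q'_def isolates_def by auto
  moreover have "sat (map j l) \<phi> \<longleftrightarrow> l \<in> X" if l: "length l = n" for l
  proof -
    have "sat (map j l) \<phi> \<longleftrightarrow> (\<exists>\<chi>\<in>q'. sat (map j l) \<chi>)"
      unfolding \<phi>_def by (simp add: gsat_fConj[OF univ_ne] qs)
    also have "\<dots> \<longleftrightarrow> l \<in> X"
    proof
      assume "\<exists>\<chi>\<in>q'. sat (map j l) \<chi>"
      then obtain \<chi> k where \<chi>: "\<chi> \<in> q" "k \<in> X" "sat (map j k) \<chi>" "sat (map j l) \<chi>" unfolding q'_def by blast
      then have "eqv (map j k) (map j l)"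
        using q(2)[OF \<chi>(1)] tup_j[OF l] tup_j[OF assms(1)[OF \<chi>(2)]] unfolding isolates_def by blast
      then obtain \<sigma> where "\<sigma> \<in> aut {}" "map \<sigma> k = l" by (rule eqv_aut)
      then show "l \<in> X" using assms(2) \<chi>(2) by blast
    next
      assume "l \<in> X"
      then show "\<exists>\<chi>\<in>q'. sat (map j l) \<chi>" using q(3)[OF tup_j[OF l]] unfolding q'_def by blast
    qed
    finally show ?thesis .
  qed
  ultimately show thesis using that by blast
qed

text \<open>A formula isolating the type of \<open>x # ps\<close> determines the orbit of
  \<open>x\<close> over \<open>P\<close>.\<close>

lemma finite_orbits_aux: assumes "finite P" shows "finite (range (orb P))"
proof -
  obtain ps where ps: "set ps = P" using finite_list[OF assms] by blast
  obtain q where q: "finite q" "\<And>\<chi>. \<chi> \<in> q \<Longrightarrow> isolates \<chi> (Suc (length ps))"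
    "\<And>l. l \<in> tup (Suc (length ps)) \<Longrightarrow> \<exists>\<chi>\<in>q. sat l \<chi>"
    by (rule finitely_many_types) blast
  have t: "map j (x # ps) \<in> tup (Suc (length ps))" for x by (rule tup_j) simp
  define c where "c x = (SOME \<chi>. \<chi> \<in> q \<and> sat (map j (x # ps)) \<chi>)" for x
  have c: "c x \<in> q \<and> sat (map j (x # ps)) (c x)" for x
    unfolding c_def by (rule someI_ex) (use q(3)[OF t[of x]] in blast)
  have sub: "orb P y \<subseteq> orb P x" if xy: "c x = c y" for x y
  proof -
    have "eqv (map j (x # ps)) (map j (y # ps))"
      using q(2)[of "c x"] c[of x] c[of y] t[of x] t[of y] xy unfolding isolates_def by metis
    then obtain \<sigma> where s: "\<sigma> \<in> aut {}" "map \<sigma> (x # ps) = y # ps" by (rule eqv_aut)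
    then have "\<sigma> \<in> aut P" using ps map_eq_conv[of \<sigma> ps "\<lambda>x. x"] unfolding aut_def by auto
    moreover have "y = \<sigma> x" using s(2) by simp
    ultimately show ?thesis
      unfolding orb_def using aut_comp[of _ P \<sigma>] by (auto simp: image_iff) (metis comp_apply)
  qed
  have "orb P x = orb P (SOME y. c y = c x)" for x
  proof -
    have "c (SOME y. c y = c x) = c x" by (rule someI[of _ x]) simp
    then show ?thesis using sub[of x "SOME y. c y = c x"] sub[of "SOME y. c y = c x" x] by simp
  qed
  then have "range (orb P) \<subseteq> (\<lambda>\<chi>. orb P (SOME y. c y = \<chi>)) ` q" using c by blast
  then show ?thesis using q(1) finite_surj by blast
qed

text \<open>The parameters become variables and the relation is closed under all automorphisms.
  Putting \<open>ps\<close> back recovers \<open>Z\<close>, because an automorphism fixing each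
  entry of \<open>ps\<close> lies in \<open>aut P\<close>.\<close>

lemma relation_definable:
  assumes "finite P" "\<And>\<sigma> x y. \<sigma> \<in> aut P \<Longrightarrow> Z x y \<Longrightarrow> Z (\<sigma> x) (\<sigma> y)"
  obtains \<phi> ps where "fvars \<phi> \<subseteq> {..Suc (length ps)}"
    "\<And>x y. holds_at C \<phi> (j x) (map j (y # ps)) \<longleftrightarrow> Z x y"
proof -
  obtain ps where ps: "set ps = P" using finite_list[OF assms(1)] by blast
  define X where "X = {map \<sigma> (x # y # ps) |\<sigma> x y. \<sigma> \<in> aut {} \<and> Z x y}"
  obtain \<phi> where \<phi>: "fvars \<phi> \<subseteq> {..<Suc (Suc (length ps))}"
    "\<And>l. length l = Suc (Suc (length ps)) \<Longrightarrow> sat (map j l) \<phi> \<longleftrightarrow> l \<in> X"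
  proof (rule invariant_definable[of X "Suc (Suc (length ps))"])
    show "length l = Suc (Suc (length ps))" if "l \<in> X" for l using that unfolding X_def by auto
    show "map \<sigma> l \<in> X" if s: "\<sigma> \<in> aut {}" and l: "l \<in> X" for \<sigma> l
    proof -
      obtain \<tau> x y where t: "l = map \<tau> (x # y # ps)" "\<tau> \<in> aut {}" "Z x y" using l unfolding X_def by blast
      have "map \<sigma> l = map (\<sigma> \<circ> \<tau>) (x # y # ps)" using t by simp
      then show ?thesis unfolding X_def using aut_comp[OF s t(2)] t(3) by blast
    qed
  qed blast
  have "holds_at C \<phi> (j x) (map j (y # ps)) \<longleftrightarrow> Z x y" for x y
  proof -
    have "holds_at C \<phi> (j x) (map j (y # ps)) \<longleftrightarrow> sat (map j (x # y # ps)) \<phi>"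
      unfolding holds_at_def list.map(2)[of j x] nth_Cons_case[of "j x"] ..
    also have "\<dots> \<longleftrightarrow> x # y # ps \<in> X" by (rule \<phi>(2)) simp
    also have "\<dots> \<longleftrightarrow> Z x y"
    proof
      assume "x # y # ps \<in> X"
      then have "\<exists>\<tau> x' y'. x # y # ps = map \<tau> (x' # y' # ps) \<and> \<tau> \<in> aut {} \<and> Z x' y'"
        unfolding X_def mem_Collect_eq .
      then obtain \<tau> x' y' where t: "x # y # ps = map \<tau> (x' # y' # ps)" "\<tau> \<in> aut {}" "Z x' y'"
        by (elim exE conjE)
      then have "map \<tau> ps = map (\<lambda>x. x) ps" by simp
      then have "\<tau> \<in> aut P" using ps t(2) unfolding map_eq_conv aut_def by auto
      then show "Z x y" using assms(2)[of \<tau> x' y'] t(1,3) by simp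
    next
      assume "Z x y"
      then show "x # y # ps \<in> X" unfolding X_def mem_Collect_eq
        by (intro exI[of _ "\<lambda>x. x"] exI[of _ x] exI[of _ y] conjI) (simp_all add: aut_id)
    qed
    finally show ?thesis .
  qed
  moreover have "fvars \<phi> \<subseteq> {..Suc (length ps)}" using \<phi>(1) by auto
  ultimately show thesis using that by blast
qed

lemma not_ale_sequence:
  assumes "\<not> H \<lesssim> K" "sg K"
  obtains h :: "nat \<Rightarrow> nat" where "\<And>i. h i \<in> H" "\<And>i k. iv (h i) \<cdot> h k \<in> K \<longleftrightarrow> i = k"
proof -
  have "infinite (cosets H K)" using assms ale_cosets by blast
  then obtain f :: "nat \<Rightarrow> nat set" where f: "inj f" "range f \<subseteq> cosets H K"
    using infinite_countable_subset by blast
  have "\<exists>h. h \<in> H \<and> f i = (\<cdot>) h ` K" for i using f(2) unfolding cosets_def by blast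
  then obtain h where h: "\<And>i. h i \<in> H" "\<And>i. f i = (\<cdot>) (h i) ` K" by metis
  have "iv (h i) \<cdot> h k \<in> K \<longleftrightarrow> i = k" for i k
    using coset_eq_iff[OF assms(2), of "h i" "h k"] h(2)[of i] h(2)[of k] inj_eq[OF f(1), of i k] by metis
  then show thesis using that h(1) by blast
qed

text \<open>If neither \<open>H\<close> nor \<open>K\<close> were contained in the other up to finite index, then the left cosets of
  \<open>K\<close> and the right cosets of \<open>H\<close> would form a pattern that dp-minimality excludes.\<close>

lemma total_aux:
  assumes "finite P" "invt P H" "invt P K" "sg H" "sg K" shows "H \<lesssim> K \<or> K \<lesssim> H"
proof (rule ccontr)
  assume neg: "\<not> (H \<lesssim> K \<or> K \<lesssim> H)"
  obtain h :: "nat \<Rightarrow> nat" where h: "\<And>i. h i \<in> H" "\<And>i k. iv (h i) \<cdot> h k \<in> K \<longleftrightarrow> i = k"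
    using not_ale_sequence[OF _ assms(5), of H] neg by blast
  obtain g :: "nat \<Rightarrow> nat" where g: "\<And>i. g i \<in> K" "\<And>i k. iv (g i) \<cdot> g k \<in> H \<longleftrightarrow> i = k"
    using not_ale_sequence[OF _ assms(4), of K] neg by blast
  obtain \<phi> ps where \<phi>: "fvars \<phi> \<subseteq> {..Suc (length ps)}"
    "\<And>x y. holds_at C \<phi> (j x) (map j (y # ps)) \<longleftrightarrow> iv y \<cdot> x \<in> K"
  proof (rule relation_definable[OF assms(1), of "\<lambda>x y. iv y \<cdot> x \<in> K"])
    show "iv (\<sigma> y) \<cdot> \<sigma> x \<in> K" if s: "\<sigma> \<in> aut P" and "iv y \<cdot> x \<in> K" for \<sigma> x y
    proof -
      have "\<sigma> (iv y \<cdot> x) \<in> K" using that invt_image[OF assms(3) s] by blast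
      then show ?thesis by (simp add: aut_mlt[OF s] aut_iv[OF s])
    qed
  qed blast
  obtain \<psi> ps' where \<psi>: "fvars \<psi> \<subseteq> {..Suc (length ps')}"
    "\<And>x y. holds_at C \<psi> (j x) (map j (y # ps')) \<longleftrightarrow> x \<cdot> y \<in> H"
  proof (rule relation_definable[OF assms(1), of "\<lambda>x y. x \<cdot> y \<in> H"])
    show "\<sigma> x \<cdot> \<sigma> y \<in> H" if s: "\<sigma> \<in> aut P" and "x \<cdot> y \<in> H" for \<sigma> x y
    proof -
      have "\<sigma> (x \<cdot> y) \<in> H" using that invt_image[OF assms(2) s] by blast
      then show ?thesis by (simp add: aut_mlt[OF s])
    qed
  qed blast
  have "\<exists>c\<in>univ C. (\<forall>i'. holds_at C \<phi> c (map j (h i' # ps)) \<longleftrightarrow> i' = i) \<and>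
      (\<forall>k'. holds_at C \<psi> c (map j (g k' # ps')) \<longleftrightarrow> k' = k)" for i k
  \<comment> \<open>The factor \<open>iv (g k)\<close> on the right lies in \<open>K\<close> and
    does not affect membership in \<open>K\<close>; the factor \<open>h i\<close> on the left lies
    in \<open>H\<close> and does not affect membership in \<open>H\<close>.\<close>
  proof (intro bexI[of _ "j (h i \<cdot> iv (g k))"] conjI allI)
    fix i'
    have "iv (h i') \<cdot> (h i \<cdot> iv (g k)) = (iv (h i') \<cdot> h i) \<cdot> iv (g k)" by simp
    then show "holds_at C \<phi> (j (h i \<cdot> iv (g k))) (map j (h i' # ps)) \<longleftrightarrow> i' = i"
      unfolding \<phi>(2) using sg_mlt_iff'[OF assms(5) sg_iv[OF assms(5) g(1)[of k]], of "iv (h i') \<cdot> h i"]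
        h(2)[of i' i] by simp
  next
    fix k'
    have "(h i \<cdot> iv (g k)) \<cdot> g k' = h i \<cdot> (iv (g k) \<cdot> g k')" by simp
    then show "holds_at C \<psi> (j (h i \<cdot> iv (g k))) (map j (g k' # ps')) \<longleftrightarrow> k' = k"
      unfolding \<psi>(2) using sg_mlt_iff[OF assms(4) h(1)[of i], of "iv (g k) \<cdot> g k'"] g(2)[of k k'] by auto
  qed (rule j_univ)
  then have "\<exists>\<phi> \<psi> m n (a :: nat \<Rightarrow> 'm list) (b :: nat \<Rightarrow> 'm list).
          fvars \<phi> \<subseteq> {..m} \<and> fvars \<psi> \<subseteq> {..n} \<and>
          (\<forall>i. length (a i) = m \<and> set (a i) \<subseteq> univ C) \<and>
          (\<forall>j. length (b j) = n \<and> set (b j) \<subseteq> univ C) \<and>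
          (\<forall>i j. \<exists>c\<in>univ C.
             (\<forall>i'. holds_at C \<phi> c (a i') \<longleftrightarrow> i' = i) \<and>
             (\<forall>j'. holds_at C \<psi> c (b j') \<longleftrightarrow> j' = j))"
    using \<phi>(1) \<psi>(1) j_univ
    by (intro exI[of _ \<phi>] exI[of _ \<psi>] exI[of _ "Suc (length ps)"] exI[of _ "Suc (length ps')"]
        exI[of _ "\<lambda>i. map j (h i # ps)"] exI[of _ "\<lambda>i. map j (g i # ps')"] conjI) auto
  then show False using dp by blast
qed

text \<open>The even and the odd terms of \<open>t\<close> form the two rows of a forbidden pattern:
  \<open>c (2 * i) \<cdot> c (Suc (2 * k))\<close> fails to commute only with
  \<open>t (2 * i)\<close> and \<open>t (Suc (2 * k))\<close>. This handles initial segments of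
  \<open>t\<close>; saturation of \<open>C\<close> provides a witness for all of it.\<close>

lemma no_irredundant_sequence_aux:
  "\<nexists>t :: nat \<Rightarrow> nat. \<forall>k. \<exists>c. \<forall>i<k. \<forall>l<k. c i \<cdot> t l = t l \<cdot> c i \<longleftrightarrow> i \<noteq> l"
proof
  assume "\<exists>t :: nat \<Rightarrow> nat. \<forall>k. \<exists>c. \<forall>i<k. \<forall>l<k. c i \<cdot> t l = t l \<cdot> c i \<longleftrightarrow> i \<noteq> l"
  then obtain t :: "nat \<Rightarrow> nat" where t: "\<And>k. \<exists>c. \<forall>i<k. \<forall>l<k. c i \<cdot> t l = t l \<cdot> c i \<longleftrightarrow> i \<noteq> l" by blast
  define \<phi> where "\<phi> = Neg (Eq (Times (Var 0) (Var 1)) (Times (Var 1) (Var 0)))"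
  have \<phi>: "holds_at C \<phi> c [x] \<longleftrightarrow> mul C c x \<noteq> mul C x c" for c x
    unfolding holds_at_def \<phi>_def by simp
  have ex: "\<exists>c\<in>univ C. \<forall>l. mul C c (j (t l)) \<noteq> mul C (j (t l)) c \<longleftrightarrow> l = 2 * i \<or> l = Suc (2 * k)" for i k
  proof -
    define \<theta> where "\<theta> l = (let \<eta> = Eq (Times (Var 0) (Var (Suc l))) (Times (Var (Suc l)) (Var 0)) in
      if l = 2 * i \<or> l = Suc (2 * k) then Neg \<eta> else \<eta>)" for l
    define env where "env l = j (t l)" for l
    have \<theta>: "gsat C (case_nat c env) (\<theta> l) \<longleftrightarrow>
        (mul C c (j (t l)) \<noteq> mul C (j (t l)) c \<longleftrightarrow> l = 2 * i \<or> l = Suc (2 * k))" for c l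
      unfolding \<theta>_def env_def Let_def by simp
    have "\<exists>c\<in>univ C. \<forall>\<phi>\<in>range \<theta>. gsat C (case_nat c env) \<phi>"
    proof (rule saturated[unfolded aleph1_saturated_def, rule_format])
      show "range env \<subseteq> univ C" unfolding env_def using j_univ by blast
      fix q assume q: "finite q \<and> q \<subseteq> range \<theta>"
      obtain L where L: "finite L" "q = \<theta> ` L" using q finite_subset_image[of q \<theta> UNIV] by auto
      obtain m where m: "\<forall>l\<in>L. l < m" using L(1) finite_nat_set_iff_bounded by blast
      \<comment> \<open>Large enough for the finitely many conditions in \<open>q\<close> and for
        the indices of both factors.\<close>
      define M where "M = Suc (m + 2 * i + 2 * k + 1)"
      obtain c where c: "\<forall>i<M. \<forall>l<M. c i \<cdot> t l = t l \<cdot> c i \<longleftrightarrow> i \<noteq> l" using t by blast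
      let ?a = "c (2 * i)" and ?b = "c (Suc (2 * k))"
      have "gsat C (case_nat (j (?a \<cdot> ?b)) env) (\<theta> l)" if l: "l \<in> L" for l
      proof -
        have "l < M" "2 * i < M" "Suc (2 * k) < M" using l m unfolding M_def by auto
        then have a: "?a \<cdot> t l = t l \<cdot> ?a \<longleftrightarrow> 2 * i \<noteq> l" and b: "?b \<cdot> t l = t l \<cdot> ?b \<longleftrightarrow> Suc (2 * k) \<noteq> l"
          using c by blast+
        have "(?a \<cdot> ?b) \<cdot> t l = t l \<cdot> (?a \<cdot> ?b) \<longleftrightarrow> 2 * i \<noteq> l \<and> Suc (2 * k) \<noteq> l"
        proof (cases "2 * i = l")
          case True
          then have "Suc (2 * k) \<noteq> l" by presburger
          then have "(?a \<cdot> ?b) \<cdot> t l = (?a \<cdot> t l) \<cdot> ?b" using b by simp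
          moreover have "t l \<cdot> (?a \<cdot> ?b) = (t l \<cdot> ?a) \<cdot> ?b" by simp
          ultimately have "(?a \<cdot> ?b) \<cdot> t l = t l \<cdot> (?a \<cdot> ?b) \<longleftrightarrow> ?a \<cdot> t l = t l \<cdot> ?a" by (metis right_cancel)
          then show ?thesis using a True by simp
        next
          case False
          then have "t l \<cdot> (?a \<cdot> ?b) = ?a \<cdot> (t l \<cdot> ?b)" using a by (metis assoc)
          moreover have "(?a \<cdot> ?b) \<cdot> t l = ?a \<cdot> (?b \<cdot> t l)" by simp
          ultimately have "(?a \<cdot> ?b) \<cdot> t l = t l \<cdot> (?a \<cdot> ?b) \<longleftrightarrow> ?b \<cdot> t l = t l \<cdot> ?b" by (metis left_cancel)
          then show ?thesis using b False by simp
        qed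
        then show ?thesis unfolding \<theta> j_mlt[symmetric] inj_eq[OF inj_j] by blast
      qed
      then show "\<exists>c\<in>univ C. \<forall>\<phi>\<in>q. gsat C (case_nat c env) \<phi>" unfolding L(2) using j_univ by blast
    qed
    then show ?thesis using \<theta> by blast
  qed
  have "\<exists>c\<in>univ C. (\<forall>i'. holds_at C \<phi> c [j (t (2 * i'))] \<longleftrightarrow> i' = i) \<and>
      (\<forall>k'. holds_at C \<phi> c [j (t (Suc (2 * k')))] \<longleftrightarrow> k' = k)" for i k
  proof -
    obtain c where c: "c \<in> univ C" "\<And>l. mul C c (j (t l)) \<noteq> mul C (j (t l)) c \<longleftrightarrow> l = 2 * i \<or> l = Suc (2 * k)"
      using ex[of i k] by blast
    have parity: "2 * i' = 2 * i \<or> 2 * i' = Suc (2 * k) \<longleftrightarrow> i' = i"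
      "Suc (2 * k') = 2 * i \<or> Suc (2 * k') = Suc (2 * k) \<longleftrightarrow> k' = k" for i' k' by presburger+
    show ?thesis by (intro bexI[OF _ c(1)] conjI allI) (simp_all only: \<phi> c(2) parity)
  qed
  then have "\<exists>\<phi> \<psi> m n (a :: nat \<Rightarrow> 'm list) (b :: nat \<Rightarrow> 'm list).
          fvars \<phi> \<subseteq> {..m} \<and> fvars \<psi> \<subseteq> {..n} \<and>
          (\<forall>i. length (a i) = m \<and> set (a i) \<subseteq> univ C) \<and>
          (\<forall>j. length (b j) = n \<and> set (b j) \<subseteq> univ C) \<and>
          (\<forall>i j. \<exists>c\<in>univ C.
             (\<forall>i'. holds_at C \<phi> c (a i') \<longleftrightarrow> i' = i) \<and>
             (\<forall>j'. holds_at C \<psi> c (b j') \<longleftrightarrow> j' = j))"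
    using j_univ
    by (intro exI[of _ \<phi>] exI[of _ 1] exI[of _ "\<lambda>i. [j (t (2 * i))]"] exI[of _ "\<lambda>k. [j (t (Suc (2 * k)))]"] conjI)
       (auto simp: \<phi>_def)
  then show False using dp by blast
qed

sublocale dp_group mlt e iv
  by unfold_locales (use finite_orbits_aux total_aux no_irredundant_sequence_aux in auto)

lemma definable_abelian_subgroup:
  obtains \<phi> A where "fvars \<phi> \<subseteq> {0}" "\<And>x. gsat C (\<lambda>_. j x) \<phi> \<longleftrightarrow> x \<in> A" "sg A" "infinite A" "abelian A"
proof -
  obtain A where A: "sg A" "infinite A" "abelian A" "invt {} A"
    using infinite_invariant_abelian_subgroup by blast
  obtain \<phi> where \<phi>: "fvars \<phi> \<subseteq> {..<1}" "\<And>l. length l = 1 \<Longrightarrow> sat (map j l) \<phi> \<longleftrightarrow> l \<in> (\<lambda>x. [x]) ` A"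
  proof (rule invariant_definable[of "(\<lambda>x. [x]) ` A" 1])
    show "map \<sigma> l \<in> (\<lambda>x. [x]) ` A" if s: "\<sigma> \<in> aut {}" and l: "l \<in> (\<lambda>x. [x]) ` A" for \<sigma> and l :: "nat list"
    proof -
      obtain x where "x \<in> A" "l = [x]" using l by blast
      moreover have "\<sigma> x \<in> A" using \<open>x \<in> A\<close> invt_image[OF A(4) s] by blast
      ultimately show ?thesis by simp
    qed
  qed auto
  have "gsat C (\<lambda>_. j x) \<phi> \<longleftrightarrow> x \<in> A" for x
  proof -
    have "gsat C (\<lambda>_. j x) \<phi> \<longleftrightarrow> sat (map j [x]) \<phi>" by (rule gsat_cong) (use \<phi>(1) in auto)
    also have "\<dots> \<longleftrightarrow> x \<in> A" using \<phi>(2)[of "[x]"] by auto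
    finally show ?thesis .
  qed
  moreover have "fvars \<phi> \<subseteq> {0}" using \<phi>(1) by auto
  ultimately show thesis using that A by blast
qed

end

section \<open>Transfer between models\<close>

text \<open>\<open>omega_categorical\<close> speaks of structures on subsets of \<open>nat\<close>,
  so countable structures on other types are copied there.\<close>

lemma countable_copy:
  assumes "is_struct M" "countable (univ M)" "infinite (univ M)"
  shows "\<exists>N :: nat gstruct. is_struct N \<and> infinite (univ N) \<and> isomorphic M N"
proof -
  let ?f = "to_nat_on (univ M)" and ?g = "from_nat_into (univ M)"
  have f: "bij_betw ?f (univ M) UNIV" by (rule to_nat_on_infinite[OF assms(2,3)])
  let ?N = "\<lparr>univ = UNIV, mul = (\<lambda>x y. ?f (mul M (?g x) (?g y)))\<rparr> :: nat gstruct"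
  have "is_struct ?N" by (simp add: is_struct_def)
  moreover have "isomorphic M ?N" unfolding isomorphic_def
    by (rule exI[of _ ?f]) (use f assms(2) in \<open>simp add: from_nat_into_to_nat_on\<close>)
  moreover have "infinite (univ ?N)" by simp
  ultimately show ?thesis by blast
qed

lemma isomorphic_sym: assumes "isomorphic M N" "is_struct M" shows "isomorphic N M"
proof -
  obtain f where f: "bij_betw f (univ M) (univ N)"
    "\<And>x y. x \<in> univ M \<Longrightarrow> y \<in> univ M \<Longrightarrow> f (mul M x y) = mul N (f x) (f y)"
    using assms(1) unfolding isomorphic_def by blast
  let ?g = "inv_into (univ M) f"
  have g: "bij_betw ?g (univ N) (univ M)" using f(1) by (rule bij_betw_inv_into)
  have "?g (mul N x y) = mul M (?g x) (?g y)" if xy: "x \<in> univ N" "y \<in> univ N" for x y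
  proof -
    have gm: "?g x \<in> univ M" "?g y \<in> univ M" using g xy unfolding bij_betw_def by blast+
    then have "mul M (?g x) (?g y) \<in> univ M" using assms(2) by (simp add: is_struct_def)
    moreover have "f (mul M (?g x) (?g y)) = mul N x y"
      using f(2)[OF gm] xy f(1) by (simp add: bij_betw_inv_into_right)
    ultimately show ?thesis using f(1) by (metis bij_betw_inv_into_left)
  qed
  then show ?thesis unfolding isomorphic_def using g by blast
qed

lemma isomorphic_trans: assumes "isomorphic M N" "isomorphic N K" shows "isomorphic M K"
proof -
  obtain f where f: "bij_betw f (univ M) (univ N)"
    "\<And>x y. x \<in> univ M \<Longrightarrow> y \<in> univ M \<Longrightarrow> f (mul M x y) = mul N (f x) (f y)"
    using assms(1) unfolding isomorphic_def by blast
  obtain g where g: "bij_betw g (univ N) (univ K)"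
    "\<And>x y. x \<in> univ N \<Longrightarrow> y \<in> univ N \<Longrightarrow> g (mul N x y) = mul K (g x) (g y)"
    using assms(2) unfolding isomorphic_def by blast
  have "f x \<in> univ N" if "x \<in> univ M" for x using f(1) that unfolding bij_betw_def by blast
  then show ?thesis unfolding isomorphic_def
    by (intro exI[of _ "g \<circ> f"]) (simp add: bij_betw_trans[OF f(1) g(1)] f(2) g(2))
qed

lemma is_model_isomorphic: assumes "isomorphic N M" "is_struct N" "is_model T M" shows "is_model T N"
proof -
  obtain f where f: "bij_betw f (univ N) (univ M)"
    "\<And>x y. x \<in> univ N \<Longrightarrow> y \<in> univ N \<Longrightarrow> f (mul N x y) = mul M (f x) (f y)"
    using assms(1) unfolding isomorphic_def by blast
  have "gsat N e \<phi>" if \<phi>: "\<phi> \<in> T" and e: "range e \<subseteq> univ N" for \<phi> e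
  proof -
    have "range (\<lambda>n. f (e n)) \<subseteq> univ M" using e f(1) unfolding bij_betw_def by blast
    then have "gsat M (\<lambda>n. f (e n)) \<phi>" using assms(3) \<phi> unfolding is_model_def by blast
    then show ?thesis using gsat_isomorphism[OF f assms(2) e] by blast
  qed
  then show ?thesis unfolding is_model_def using assms(2) by blast
qed

lemma elem_is_model: fixes M :: "'a gstruct" assumes "elementary M S" "is_model T M" shows "is_model T (substr M S)"
  unfolding is_model_def
proof (intro conjI ballI allI impI)
  show "is_struct (substr M S)" using assms elem_is_struct unfolding is_model_def by blast
  fix \<phi> and e :: "nat \<Rightarrow> 'a" assume \<phi>: "\<phi> \<in> T" and e: "range e \<subseteq> univ (substr M S)"
  then have "range e \<subseteq> S" "range e \<subseteq> univ M" using assms(1) unfolding elementary_def by auto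
  then show "gsat (substr M S) e \<phi>"
    using elem_gsat[OF assms(1)] assms(2) \<phi> unfolding is_model_def by blast
qed

lemma omega_categorical_isomorphic:
  fixes M N :: "'a gstruct"
  assumes T: "omega_categorical T"
    and M: "is_model T M" "countable (univ M)" "infinite (univ M)"
    and N: "is_model T N" "countable (univ N)" "infinite (univ N)"
  shows "isomorphic M N"
proof -
  obtain K :: "nat gstruct" where K: "\<And>N :: nat gstruct. is_model T N \<Longrightarrow> infinite (univ N) \<Longrightarrow> isomorphic K N" "is_struct K"
    using T unfolding omega_categorical_def is_model_def by blast
  have *: "isomorphic K M \<and> is_struct M" if M: "is_model T M" "countable (univ M)" "infinite (univ M)" for M :: "'a gstruct"
  proof -
    have sM: "is_struct M" using M unfolding is_model_def by blast
    obtain M' :: "nat gstruct" where M': "is_struct M'" "infinite (univ M')" "isomorphic M M'"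
      using countable_copy[OF sM M(2,3)] by blast
    have M'M: "isomorphic M' M" by (rule isomorphic_sym[OF M'(3) sM])
    have "isomorphic K M'" by (rule K(1)[OF is_model_isomorphic[OF M'M M'(1) M(1)] M'(2)])
    then show ?thesis using isomorphic_trans[OF _ M'M] sM by blast
  qed
  have "isomorphic K M" "isomorphic K N" using *[OF M] *[OF N] by auto
  then show ?thesis using isomorphic_sym[OF _ K(2)] isomorphic_trans by blast
qed

text \<open>Meant for formulas in variable 0. All variables are sent to \<open>i\<close>, which
  matches the constant environments in \<open>zero_definable\<close>.\<close>

abbreviation var_inst :: "gform \<Rightarrow> nat \<Rightarrow> gform" where
  "var_inst \<phi> i \<equiv> frename \<phi> (\<lambda>_. i)"

text \<open>\<open>many \<theta> n k\<close> says that \<open>\<theta>\<close> has \<open>n\<close> solutions that differ from the variables below \<open>k\<close>.\<close>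

primrec many :: "gform \<Rightarrow> nat \<Rightarrow> nat \<Rightarrow> gform" where
  "many \<theta> 0 = (\<lambda>k. fTrue)"
| "many \<theta> (Suc n) = (\<lambda>k. Exists (And (var_inst \<theta> 0)
     (And (fConj (map (\<lambda>i. Neg (Eq (Var 0) (Var (Suc i)))) [0..<k])) (many \<theta> n (Suc k)))))"

lemma fvars_many: "fvars (many \<theta> n k) \<subseteq> {..<k}"
proof (induction n arbitrary: k)
  case (Suc n)
  show ?case using Suc[of "Suc k"] by (auto simp: fvars_frename subset_iff)
qed simp

lemma gsat_distinct: "univ M \<noteq> {} \<Longrightarrow>
  gsat M (case_nat c e) (fConj (map (\<lambda>i. Neg (Eq (Var 0) (Var (Suc i)))) [0..<k])) \<longleftrightarrow> c \<notin> e ` {..<k}"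
  by (auto simp: gsat_fConj)

text \<open>With \<open>infinite_if_many\<close> this expresses infinity of a definable set by the
  sentences \<open>many \<theta> n 0\<close>, which transfer between models of a complete
  theory.\<close>

lemma many_if_infinite:
  assumes "infinite {c \<in> univ M. gsat M (\<lambda>_. c) \<theta>}" shows "gsat M e (many \<theta> n k)"
proof (induction n arbitrary: e k)
  case 0
  have "univ M \<noteq> {}" using assms by auto
  then show ?case by (simp add: gsat_fTrue)
next
  case (Suc n)
  have ne: "univ M \<noteq> {}" using assms by auto
  have "infinite ({c \<in> univ M. gsat M (\<lambda>_. c) \<theta>} - e ` {..<k})" using assms by simp
  then obtain c where c: "c \<in> univ M" "gsat M (\<lambda>_. c) \<theta>" "c \<notin> e ` {..<k}"
    by (metis (no_types, lifting) DiffE finite.emptyI mem_Collect_eq ex_in_conv)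
  have "gsat M (case_nat c e) (And (var_inst \<theta> 0)
     (And (fConj (map (\<lambda>i. Neg (Eq (Var 0) (Var (Suc i)))) [0..<k])) (many \<theta> n (Suc k))))"
    unfolding gsat.simps(3) gsat_distinct[OF ne] using c Suc by (simp add: gsat_frename)
  then show ?case unfolding many.simps gsat.simps(4) using c(1) by blast
qed

lemma infinite_if_many:
  assumes ne: "univ M \<noteq> {}" and many: "\<And>n. gsat M e (many \<theta> n 0)"
  shows "infinite {c \<in> univ M. gsat M (\<lambda>_. c) \<theta>}" (is "infinite ?S")
proof
  \<comment> \<open>The induction also has to avoid the elements already named by the first
    \<open>k\<close> variables.\<close>
  have card: "\<exists>X\<subseteq>?S. finite X \<and> card X = n \<and> X \<inter> e ` {..<k} = {}" if "gsat M e (many \<theta> n k)" for n e k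
    using that
  proof (induction n arbitrary: e k)
    case 0
    show ?case by (intro exI[of _ "{}"]) simp
  next
    case (Suc n)
    obtain c where c: "c \<in> univ M" "gsat M (case_nat c e) (And (var_inst \<theta> 0)
       (And (fConj (map (\<lambda>i. Neg (Eq (Var 0) (Var (Suc i)))) [0..<k])) (many \<theta> n (Suc k))))"
      using Suc.prems unfolding many.simps gsat.simps(4) by blast
    then have c': "gsat M (\<lambda>_. c) \<theta>" "c \<notin> e ` {..<k}" "gsat M (case_nat c e) (many \<theta> n (Suc k))"
      unfolding gsat.simps(3) gsat_distinct[OF ne] by (simp_all add: gsat_frename)
    obtain X where X: "X \<subseteq> ?S" "finite X" "card X = n" "X \<inter> case_nat c e ` {..<Suc k} = {}"
      using Suc.IH[OF c'(3)] by blast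
    have "case_nat c e ` {..<Suc k} = insert c (e ` {..<k})"
      by (simp add: lessThan_Suc_eq_insert_0 image_image)
    then have "c \<notin> X" "X \<inter> e ` {..<k} = {}" using X(4) by auto
    then show ?case using X c(1) c' by (intro exI[of _ "insert c X"]) auto
  qed
  assume fin: "finite ?S"
  obtain X where "X \<subseteq> ?S" "card X = Suc (card ?S)" using card[OF many, of "Suc (card ?S)"] by blast
  then show False using card_mono[OF fin, of X] by simp
qed

lemma gsat_closed: "fvars \<phi> = {} \<Longrightarrow> gsat M e \<phi> \<longleftrightarrow> gsat M e' \<phi>"
  by (rule gsat_cong) simp

text \<open>\<open>Th M\<close> is complete: it contains the negation of each sentence false in
  \<open>M\<close>.\<close>

lemma Th_model_gsat: assumes "is_model (Th M) N" "is_struct M" "fvars \<phi> = {}"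
  shows "gsat N e \<phi> \<longleftrightarrow> gsat M e' \<phi>"
proof -
  obtain d where d: "d \<in> univ N" using assms(1) unfolding is_model_def is_struct_def by blast
  have *: "gsat N e \<psi>" if \<psi>: "fvars \<psi> = {}" "gsat M e' \<psi>" for \<psi>
  proof -
    have "\<psi> \<in> Th M" unfolding Th_def using \<psi> gsat_closed[OF \<psi>(1), of M e'] by blast
    then have "gsat N (\<lambda>_. d) \<psi>" using assms(1) d unfolding is_model_def by auto
    then show ?thesis using gsat_closed[OF \<psi>(1), of N e "\<lambda>_. d"] by blast
  qed
  show ?thesis using *[OF assms(3)] *[of "Neg \<phi>"] assms(3) by auto
qed

text \<open>The language has only multiplication, so the neutral element and inverses are
  quantified; the left-sided laws match \<open>tgroup\<close>.\<close>

definition group_axioms :: "gform list" where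
  "group_axioms =
    [fAll (fAll (fAll (Eq (Times (Times (Var 0) (Var (Suc 0))) (Var (Suc (Suc 0))))
        (Times (Var 0) (Times (Var (Suc 0)) (Var (Suc (Suc 0)))))))),
     Exists (fAll (And (Eq (Times (Var (Suc 0)) (Var 0)) (Var 0))
       (Exists (Eq (Times (Var 0) (Var (Suc 0))) (Var (Suc (Suc 0)))))))]"

text \<open>\<open>var_inst\<close> inserts variables, not terms, so a product enters as a bound
  variable. In a group \<open>(y x) x = x\<close> forces \<open>y x\<close> to be neutral without
  naming the neutral element.\<close>

definition abelian_subgroup_axioms :: "gform \<Rightarrow> gform list" where
  "abelian_subgroup_axioms \<phi> =
    [fAll (fAll (fImp (And (var_inst \<phi> 0) (var_inst \<phi> (Suc 0)))
       (Exists (And (var_inst \<phi> 0) (Eq (Var 0) (Times (Var (Suc 0)) (Var (Suc (Suc 0))))))))),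
     fAll (fImp (var_inst \<phi> 0) (Exists (And (var_inst \<phi> 0)
       (Eq (Times (Times (Var 0) (Var (Suc 0))) (Var (Suc 0))) (Var (Suc 0)))))),
     fAll (fAll (fImp (And (var_inst \<phi> 0) (var_inst \<phi> (Suc 0)))
       (Eq (Times (Var 0) (Var (Suc 0))) (Times (Var (Suc 0)) (Var 0)))))]"

lemma gsat_group_axioms: "(\<forall>\<psi>\<in>set group_axioms. gsat M e \<psi>) \<longleftrightarrow>
    (\<forall>x\<in>univ M. \<forall>y\<in>univ M. \<forall>z\<in>univ M. mul M (mul M z y) x = mul M z (mul M y x)) \<and>
    (\<exists>u\<in>univ M. \<forall>x\<in>univ M. mul M u x = x \<and> (\<exists>y\<in>univ M. mul M y x = u))"
  by (simp add: group_axioms_def)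

lemma gsat_abelian_subgroup_axioms:
  fixes M :: "'a gstruct" and \<phi> :: gform
  defines "Q \<equiv> \<lambda>x. gsat M (\<lambda>_. x) \<phi>"
  shows "(\<forall>\<psi>\<in>set (abelian_subgroup_axioms \<phi>). gsat M e \<psi>) \<longleftrightarrow>
    (\<forall>x\<in>univ M. \<forall>y\<in>univ M. Q y \<and> Q x \<longrightarrow> (\<exists>z\<in>univ M. Q z \<and> z = mul M y x)) \<and>
    (\<forall>x\<in>univ M. Q x \<longrightarrow> (\<exists>y\<in>univ M. Q y \<and> mul M (mul M y x) x = x)) \<and>
    (\<forall>x\<in>univ M. \<forall>y\<in>univ M. Q y \<and> Q x \<longrightarrow> mul M y x = mul M x y)"
  by (simp add: abelian_subgroup_axioms_def gsat_frename Q_def)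

lemma fvars_group_axioms: "\<psi> \<in> set group_axioms \<Longrightarrow> fvars \<psi> = {}"
  by (auto simp: group_axioms_def)

lemma fvars_abelian_subgroup_axioms: "\<psi> \<in> set (abelian_subgroup_axioms \<phi>) \<Longrightarrow> fvars \<psi> = {}"
  by (auto simp: abelian_subgroup_axioms_def fvars_frename)

theorem theorem2p9:
  fixes G :: "('a, 'b) monoid_scheme"
    and C :: "'m gstruct"
  assumes "group G"
    and "infinite (carrier G)"
    and "dp_minimal (Th (group_struct G)) C"
    and "omega_categorical (Th (group_struct G))"
  shows "\<exists>H. subgroup H G \<and> infinite H \<and> comm_group (G\<lparr>carrier := H\<rparr>) \<and>
           zero_definable (group_struct G) H"
proof -
  interpret G: group G by fact
  let ?G = "group_struct G"
  have uG: "univ ?G = carrier G" and mG: "mul ?G = mult G" by (simp_all add: group_struct_def)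
  have sG: "is_struct ?G" unfolding is_struct_def uG mG using G.one_closed by auto
  have neG: "univ ?G \<noteq> {}" using uG G.one_closed by blast
  have model: "is_model (Th ?G) C" and sat: "aleph1_saturated C"
    using assms(3) unfolding dp_minimal_def monster_model_def by auto
  have sC: "is_struct C" using model unfolding is_model_def by blast
  have neC: "univ C \<noteq> {}" using sC unfolding is_struct_def by blast
  have transfer: "gsat C e \<phi> \<longleftrightarrow> gsat ?G e' \<phi>" if "fvars \<phi> = {}" for \<phi> e e'
    by (rule Th_model_gsat[OF model sG that])
  \<comment> \<open>Infinity of \<open>G\<close> reaches \<open>C\<close> through the sentences for
    \<open>fTrue\<close>.\<close>
  have infC: "infinite (univ C)"
  proof -
    have "{c \<in> univ ?G. gsat ?G (\<lambda>_. c) fTrue} = carrier G" using gsat_fTrue[OF neG] uG by blast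
    then have "infinite {c \<in> univ ?G. gsat ?G (\<lambda>_. c) fTrue}" using assms(2) by simp
    then have "gsat ?G e (many fTrue n 0)" for e n by (rule many_if_infinite)
    then have "gsat C e (many fTrue n 0)" for e n using transfer fvars_many[of fTrue n 0] by blast
    then have "infinite {c \<in> univ C. gsat C (\<lambda>_. c) fTrue}" by (rule infinite_if_many[OF neC])
    then show ?thesis using finite_subset[of "{c \<in> univ C. gsat C (\<lambda>_. c) fTrue}" "univ C"] by blast
  qed
  interpret C: categorical_struct C
  proof
    fix S S' assume "elementary C S" "countable S" "elementary C S'" "countable S'"
    then show "isomorphic (substr C S) (substr C S')"
      using elem_infinite[OF _ infC] elem_is_model[OF _ model]
      by (intro omega_categorical_isomorphic[OF assms(4)]) auto
  qed (fact sC sat)+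
  obtain S where S: "elementary C S" "countable S" using C.loewenheim_skolem[of "[]"] by auto
  define j where "j = from_nat_into S"
  have "bij_betw j UNIV S" unfolding j_def by (rule bij_betw_from_nat_into[OF S(2) elem_infinite[OF S(1) infC]])
  then have j: "inj j" "range j = S" unfolding bij_betw_def by auto
  have jS: "j x \<in> S" for x using j(2) by blast
  define mlt where "mlt x y = inv_into UNIV j (mul C (j x) (j y))" for x y
  have j_mlt: "j (mlt x y) = mul C (j x) (j y)" for x y
    unfolding mlt_def by (rule f_inv_into_f) (use elem_mul[OF S(1) sC] j(2) in blast)
  have "\<exists>y\<in>carrier G. y \<otimes>\<^bsub>G\<^esub> x = \<one>\<^bsub>G\<^esub>" if "x \<in> carrier G" for x
    using G.l_inv[OF that] G.inv_closed[OF that] by blast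
  then have "\<forall>\<psi>\<in>set group_axioms. gsat ?G (\<lambda>_. \<one>\<^bsub>G\<^esub>) \<psi>"
    unfolding gsat_group_axioms uG mG
    by (intro conjI bexI[of _ "\<one>\<^bsub>G\<^esub>"] G.one_closed) (simp_all add: G.m_assoc)
  \<comment> \<open>From \<open>G\<close> to \<open>C\<close> by the common theory, from
    \<open>C\<close> to \<open>S\<close> by elementarity.\<close>
  then have "\<forall>\<psi>\<in>set group_axioms. gsat (substr C S) (\<lambda>_. j 0) \<psi>"
    using transfer[OF fvars_group_axioms] elem_gsat[OF S(1), of "\<lambda>_. j 0"] j(2) by blast
  then have ax: "\<And>x y z. x \<in> S \<Longrightarrow> y \<in> S \<Longrightarrow> z \<in> S \<Longrightarrow> mul C (mul C z y) x = mul C z (mul C y x)"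
    "\<exists>u\<in>S. \<forall>x\<in>S. mul C u x = x \<and> (\<exists>y\<in>S. mul C y x = u)"
    unfolding gsat_group_axioms by auto
  obtain u where u: "\<And>x. mul C (j u) (j x) = j x" "\<And>x. \<exists>y. mul C (j y) (j x) = j u"
    using ax(2) unfolding j(2)[symmetric] by blast
  obtain iv where iv: "\<And>x. mul C (j (iv x)) (j x) = j u" using u(2) by metis
  interpret D: dp_model C mlt u iv j
  proof
    show "mlt (mlt x y) z = mlt x (mlt y z)" for x y z
      by (rule injD[OF j(1)]) (unfold j_mlt, rule ax(1), use j(2) in auto)
    show "mlt u x = x" for x by (rule injD[OF j(1)]) (simp add: j_mlt u)
    show "mlt (iv x) x = u" for x by (rule injD[OF j(1)]) (simp add: j_mlt iv)
    show "elementary C (range j)" using S(1) j(2) by simp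
  qed (use assms(3) j(1) j_mlt in \<open>simp_all only: dp_minimal_def simp_thms\<close>)
  obtain \<phi> A where A: "fvars \<phi> \<subseteq> {0}" "\<And>x. gsat C (\<lambda>_. j x) \<phi> \<longleftrightarrow> x \<in> A" "D.sg A" "infinite A" "D.abelian A"
    by (rule D.definable_abelian_subgroup) blast
  have Q: "gsat (substr C S) (\<lambda>_. j x) \<phi> \<longleftrightarrow> x \<in> A" for x
    using elem_gsat[OF S(1), of "\<lambda>_. j x"] A(2) j(2) by blast
  \<comment> \<open>The axioms for \<open>\<phi>\<close> are checked in \<open>S\<close>, where
    \<open>A\<close> lives, and then pass back to \<open>G\<close>.\<close>
  have "\<forall>\<psi>\<in>set (abelian_subgroup_axioms \<phi>). gsat (substr C S) (\<lambda>_. j 0) \<psi>"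
    unfolding gsat_abelian_subgroup_axioms
  proof (intro conjI; (intro ballI impI)?)
    fix x y assume "x \<in> univ (substr C S)" "y \<in> univ (substr C S)"
    then obtain a b where ab: "x = j a" "y = j b" unfolding j(2)[symmetric] by auto
    assume "gsat (substr C S) (\<lambda>_. y) \<phi> \<and> gsat (substr C S) (\<lambda>_. x) \<phi>"
    then have AA: "a \<in> A" "b \<in> A" unfolding ab Q by auto
    then have "gsat (substr C S) (\<lambda>_. j (mlt b a)) \<phi>" using Q D.sg_mlt[OF A(3)] by blast
    then show "\<exists>z\<in>univ (substr C S). gsat (substr C S) (\<lambda>_. z) \<phi> \<and> z = mul (substr C S) y x"
      by (intro bexI[of _ "j (mlt b a)"]) (simp_all add: ab j_mlt[symmetric] jS)
    have "mlt b a = mlt a b" using A(5) AA unfolding D.abelian_def by blast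
    then show "mul (substr C S) y x = mul (substr C S) x y" using j_mlt by (metis ab gstruct.select_convs(2))
  next
    fix x assume "x \<in> univ (substr C S)"
    then obtain a where a: "x = j a" unfolding j(2)[symmetric] by auto
    assume "gsat (substr C S) (\<lambda>_. x) \<phi>"
    then have "a \<in> A" unfolding a Q .
    then have "gsat (substr C S) (\<lambda>_. j (iv a)) \<phi>" using Q D.sg_iv[OF A(3)] by blast
    then show "\<exists>y\<in>univ (substr C S). gsat (substr C S) (\<lambda>_. y) \<phi> \<and>
        mul (substr C S) (mul (substr C S) y x) x = x"
      by (intro bexI[of _ "j (iv a)"]) (simp_all add: a iv u jS)
  qed
  then have "\<forall>\<psi>\<in>set (abelian_subgroup_axioms \<phi>). gsat ?G (\<lambda>_. \<one>\<^bsub>G\<^esub>) \<psi>"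
    using transfer[OF fvars_abelian_subgroup_axioms] elem_gsat[OF S(1), of "\<lambda>_. j 0"] j(2) by blast
  then have H: "\<And>x y. x \<in> carrier G \<Longrightarrow> y \<in> carrier G \<Longrightarrow> gsat ?G (\<lambda>_. y) \<phi> \<Longrightarrow> gsat ?G (\<lambda>_. x) \<phi> \<Longrightarrow>
        gsat ?G (\<lambda>_. y \<otimes>\<^bsub>G\<^esub> x) \<phi> \<and> y \<otimes>\<^bsub>G\<^esub> x = x \<otimes>\<^bsub>G\<^esub> y"
      "\<And>x. x \<in> carrier G \<Longrightarrow> gsat ?G (\<lambda>_. x) \<phi> \<Longrightarrow>
        \<exists>y\<in>carrier G. gsat ?G (\<lambda>_. y) \<phi> \<and> (y \<otimes>\<^bsub>G\<^esub> x) \<otimes>\<^bsub>G\<^esub> x = x"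
    unfolding gsat_abelian_subgroup_axioms uG mG by blast+
  define H where "H = {c \<in> univ ?G. gsat ?G (\<lambda>_. c) \<phi>}"
  \<comment> \<open>The image of \<open>A\<close> under \<open>j\<close> consists of solutions in
    \<open>C\<close>, so infinity can be transferred from there.\<close>
  have "infinite {c \<in> univ C. gsat C (\<lambda>_. c) \<phi>}"
  proof
    assume "finite {c \<in> univ C. gsat C (\<lambda>_. c) \<phi>}"
    moreover have "j ` A \<subseteq> {c \<in> univ C. gsat C (\<lambda>_. c) \<phi>}" using A(2) D.j_univ by blast
    ultimately have "finite (j ` A)" by (rule finite_subset[rotated])
    then show False using A(4) j(1) by (meson finite_imageD inj_on_subset subset_UNIV)
  qed
  then have "gsat C e (many \<phi> n 0)" for e n by (rule many_if_infinite)
  then have "gsat ?G e (many \<phi> n 0)" for e n using transfer fvars_many[of \<phi> n 0] by blast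
  then have infH: "infinite H" unfolding H_def
    by (rule infinite_if_many[OF neG])
  have sub: "subgroup H G"
  proof (rule G.subgroupI)
    show "H \<subseteq> carrier G" unfolding H_def uG by blast
    show "H \<noteq> {}" using infH by auto
    show "a \<otimes>\<^bsub>G\<^esub> b \<in> H" if "a \<in> H" "b \<in> H" for a b
      using that H(1)[of b a] unfolding H_def uG by auto
    show "inv\<^bsub>G\<^esub> a \<in> H" if a: "a \<in> H" for a
    proof -
      obtain y where y: "y \<in> carrier G" "gsat ?G (\<lambda>_. y) \<phi>" "(y \<otimes>\<^bsub>G\<^esub> a) \<otimes>\<^bsub>G\<^esub> a = a"
        using H(2)[of a] a unfolding H_def uG by blast
      have aG: "a \<in> carrier G" using a unfolding H_def uG by blast
      have "y \<otimes>\<^bsub>G\<^esub> a = \<one>\<^bsub>G\<^esub>" using G.r_cancel_one[OF aG G.m_closed[OF y(1) aG]] y(3) by simp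
      then have "y = inv\<^bsub>G\<^esub> a" using G.inv_equality[OF _ aG y(1)] by simp
      then show ?thesis unfolding H_def uG using y by blast
    qed
  qed
  have "comm_group (G\<lparr>carrier := H\<rparr>)"
  proof (rule group.group_comm_groupI)
    show "group (G\<lparr>carrier := H\<rparr>)" by (rule subgroup.subgroup_is_group[OF sub assms(1)])
    show "x \<otimes>\<^bsub>G\<lparr>carrier := H\<rparr>\<^esub> y = y \<otimes>\<^bsub>G\<lparr>carrier := H\<rparr>\<^esub> x"
      if "x \<in> carrier (G\<lparr>carrier := H\<rparr>)" "y \<in> carrier (G\<lparr>carrier := H\<rparr>)" for x y
      using that H(1)[of y x] unfolding H_def uG by auto
  qed
  moreover have "zero_definable ?G H" unfolding zero_definable_def H_def using A(1) by blast
  ultimately show ?thesis using sub infH by blast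
qed

end
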